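(* Let $\alpha\in(0,1)$, $T>0$, $r>1$, and let $\Omega\subset\mathbb R^d$ be a bounded Lipschitz domain. Assume that $u\in C^3((0,T],H_0^1(\Omega))$ is the solution to $$\partial_t^\alpha u=\Delta u+f\ \text{ in }(0,T]\times\Omega,\qquad u=0\ \text{ on }(0,T]\times\partial\Omega,\qquad u(0,\cdot)=u^0,$$ and that $|\partial_t^lu(t)|\le C_l(1+t^{\alpha-l})$ (pointwise in $\Omega$) for $l=1,3$ and $0<t\le T$. For $N\ge2$ consider the modified graded mesh $$t_k=T\,\frac{(k+k_0)^r-k_0^r}{(N+k_0)^r-k_0^r},\qquad \tau_k=t_k-t_{k-1},$$ where $$k_0=\min\left\{k\in\{0,1,2,\dots\}:\ \frac{(k+2)^r-(k+1)^r}{(k+1)^r-k^r}\le\rho_{\rm R}\right\},\qquad\rho_{\rm R}=\frac{3+\sqrt{17}}2 ,$$ and let $u^k$, $1\le k\le N$, be the numerical solutions on this mesh of the L2 scheme $$L_k^\alpha u=\Delta u^k+f^k\ \text{ in }\Omega,\qquad u^k=0\ \text{ on }\partial\Omega,\qquad f^k=f(t_k,\cdot),$$ started from $u^0$. Then there is a constant $C$, independent of $N$ and $n$, such that for all $1\le n\le N$ $$\|\nabla u(t_n)-\nabla u^n\|_{L^2(\Omega)}\le\begin{cases}C\,N^{-(2r\alpha+\alpha-1)/2}, & \text{if }1<r<\max\{1,1/\alpha-1\},\\ C\,N^{-r\alpha/2}, & \text{if }\max\{1,1/\alpha-1\}<r<5/\alpha-1,\\ C\,N^{-(5-\alpha)/2},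 & \text{if }r>5/\alpha-1.\end{cases}$$ If $r=1/\alpha-1$ with $\alpha<1/2$, or $r=5/\alpha-1$, then $$\|\nabla u(t_n)-\nabla u^n\|_{L^2(\Omega)}\le C\,N^{-r\alpha/2}\log N\qquad\text{for all }1\le n\le N.$$
   Context: $\partial_t^\alpha u(t)=\frac1{\Gamma(1-\alpha)}\int_0^t\frac{u'(s)}{(t-s)^\alpha}ds$ is the Caputo derivative. The solution $u$ is continuous in time up to $t=0$ with values in $L^2(\Omega)$, with $u(0)=u^0$, and satisfies the equation weakly in space at every $t\in(0,T]$. The scheme is understood weakly: $u^k\in H_0^1(\Omega)$ and $\langle L_k^\alpha u,v\rangle=-\langle\nabla u^k,\nabla v\rangle+\langle f^k,v\rangle$ for all $v\in H_0^1(\Omega)$, with $\langle\cdot,\cdot\rangle$ the $L^2(\Omega)$ inner product. L2 operator (applied to the sequence of numerical solutions $u^0,u^1,\dots$): for $j\ge1$ let $H_2^j$ be the quadratic Lagrange polynomial in $t$ interpolating $u^{j-1},u^j,u^{j+1}$ at $t_{j-1},t_j,t_{j+1}$. Then $$L_1^\alpha u=\frac{u^1-u^0}{\Gamma(2-\alpha)\tau_1^\alpha},\qquad L_k^\alpha u=\frac1{\Gamma(1-\alpha)}\left(\sum_{j=1}^{k-1}\int_{t_{j-1}}^{t_j}\frac{\partial_sH_2^j(s)}{(t_k-s)^\alpha}ds+\int_{t_{k-1}}^{t_k}\frac{\partial_sH_2^{k-1}(s)}{(t_k-s)^\alpha}ds\right),\quad k\ge2.$$ *)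

theory Defs
  imports "HOL-Analysis.Analysis"
begin

section \<open>Bounded Lipschitz domains\<close>

text \<open>
  Near every boundary point, \<open>\<Omega>\<close> is the strict epigraph, in some direction \<open>e\<close>, of a Lipschitz
  function on the hyperplane orthogonal to \<open>e\<close>.
\<close>

definition lipschitz_boundary :: "(real^'d) set \<Rightarrow> bool" where
  "lipschitz_boundary \<Omega> \<longleftrightarrow>
     (\<forall>p\<in>frontier \<Omega>. \<exists>\<delta>>0. \<exists>e. \<exists>\<gamma> :: real^'d \<Rightarrow> real. \<exists>L.
        norm e = 1 \<and> L-lipschitz_on {y. y \<bullet> e = 0} \<gamma> \<and>
        \<Omega> \<inter> ball p \<delta> = {x \<in> ball p \<delta>. \<gamma> (x - (x \<bullet> e) *\<^sub>R e) < x \<bullet> e})"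

definition bounded_lipschitz_domain :: "(real^'d) set \<Rightarrow> bool" where
  "bounded_lipschitz_domain \<Omega> \<longleftrightarrow>
     open \<Omega> \<and> connected \<Omega> \<and> \<Omega> \<noteq> {} \<and> bounded \<Omega> \<and> lipschitz_boundary \<Omega>"


section \<open>The spaces $L^2(\Omega)$ and $H_0^1(\Omega)$\<close>

text \<open>
  Elements of these spaces are represented by functions; two functions that agree almost everywhere
  on \<open>\<Omega>\<close> represent the same element. Everything below is invariant under this identification.
  The values are real numbers (functions) or vectors (gradients).
\<close>

definition L2 :: "(real^'d) set \<Rightarrow> (real^'d \<Rightarrow> 'b::euclidean_space) set" where
  "L2 \<Omega> = {f \<in> borel_measurable (lebesgue_on \<Omega>). integrable (lebesgue_on \<Omega>) (\<lambda>x. (norm (f x))\<^sup>2)}"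

definition L2_inner ::
    "(real^'d) set \<Rightarrow> (real^'d \<Rightarrow> 'b::euclidean_space) \<Rightarrow> (real^'d \<Rightarrow> 'b) \<Rightarrow> real" where
  "L2_inner \<Omega> f g = (\<integral>x. f x \<bullet> g x \<partial>lebesgue_on \<Omega>)"

definition L2_norm :: "(real^'d) set \<Rightarrow> (real^'d \<Rightarrow> 'b::euclidean_space) \<Rightarrow> real" where
  "L2_norm \<Omega> f = sqrt (L2_inner \<Omega> f f)"

definition partial_deriv :: "'d \<Rightarrow> (real^'d \<Rightarrow> real) \<Rightarrow> real^'d \<Rightarrow> real" where
  "partial_deriv i f x = frechet_derivative f (at x) (axis i 1)"

primrec C_k :: "nat \<Rightarrow> (real^'d \<Rightarrow> real) \<Rightarrow> bool" where
  "C_k 0 f \<longleftrightarrow> continuous_on UNIV f"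
| "C_k (Suc k) f \<longleftrightarrow> (\<forall>x. f differentiable (at x)) \<and> (\<forall>i. C_k k (partial_deriv i f))"

text \<open>The space $C_c^\infty(\Omega)$; its elements are extended by zero to the whole space.\<close>

definition test_functions :: "(real^'d) set \<Rightarrow> (real^'d \<Rightarrow> real) set" where
  "test_functions \<Omega> =
     {\<phi>. (\<forall>k. C_k k \<phi>) \<and> compact (closure {x. \<phi> x \<noteq> 0}) \<and> closure {x. \<phi> x \<noteq> 0} \<subseteq> \<Omega>}"

definition has_weak_gradient ::
    "(real^'d) set \<Rightarrow> (real^'d \<Rightarrow> real) \<Rightarrow> (real^'d \<Rightarrow> real^'d) \<Rightarrow> bool" where
  "has_weak_gradient \<Omega> v g \<longleftrightarrow>
     g \<in> L2 \<Omega> \<and>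
     (\<forall>\<phi>\<in>test_functions \<Omega>. \<forall>i.
        L2_inner \<Omega> v (partial_deriv i \<phi>) = - L2_inner \<Omega> (\<lambda>x. g x $ i) \<phi>)"

definition H1 :: "(real^'d) set \<Rightarrow> (real^'d \<Rightarrow> real) set" where
  "H1 \<Omega> = {v \<in> L2 \<Omega>. \<exists>g. has_weak_gradient \<Omega> v g}"

text \<open>The choice is unique up to null sets; it is meaningful for \<open>v \<in> H1 \<Omega>\<close> only.\<close>

definition weak_grad :: "(real^'d) set \<Rightarrow> (real^'d \<Rightarrow> real) \<Rightarrow> real^'d \<Rightarrow> real^'d" where
  "weak_grad \<Omega> v = (SOME g. has_weak_gradient \<Omega> v g)"

definition H1_norm :: "(real^'d) set \<Rightarrow> (real^'d \<Rightarrow> real) \<Rightarrow> real" where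
  "H1_norm \<Omega> v = sqrt ((L2_norm \<Omega> v)\<^sup>2 + (L2_norm \<Omega> (weak_grad \<Omega> v))\<^sup>2)"

text \<open>$H_0^1(\Omega)$ is the closure of $C_c^\infty(\Omega)$ in $H^1(\Omega)$.\<close>

definition H10 :: "(real^'d) set \<Rightarrow> (real^'d \<Rightarrow> real) set" where
  "H10 \<Omega> = {v \<in> H1 \<Omega>. \<exists>\<phi>. (\<forall>n::nat. \<phi> n \<in> test_functions \<Omega>) \<and>
                        (\<lambda>n. H1_norm \<Omega> (\<lambda>x. v x - \<phi> n x)) \<longlonglongrightarrow> 0}"


section \<open>Functions of time with values in $H_0^1(\Omega)$ and $L^2(\Omega)$\<close>

text \<open>
  \<open>C_time_H10 m \<Omega> T u D\<close>: the function \<open>u\<close> belongs to $C^m((0,T],H_0^1(\Omega))$, and \<open>D l\<close>, for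
  \<open>l \<le> m\<close>, is its \<open>l\<close>-th time derivative (one-sided at \<open>T\<close>). Limits are in the $H^1$ norm.
\<close>

definition C_time_H10 ::
    "nat \<Rightarrow> (real^'d) set \<Rightarrow> real \<Rightarrow> (real \<Rightarrow> real^'d \<Rightarrow> real) \<Rightarrow> (nat \<Rightarrow> real \<Rightarrow> real^'d \<Rightarrow> real) \<Rightarrow> bool"
  where
  "C_time_H10 m \<Omega> T u D \<longleftrightarrow>
     (\<forall>t\<in>{0<..T}. D 0 t = u t) \<and>
     (\<forall>l\<le>m. \<forall>t\<in>{0<..T}. D l t \<in> H10 \<Omega>) \<and>
     (\<forall>l\<le>m. \<forall>t\<in>{0<..T}.
        ((\<lambda>s. H1_norm \<Omega> (\<lambda>x. D l s x - D l t x)) \<longlongrightarrow> 0) (at t within {0<..T})) \<and>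
     (\<forall>l<m. \<forall>t\<in>{0<..T}.
        ((\<lambda>s. H1_norm \<Omega> (\<lambda>x. (D l s x - D l t x) / (s - t) - D (Suc l) t x)) \<longlongrightarrow> 0)
          (at t within {0<..T}))"

definition C_time_L2 ::
    "(real^'d) set \<Rightarrow> real \<Rightarrow> (real \<Rightarrow> real^'d \<Rightarrow> real) \<Rightarrow> bool" where
  "C_time_L2 \<Omega> T u \<longleftrightarrow>
     (\<forall>t\<in>{0..T}. u t \<in> L2 \<Omega> \<and>
        ((\<lambda>s. L2_norm \<Omega> (\<lambda>x. u s x - u t x)) \<longlongrightarrow> 0) (at t within {0..T}))"

text \<open>
  The Bochner integral over a time set \<open>S\<close> of finite measure of a function with values in
  $L^2(\Omega)$, defined through approximation by simple functions.
\<close>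

definition L2_simple_function ::
    "(real^'d) set \<Rightarrow> real set \<Rightarrow> (real \<Rightarrow> real^'d \<Rightarrow> real) \<Rightarrow> bool" where
  "L2_simple_function \<Omega> S \<phi> \<longleftrightarrow>
     finite (\<phi> ` S) \<and> \<phi> ` S \<subseteq> L2 \<Omega> \<and> (\<forall>c\<in>\<phi> ` S. {s \<in> S. \<phi> s = c} \<in> sets lebesgue)"

definition L2_simple_integral ::
    "real set \<Rightarrow> (real \<Rightarrow> real^'d \<Rightarrow> real) \<Rightarrow> real^'d \<Rightarrow> real" where
  "L2_simple_integral S \<phi> x = (\<Sum>c\<in>\<phi> ` S. measure lebesgue {s \<in> S. \<phi> s = c} * c x)"

definition has_L2_bochner_integral ::
    "(real^'d) set \<Rightarrow> real set \<Rightarrow> (real \<Rightarrow> real^'d \<Rightarrow> real) \<Rightarrow> (real^'d \<Rightarrow> real) \<Rightarrow> bool" where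
  "has_L2_bochner_integral \<Omega> S g w \<longleftrightarrow>
     (\<forall>s\<in>S. g s \<in> L2 \<Omega>) \<and> w \<in> L2 \<Omega> \<and>
     (\<exists>\<phi> :: nat \<Rightarrow> real \<Rightarrow> real^'d \<Rightarrow> real.
        (\<forall>n. L2_simple_function \<Omega> S (\<phi> n)) \<and>
        (\<forall>n. integrable (lebesgue_on S) (\<lambda>s. L2_norm \<Omega> (\<lambda>x. g s x - \<phi> n s x))) \<and>
        (\<lambda>n. \<integral>s. L2_norm \<Omega> (\<lambda>x. g s x - \<phi> n s x) \<partial>lebesgue_on S) \<longlonglongrightarrow> 0 \<and>
        (\<lambda>n. L2_norm \<Omega> (\<lambda>x. L2_simple_integral S (\<phi> n) x - w x)) \<longlonglongrightarrow> 0)"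

text \<open>
  \<open>has_caputo_derivative \<Omega> \<alpha> u' t w\<close>: the Caputo derivative of order \<open>\<alpha>\<close> at time \<open>t\<close>, of the function
  whose first time derivative is \<open>u'\<close>, exists and equals \<open>w\<close>.
\<close>

definition has_caputo_derivative ::
    "(real^'d) set \<Rightarrow> real \<Rightarrow> (real \<Rightarrow> real^'d \<Rightarrow> real) \<Rightarrow> real \<Rightarrow> (real^'d \<Rightarrow> real) \<Rightarrow> bool" where
  "has_caputo_derivative \<Omega> \<alpha> u' t w \<longleftrightarrow>
     (\<exists>I. has_L2_bochner_integral \<Omega> {0<..<t} (\<lambda>s x. u' s x / (t - s) powr \<alpha>) I \<and>
          w = (\<lambda>x. 1 / Gamma (1 - \<alpha>) * I x))"

text \<open>
  Weak form, at every \<open>t\<close> in \<open>(0,T]\<close>, of the equation $\partial_t^\alpha u=\Delta u+f$; the boundary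
  condition is contained in $u(t)\in H_0^1(\Omega)$. Here \<open>u'\<close> is the time derivative of \<open>u\<close>.
\<close>

definition weak_subdiffusion_eq ::
    "(real^'d) set \<Rightarrow> real \<Rightarrow> real \<Rightarrow> (real \<Rightarrow> real^'d \<Rightarrow> real) \<Rightarrow> (real \<Rightarrow> real^'d \<Rightarrow> real) \<Rightarrow>
     (real \<Rightarrow> real^'d \<Rightarrow> real) \<Rightarrow> bool" where
  "weak_subdiffusion_eq \<Omega> T \<alpha> f u u' \<longleftrightarrow>
     (\<forall>t\<in>{0<..T}. u t \<in> H10 \<Omega> \<and>
        (\<exists>w. has_caputo_derivative \<Omega> \<alpha> u' t w \<and>
             (\<forall>v\<in>H10 \<Omega>. L2_inner \<Omega> w v =
                - L2_inner \<Omega> (weak_grad \<Omega> (u t)) (weak_grad \<Omega> v) + L2_inner \<Omega> (f t) v)))"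


section \<open>The modified graded mesh\<close>

definition rho_R :: real where
  "rho_R = (3 + sqrt 17) / 2"

definition mesh_k0 :: "real \<Rightarrow> nat" where
  "mesh_k0 r = (LEAST k::nat.
     (real (k + 2) powr r - real (k + 1) powr r) / (real (k + 1) powr r - real k powr r) \<le> rho_R)"

definition graded_mesh :: "real \<Rightarrow> real \<Rightarrow> nat \<Rightarrow> nat \<Rightarrow> real" where
  "graded_mesh T r N k =
     T * ((real (k + mesh_k0 r) powr r - real (mesh_k0 r) powr r) /
          (real (N + mesh_k0 r) powr r - real (mesh_k0 r) powr r))"


section \<open>The L2 scheme\<close>

text \<open>
  The operators below act on real sequences; for sequences of functions on \<open>\<Omega>\<close> they are applied
  pointwise in \<open>x\<close>.
\<close>

definition lagrange_interp :: "(nat \<Rightarrow> real) \<Rightarrow> (nat \<Rightarrow> real) \<Rightarrow> nat set \<Rightarrow> real \<Rightarrow> real" where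
  "lagrange_interp t a J s = (\<Sum>i\<in>J. a i * (\<Prod>m\<in>J - {i}. (s - t m) / (t i - t m)))"

definition H2_interp :: "(nat \<Rightarrow> real) \<Rightarrow> (nat \<Rightarrow> real) \<Rightarrow> nat \<Rightarrow> real \<Rightarrow> real" where
  "H2_interp t a j = lagrange_interp t a {j - 1, j, j + 1}"

definition L2_op :: "real \<Rightarrow> (nat \<Rightarrow> real) \<Rightarrow> nat \<Rightarrow> (nat \<Rightarrow> real) \<Rightarrow> real" where
  "L2_op \<alpha> t k a =
     (if k = 1 then (a 1 - a 0) / (Gamma (2 - \<alpha>) * (t 1 - t 0) powr \<alpha>)
      else 1 / Gamma (1 - \<alpha>) *
        ((\<Sum>j=1..k-1. integral {t (j - 1)..t j} (\<lambda>s. deriv (H2_interp t a j) s / (t k - s) powr \<alpha>))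
         + integral {t (k - 1)..t k} (\<lambda>s. deriv (H2_interp t a (k - 1)) s / (t k - s) powr \<alpha>)))"

text \<open>
  \<open>U 0, \<dots>, U N\<close> is a numerical solution on the mesh \<open>t\<close>, started from \<open>u0\<close>.
\<close>

definition L2_scheme_solution ::
    "(real^'d) set \<Rightarrow> real \<Rightarrow> (nat \<Rightarrow> real) \<Rightarrow> nat \<Rightarrow> (real \<Rightarrow> real^'d \<Rightarrow> real) \<Rightarrow> (real^'d \<Rightarrow> real) \<Rightarrow>
     (nat \<Rightarrow> real^'d \<Rightarrow> real) \<Rightarrow> bool" where
  "L2_scheme_solution \<Omega> \<alpha> t N f u0 U \<longleftrightarrow>
     (AE x in lebesgue_on \<Omega>. U 0 x = u0 x) \<and>
     (\<forall>k\<in>{1..N}. U k \<in> H10 \<Omega> \<and>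
        (\<forall>v\<in>H10 \<Omega>. L2_inner \<Omega> (\<lambda>x. L2_op \<alpha> t k (\<lambda>j. U j x)) v =
           - L2_inner \<Omega> (weak_grad \<Omega> (U k)) (weak_grad \<Omega> v) + L2_inner \<Omega> (f (t k)) v))"

end

theory Submission
  imports Defs
begin

text \<open>
  Write \<open>e\<^sup>k = u(t\<^sub>k) - u\<^sup>k\<close> for the error, \<open>\<delta>\<^sub>k = e\<^sup>k - e\<^sup>k\<^sup>-\<^sup>1\<close> for its increments and \<open>R\<^sub>k\<close> for the truncation
  error of the L2 operator at \<open>t\<^sub>k\<close>. The error solves \<open>L\<^sub>k e = \<Delta> e\<^sup>k + R\<^sub>k\<close> weakly. Testing with \<open>\<delta>\<^sub>k\<close>
  and summing over \<open>k\<close>, the Laplacian contributes at least half of \<open>\<parallel>\<nabla>e\<^sup>n\<parallel>\<^sup>2\<close>. If the form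
  \<open>\<Sum>\<^sub>k \<langle>L\<^sub>k e, \<delta>\<^sub>k\<rangle>\<close> is bounded below by a multiple of \<open>\<Sum>\<^sub>k \<tau>\<^sub>k\<^sup>-\<^sup>\<alpha> \<parallel>\<delta>\<^sub>k\<parallel>\<^sup>2\<close>, then the term \<open>\<langle>R\<^sub>k, \<delta>\<^sub>k\<rangle>\<close> can be
  absorbed and \<open>\<parallel>\<nabla>e\<^sup>n\<parallel>\<^sup>2 \<le> C \<Sum>\<^sub>k \<tau>\<^sub>k\<^sup>\<alpha> \<parallel>R\<^sub>k\<parallel>\<^sup>2\<close> (\<open>energy_estimate\<close>). Two facts remain.

  Coercivity (\<open>L2_op_coercive\<close>). Integrating the piecewise quadratic interpolant against the kernel
  \<open>(t\<^sub>k - s)\<^sup>-\<^sup>\<alpha>\<close> writes \<open>L\<^sub>k\<close> as a triangular matrix acting on increments. On a mesh with nondecreasing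
  steps the coefficient of the \<open>j\<close>-th increment lies between the values of the kernel at \<open>t\<^sub>j\<^sub>-\<^sub>1\<close> and
  \<open>t\<^sub>j\<close>, simply because the kernel is increasing and convex. The same holds for the difference of two
  consecutive kernels. Such a matrix is a nonnegative combination of the triangles
  \<open>a \<le> j \<le> k \<le> b\<close>, on each of which \<open>\<Sum> x\<^sub>j x\<^sub>k\<close> is half a square plus half a sum of squares
  (\<open>triangular_form_lower_bound\<close>). What does not fit this pattern is the last cell, on which the
  interpolant of the previous cell is used once more: this leaves a bidiagonal form, as in the
  variable-step BDF2 method. The unused part of the diagonal dominates it as long as the step
  ratios do not exceed 18/5 (\<open>diagonal_margin\<close>), and \<open>\<rho>\<^sub>R < 18/5\<close>. The shift \<open>k\<^sub>0\<close> of the mesh makes the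
  first ratio at most \<open>\<rho>\<^sub>R\<close>, and the ratios decrease.

  Truncation (\<open>truncation_error\<close>). On each cell but the last the derivative of the interpolation
  error has mean zero, so it only sees the increment of the kernel over that cell. Far from \<open>t\<^sub>k\<close> this
  increment is small, near \<open>t\<^sub>k\<close> the increments telescope. The outcome is
  \<open>\<bar>R\<^sub>k\<bar> \<le> C (k\<^sup>\<alpha>\<^sup>-\<^sup>3 + k\<^bsup>1/2 - r(1 + \<alpha>)\<^esup>)\<close>, uniformly in \<open>N\<close>. Since \<open>u\<close> takes values in a function space and the
  bounds on its derivatives hold only almost everywhere in \<open>\<Omega>\<close> at each time, this is proved for the real
  functions \<open>t \<mapsto> \<langle>u(t), \<psi>\<rangle>\<close> and then applied with \<open>\<psi> = R\<^sub>k\<close>.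

  Inserting \<open>\<tau>\<^sub>k \<le> C N\<^sup>-\<^sup>r k\<^sup>r\<^sup>-\<^sup>1\<close> gives
  \<open>\<parallel>\<nabla>e\<^sup>n\<parallel>\<^sup>2 \<le> C N\<^bsup>-r\<alpha>\<^esup> (1 + \<Sum>\<^sub>k k\<^bsup>r\<alpha> + \<alpha> - 6\<^esup>)\<close>, where the sum runs over \<open>k \<le> N\<close>. The sum is bounded,
  logarithmic or a power of \<open>N\<close> according to the sign of \<open>r\<alpha> + \<alpha> - 5\<close>, which is the distinction between
  \<open>r\<close> below, at and above \<open>5/\<alpha> - 1\<close>. For \<open>r < 1/\<alpha> - 1\<close> the rate \<open>N\<^bsup>-r\<alpha>/2\<^esup>\<close> implies the stated one.
\<close>

section \<open>Quadratic forms of monotone triangular kernels\<close>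

text \<open>
  Summation by parts in \<open>j\<close> replaces \<open>x\<^sub>j\<close> by the partial sums \<open>P\<^sub>a\<^sub>k = x\<^sub>a + \<dots> + x\<^sub>k\<close>, weighted with the
  differences \<open>D\<^sub>k\<^sub>a = A\<^sub>k\<^sub>a - A\<^sub>k\<^sub>,\<^sub>a\<^sub>-\<^sub>1\<close>. As \<open>2 x\<^sub>k P\<^sub>a\<^sub>k\<close> equals the increment of \<open>P\<^sub>a\<^sub>k\<^sup>2\<close> in \<open>k\<close> plus \<open>x\<^sub>k\<^sup>2\<close>, and
  \<open>D\<^sub>k\<^sub>a\<close> is nonnegative and nonincreasing in \<open>k\<close>, summation by parts in \<open>k\<close> leaves only nonnegative
  terms besides the diagonal.
\<close>

lemma triangular_form_lower_bound:
  fixes A :: "nat \<Rightarrow> nat \<Rightarrow> real" and x :: "nat \<Rightarrow> real"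
  assumes A0: "\<And>k. A k 0 = 0"
    and inc: "\<And>k a. 1 \<le> a \<Longrightarrow> a \<le> k \<Longrightarrow> A k (a - 1) \<le> A k a"
    and dec: "\<And>k a. 1 \<le> a \<Longrightarrow> a \<le> k \<Longrightarrow> A (Suc k) a - A (Suc k) (a - 1) \<le> A k a - A k (a - 1)"
  shows "(\<Sum>k=1..n. A k k * (x k)\<^sup>2) / 2 \<le> (\<Sum>k=1..n. x k * (\<Sum>j=1..k. A k j * x j))"
proof -
  define D where "D k a = A k a - A k (a - 1)" for k a
  define P where "P a k = (\<Sum>j=a..k. x j)" for a k
  have P_Suc: "P a (Suc k) = P a k + x (Suc k)" if "a \<le> Suc k" for a k
    using that by (simp add: P_def)
  have P_empty: "P (Suc k) k = 0" for k
    by (simp add: P_def)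
  have D_sum: "(\<Sum>a=1..m. D k a) = A k m" for k m
    by (induction m) (auto simp: D_def A0)
  have row: "(\<Sum>j=1..m. A k j * x j) = (\<Sum>a=1..m. D k a * P a m)" for k m
  proof (induction m)
    case (Suc m)
    have "(\<Sum>a=1..Suc m. D k a * P a (Suc m)) = (\<Sum>a=1..Suc m. D k a * P a m + D k a * x (Suc m))"
      by (intro sum.cong) (auto simp: P_Suc algebra_simps)
    also have "\<dots> = (\<Sum>a=1..Suc m. D k a * P a m) + A k (Suc m) * x (Suc m)"
      by (simp only: sum.distrib sum_distrib_right[symmetric] D_sum)
    also have "(\<Sum>a=1..Suc m. D k a * P a m) = (\<Sum>a=1..m. D k a * P a m)"
      by (simp add: P_empty)
    finally show ?case using Suc by simp
  qed simp
  \<comment> \<open>The last sum is what telescoping in \<open>k\<close> leaves over; keeping it makes the induction work.\<close>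
  have "(\<Sum>k=1..n. A k k * (x k)\<^sup>2) / 2 + (\<Sum>a=1..n. D n a * (P a n)\<^sup>2) / 2
          \<le> (\<Sum>k=1..n. x k * (\<Sum>j=1..k. A k j * x j))"
  proof (induction n)
    case (Suc n)
    have "x (Suc n) * (\<Sum>j=1..Suc n. A (Suc n) j * x j)
            = (\<Sum>a=1..Suc n. D (Suc n) a * ((P a (Suc n))\<^sup>2 - (P a n)\<^sup>2 + (x (Suc n))\<^sup>2) / 2)"
      unfolding row sum_distrib_left
      by (intro sum.cong) (auto simp: P_Suc power2_eq_square field_simps)
    also have "\<dots> = (\<Sum>a=1..Suc n. D (Suc n) a * (P a (Suc n))\<^sup>2) / 2
        - (\<Sum>a=1..Suc n. D (Suc n) a * (P a n)\<^sup>2) / 2 + (\<Sum>a=1..Suc n. D (Suc n) a) * (x (Suc n))\<^sup>2 / 2"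
      by (simp only: sum_distrib_right sum_divide_distrib sum.distrib[symmetric] sum_subtractf[symmetric])
        (simp add: field_simps)
    also have "(\<Sum>a=1..Suc n. D (Suc n) a * (P a n)\<^sup>2) = (\<Sum>a=1..n. D (Suc n) a * (P a n)\<^sup>2)"
      by (simp add: P_empty)
    also have "(\<Sum>a=1..Suc n. D (Suc n) a) = A (Suc n) (Suc n)"
      by (rule D_sum)
    finally have *: "x (Suc n) * (\<Sum>j=1..Suc n. A (Suc n) j * x j)
        = (\<Sum>a=1..Suc n. D (Suc n) a * (P a (Suc n))\<^sup>2) / 2
        - (\<Sum>a=1..n. D (Suc n) a * (P a n)\<^sup>2) / 2 + A (Suc n) (Suc n) * (x (Suc n))\<^sup>2 / 2" .
    have "(\<Sum>a=1..n. D (Suc n) a * (P a n)\<^sup>2) \<le> (\<Sum>a=1..n. D n a * (P a n)\<^sup>2)"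
      using dec by (intro sum_mono mult_right_mono) (auto simp: D_def)
    with Suc * show ?case
      by (simp add: add_divide_distrib)
  qed simp
  moreover have "0 \<le> (\<Sum>a=1..n. D n a * (P a n)\<^sup>2)"
    using inc by (intro sum_nonneg mult_nonneg_nonneg) (auto simp: D_def)
  ultimately show ?thesis by simp
qed

section \<open>Moments of monotone and convex functions\<close>

lemma has_integral_odd_weight:
  fixes a b :: real assumes "a \<le> b"
  shows "((\<lambda>s. 2 * s - a - b) has_integral 0) {a..b}"
proof -
  have "((\<lambda>s. 2 * s - a - b) has_integral ((b\<^sup>2 - (a + b) * b) - (a\<^sup>2 - (a + b) * a))) {a..b}"
    using assms by (intro fundamental_theorem_of_calculus)
      (auto intro!: derivative_eq_intros simp: has_real_derivative_iff_has_vector_derivative[symmetric])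
  then show ?thesis by (simp add: power2_eq_square algebra_simps)
qed

lemma has_integral_centred_square:
  fixes a b m :: real assumes "a \<le> b"
  shows "((\<lambda>s. 2 * m * (s - (a + b) / 2)\<^sup>2) has_integral m * (b - a) ^ 3 / 6) {a..b}"
proof -
  have "((\<lambda>s. 2 * m * (s - (a + b) / 2)\<^sup>2) has_integral
      (2 * m / 3 * (b - (a + b) / 2) ^ 3 - 2 * m / 3 * (a - (a + b) / 2) ^ 3)) {a..b}"
    using assms by (intro fundamental_theorem_of_calculus)
      (auto intro!: derivative_eq_intros simp: has_real_derivative_iff_has_vector_derivative[symmetric] power2_eq_square)
  moreover have "2 * m / 3 * (b - (a + b) / 2) ^ 3 - 2 * m / 3 * (a - (a + b) / 2) ^ 3 = m * (b - a) ^ 3 / 6"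
    by (simp add: field_simps power3_eq_cube)
  ultimately show ?thesis by (simp only:)
qed

text \<open>
  The weight \<open>2 s - a - b\<close> has mean zero, so \<open>v\<close> may be compared with its value at the midpoint; this
  yields the two bounds on the odd moment below.
\<close>

lemma odd_moment_centred:
  fixes v :: "real \<Rightarrow> real"
  assumes "a \<le> b" "continuous_on {a..b} v"
  shows "integral {a..b} (\<lambda>s. (2 * s - a - b) * v s)
       = integral {a..b} (\<lambda>s. (2 * s - a - b) * (v s - c))"
proof -
  have "((\<lambda>s. (2 * s - a - b) * v s - (2 * s - a - b) * c) has_integral
      (integral {a..b} (\<lambda>s. (2 * s - a - b) * v s) - 0 * c)) {a..b}"
    by (intro has_integral_diff has_integral_mult_left has_integral_odd_weight integrable_integral
        integrable_continuous_real continuous_intros assms)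
  then show ?thesis
    by (intro integral_unique[symmetric]) (simp add: algebra_simps)
qed

lemma odd_moment_nonneg:
  fixes v :: "real \<Rightarrow> real"
  assumes "a \<le> b" "continuous_on {a..b} v" "mono_on {a..b} v"
  shows "0 \<le> integral {a..b} (\<lambda>s. (2 * s - a - b) * v s)"
proof -
  have "0 \<le> integral {a..b} (\<lambda>s. (2 * s - a - b) * (v s - v ((a + b) / 2)))"
  proof (rule integral_nonneg)
    fix s assume s: "s \<in> {a..b}"
    show "0 \<le> (2 * s - a - b) * (v s - v ((a + b) / 2))"
    proof (cases "s \<le> (a + b) / 2")
      case True
      then have "v s \<le> v ((a + b) / 2)" using s by (intro mono_onD[OF assms(3)]) auto
      then show ?thesis using True by (intro mult_nonpos_nonpos) (auto simp: field_simps)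
    next
      case False
      then have "v ((a + b) / 2) \<le> v s" using s by (intro mono_onD[OF assms(3)]) auto
      then show ?thesis using False by (intro mult_nonneg_nonneg) (auto simp: field_simps)
    qed
  qed (intro integrable_continuous_real continuous_intros assms)
  then show ?thesis using odd_moment_centred[OF assms(1,2)] by simp
qed

lemma odd_moment_le:
  fixes v :: "real \<Rightarrow> real"
  assumes "a \<le> b" "continuous_on {a..b} v"
    and slope: "\<And>s s'. a \<le> s \<Longrightarrow> s \<le> s' \<Longrightarrow> s' \<le> b \<Longrightarrow> v s' - v s \<le> m * (s' - s)"
  shows "integral {a..b} (\<lambda>s. (2 * s - a - b) * v s) \<le> m * (b - a) ^ 3 / 6"
proof -
  have "integral {a..b} (\<lambda>s. (2 * s - a - b) * (v s - v ((a + b) / 2))) \<le> m * (b - a) ^ 3 / 6"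
  proof (rule has_integral_le[OF integrable_integral has_integral_centred_square[OF assms(1)]])
    fix s assume s: "s \<in> {a..b}"
    define c where "c = (a + b) / 2"
    have odd: "2 * s - a - b = 2 * (s - c)" by (simp add: c_def field_simps)
    have "(2 * s - a - b) * (v s - v c) \<le> 2 * m * (s - c)\<^sup>2"
    proof (cases "s \<le> c")
      case True
      then have "v c - v s \<le> m * (c - s)" using s by (intro slope) (auto simp: c_def)
      then have "2 * (c - s) * (v c - v s) \<le> 2 * (c - s) * (m * (c - s))"
        using True by (intro mult_left_mono) auto
      then show ?thesis unfolding odd by (simp add: power2_eq_square algebra_simps)
    next
      case False
      then have "v s - v c \<le> m * (s - c)" using s by (intro slope) (auto simp: c_def)
      then have "2 * (s - c) * (v s - v c) \<le> 2 * (s - c) * (m * (s - c))"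
        using False by (intro mult_left_mono) auto
      then show ?thesis unfolding odd by (simp add: power2_eq_square algebra_simps)
    qed
    then show "(2 * s - a - b) * (v s - v ((a + b) / 2)) \<le> 2 * m * (s - (a + b) / 2)\<^sup>2"
      by (simp only: c_def)
  qed (intro integrable_continuous_real continuous_intros assms)
  then show ?thesis using odd_moment_centred[OF assms(1,2)] by simp
qed

text \<open>
  The weight \<open>1 - (2 s - a - b) / c\<close> is nonnegative and has the same integral as 1, so the tilted mean of
  an increasing function is at least its left end value.
\<close>

lemma tilted_integral_ge:
  fixes v :: "real \<Rightarrow> real"
  assumes "a \<le> b" "continuous_on {a..b} v" "mono_on {a..b} v" "b - a \<le> c" "0 < c"
  shows "(b - a) * v a \<le> integral {a..b} v - integral {a..b} (\<lambda>s. (2 * s - a - b) * v s) / c"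
proof -
  have 1: "((\<lambda>s. v s - (2 * s - a - b) * v s / c) has_integral
      (integral {a..b} v - integral {a..b} (\<lambda>s. (2 * s - a - b) * v s) / c)) {a..b}"
    by (intro has_integral_diff has_integral_divide integrable_integral
        integrable_continuous_real continuous_intros assms)
  have 2: "((\<lambda>s. v a - (2 * s - a - b) * v a / c) has_integral ((b - a) * v a - 0 * v a / c)) {a..b}"
    using has_integral_const_real[of "v a" a b] assms(1)
    by (intro has_integral_diff has_integral_divide has_integral_mult_left has_integral_odd_weight) auto
  have "(b - a) * v a - 0 * v a / c \<le> integral {a..b} v - integral {a..b} (\<lambda>s. (2 * s - a - b) * v s) / c"
  proof (rule has_integral_le[OF 2 1])
    fix s assume s: "s \<in> {a..b}"
    have "v a \<le> v s" using s assms by (intro mono_onD[OF assms(3)]) auto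
    moreover have "(2 * s - a - b) / c \<le> 1" using s assms by (simp add: field_simps)
    ultimately have "(1 - (2 * s - a - b) / c) * v a \<le> (1 - (2 * s - a - b) / c) * v s"
      by (intro mult_left_mono) auto
    then show "v a - (2 * s - a - b) * v a / c \<le> v s - (2 * s - a - b) * v s / c"
      by (simp add: algebra_simps)
  qed
  then show ?thesis by simp
qed

lemma integral_le_right_value:
  fixes v :: "real \<Rightarrow> real"
  assumes "a \<le> b" "continuous_on {a..b} v"
    and slope: "\<And>s. a \<le> s \<Longrightarrow> s \<le> b \<Longrightarrow> m * (b - s) \<le> v b - v s"
  shows "integral {a..b} v \<le> (b - a) * v b - m * (b - a)\<^sup>2 / 2"
proof -
  have 1: "((\<lambda>s. v b - m * (b - s)) has_integral
     ((v b * b + m * (b - b)\<^sup>2 / 2) - (v b * a + m * (b - a)\<^sup>2 / 2))) {a..b}"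
    using assms(1) by (intro fundamental_theorem_of_calculus)
      (auto intro!: derivative_eq_intros simp: has_real_derivative_iff_has_vector_derivative[symmetric] field_simps)
  have "integral {a..b} v \<le> (v b * b + m * (b - b)\<^sup>2 / 2) - (v b * a + m * (b - a)\<^sup>2 / 2)"
    using slope by (intro has_integral_le[OF integrable_integral 1] integrable_continuous_real assms) fastforce
  then show ?thesis by (simp add: algebra_simps)
qed

lemma integral_le_left_value:
  fixes v :: "real \<Rightarrow> real"
  assumes "a \<le> b" "continuous_on {a..b} v"
    and slope: "\<And>s. a \<le> s \<Longrightarrow> s \<le> b \<Longrightarrow> v s - v a \<le> m * (s - a)"
  shows "integral {a..b} v \<le> (b - a) * v a + m * (b - a)\<^sup>2 / 2"
proof -
  have 1: "((\<lambda>s. v a + m * (s - a)) has_integral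
     ((v a * b + m * (b - a)\<^sup>2 / 2) - (v a * a + m * (a - a)\<^sup>2 / 2))) {a..b}"
    using assms(1) by (intro fundamental_theorem_of_calculus)
      (auto intro!: derivative_eq_intros simp: has_real_derivative_iff_has_vector_derivative[symmetric] field_simps)
  have "integral {a..b} v \<le> (v a * b + m * (b - a)\<^sup>2 / 2) - (v a * a + m * (a - a)\<^sup>2 / 2)"
    using slope by (intro has_integral_le[OF integrable_integral 1] integrable_continuous_real assms) fastforce
  then show ?thesis by (simp add: algebra_simps)
qed

text \<open>
  The kernels to which this is applied are given by formulas, hence convexity is expressed by a
  monotone derivative. The derivative is two-sided at the ends of the interval.
\<close>

definition convex_increasing :: "real \<Rightarrow> (real \<Rightarrow> real) \<Rightarrow> bool" where
  "convex_increasing b v \<longleftrightarrow>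
     (\<exists>v'. (\<forall>s\<in>{0..b}. (v has_real_derivative v' s) (at s) \<and> 0 \<le> v' s) \<and> mono_on {0..b} v')"

lemma convex_increasing_continuous: "convex_increasing b v \<Longrightarrow> continuous_on {0..b} v"
  unfolding convex_increasing_def
  by (meson DERIV_isCont continuous_at_imp_continuous_on)

text \<open>A supporting slope at \<open>p\<close>: chords to the left of \<open>p\<close> are flatter, chords to the right steeper.\<close>

lemma convex_increasing_slope:
  assumes "convex_increasing b v" "p \<in> {0..b}"
  obtains m where "0 \<le> m"
    "\<And>s s'. 0 \<le> s \<Longrightarrow> s \<le> s' \<Longrightarrow> s' \<le> p \<Longrightarrow> v s' - v s \<le> m * (s' - s)"
    "\<And>s s'. p \<le> s \<Longrightarrow> s \<le> s' \<Longrightarrow> s' \<le> b \<Longrightarrow> m * (s' - s) \<le> v s' - v s"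
proof -
  from assms(1) obtain v' where v': "\<And>s. s \<in> {0..b} \<Longrightarrow> (v has_real_derivative v' s) (at s)"
    "\<And>s. s \<in> {0..b} \<Longrightarrow> 0 \<le> v' s" "mono_on {0..b} v'"
    unfolding convex_increasing_def by blast
  have mvt: "\<exists>z. s < z \<and> z < s' \<and> v s' - v s = (s' - s) * v' z" if "0 \<le> s" "s < s'" "s' \<le> b" for s s'
    using that by (intro MVT2) (auto intro!: v'(1))
  show ?thesis
  proof (rule that[of "v' p"])
    show "0 \<le> v' p" using v'(2) assms(2) .
    show "v s' - v s \<le> v' p * (s' - s)" if ss: "0 \<le> s" "s \<le> s'" "s' \<le> p" for s s'
    proof (cases "s = s'")
      case False
      with ss assms(2) mvt[of s s'] obtain z where z: "s < z" "z < s'" "v s' - v s = (s' - s) * v' z" by auto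
      have "v' z \<le> v' p" using z ss assms(2) by (intro mono_onD[OF v'(3)]) auto
      then show ?thesis using z ss by (simp add: mult.commute mult_right_mono)
    qed simp
    show "v' p * (s' - s) \<le> v s' - v s" if ss: "p \<le> s" "s \<le> s'" "s' \<le> b" for s s'
    proof (cases "s = s'")
      case False
      with ss assms(2) mvt[of s s'] obtain z where z: "s < z" "z < s'" "v s' - v s = (s' - s) * v' z" by auto
      have "v' p \<le> v' z" using z ss assms(2) by (intro mono_onD[OF v'(3)]) auto
      then show ?thesis using z ss by (simp add: mult.commute mult_right_mono)
    qed simp
  qed
qed

lemma convex_increasing_mono:
  assumes "convex_increasing b v"
  shows "mono_on {0..b} v"
proof (rule mono_onI)
  fix s s' assume s: "s \<in> {0..b}" "s' \<in> {0..b}" "s \<le> s'"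
  have "0 \<in> {0..b}" using s by auto
  from convex_increasing_slope[OF assms this] obtain m where m: "0 \<le> m"
    "\<And>s s'. 0 \<le> s \<Longrightarrow> s \<le> s' \<Longrightarrow> s' \<le> b \<Longrightarrow> m * (s' - s) \<le> v s' - v s"
    by metis
  have "0 \<le> m * (s' - s)" using m(1) s by simp
  with m(2)[of s s'] s show "v s \<le> v s'" by auto
qed

lemma convex_increasing_subinterval:
  assumes "convex_increasing b v" "b' \<le> b" shows "convex_increasing b' v"
  using assms unfolding convex_increasing_def
  by (meson atLeastAtMost_iff mono_on_subset order_trans subsetI)

section \<open>The kernel of the Caputo derivative\<close>

lemma has_derivative_reflected_powr:
  fixes T p s :: real
  assumes "s < T"
  shows "((\<lambda>s. (T - s) powr p) has_real_derivative - p * (T - s) powr (p - 1)) (at s)"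
  using assms by (auto intro!: derivative_eq_intros simp: powr_diff field_simps)

lemma has_integral_reflected_powr:
  fixes T p a b :: real
  assumes "- 1 < p" "a \<le> b" "b \<le> T"
  shows "((\<lambda>s. (T - s) powr p) has_integral ((T - a) powr (p + 1) - (T - b) powr (p + 1)) / (p + 1)) {a..b}"
proof -
  let ?G = "\<lambda>s. - ((T - s) powr (p + 1)) / (p + 1)"
  have "((\<lambda>s. (T - s) powr p) has_integral (?G b - ?G a)) {a..b}"
  proof (rule fundamental_theorem_of_calculus_interior)
    show "continuous_on {a..b} ?G"
      using assms by (intro continuous_intros continuous_on_powr') auto
    fix s assume s: "s \<in> {a<..<b}"
    have "(?G has_real_derivative - (- (p + 1) * (T - s) powr (p + 1 - 1)) / (p + 1)) (at s)"
      using s assms by (intro DERIV_cdivide DERIV_minus has_derivative_reflected_powr) auto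
    moreover have "- (- (p + 1) * (T - s) powr (p + 1 - 1)) / (p + 1) = (T - s) powr p"
      using assms by (simp add: field_simps)
    ultimately show "(?G has_vector_derivative (T - s) powr p) (at s)"
      by (simp add: has_real_derivative_iff_has_vector_derivative)
  qed (use assms in auto)
  moreover have "?G b - ?G a = ((T - a) powr (p + 1) - (T - b) powr (p + 1)) / (p + 1)"
    by (simp add: diff_divide_distrib)
  ultimately show ?thesis by (simp only:)
qed

lemma has_integral_kernel_odd:
  fixes T a \<alpha> :: real
  assumes "\<alpha> < 1" "a < T"
  shows "((\<lambda>s. (2 * s - a - T) * (T - s) powr (- \<alpha>)) has_integral
           (T - a) powr (2 - \<alpha>) * (\<alpha> / ((1 - \<alpha>) * (2 - \<alpha>)))) {a..T}"
proof -
  have "((\<lambda>s. (T - a) * (T - s) powr (- \<alpha>) - 2 * (T - s) powr (1 - \<alpha>)) has_integral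
      ((T - a) * (((T - a) powr (- \<alpha> + 1) - (T - T) powr (- \<alpha> + 1)) / (- \<alpha> + 1))
       - 2 * (((T - a) powr (1 - \<alpha> + 1) - (T - T) powr (1 - \<alpha> + 1)) / (1 - \<alpha> + 1)))) {a..T}"
    using assms by (intro has_integral_diff has_integral_mult_right has_integral_reflected_powr) auto
  moreover have "(T - a) * (((T - a) powr (- \<alpha> + 1) - (T - T) powr (- \<alpha> + 1)) / (- \<alpha> + 1))
       - 2 * (((T - a) powr (1 - \<alpha> + 1) - (T - T) powr (1 - \<alpha> + 1)) / (1 - \<alpha> + 1))
       = (T - a) powr (2 - \<alpha>) * (\<alpha> / ((1 - \<alpha>) * (2 - \<alpha>)))"
  proof -
    have e: "(T - a) powr (1 - \<alpha>) * (T - a) = (T - a) powr (2 - \<alpha>)"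
      using assms by (simp add: powr_mult_base[symmetric] mult.commute) (simp add: powr_mult_base)
    have "(T - a) * (((T - a) powr (- \<alpha> + 1) - (T - T) powr (- \<alpha> + 1)) / (- \<alpha> + 1))
       - 2 * (((T - a) powr (1 - \<alpha> + 1) - (T - T) powr (1 - \<alpha> + 1)) / (1 - \<alpha> + 1))
       = ((T - a) powr (1 - \<alpha>) * (T - a)) / (1 - \<alpha>) - 2 * (T - a) powr (2 - \<alpha>) / (2 - \<alpha>)"
      using assms by (simp add: algebra_simps)
    also have "\<dots> = (T - a) powr (2 - \<alpha>) * (1 / (1 - \<alpha>) - 2 / (2 - \<alpha>))"
      unfolding e by (simp add: algebra_simps)
    also have "1 / (1 - \<alpha>) - 2 / (2 - \<alpha>) = \<alpha> / ((1 - \<alpha>) * (2 - \<alpha>))"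
      using assms by (simp add: field_simps)
    finally show ?thesis .
  qed
  ultimately have "((\<lambda>s. (T - a) * (T - s) powr (- \<alpha>) - 2 * (T - s) powr (1 - \<alpha>)) has_integral
      (T - a) powr (2 - \<alpha>) * (\<alpha> / ((1 - \<alpha>) * (2 - \<alpha>)))) {a..T}" by (simp only:)
  moreover have "(T - a) * (T - s) powr (- \<alpha>) - 2 * (T - s) powr (1 - \<alpha>) = (2 * s - a - T) * (T - s) powr (- \<alpha>)"
    if "s \<in> {a..T}" for s
  proof -
    have "(T - s) powr (1 - \<alpha>) = (T - s) * (T - s) powr (- \<alpha>)"
      using that by (cases "s = T") (auto simp: powr_mult_base)
    then show ?thesis by (simp add: algebra_simps)
  qed
  ultimately show ?thesis
    by (rule has_integral_eq[rotated]) auto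
qed

text \<open>The derivative of the difference of two consecutive kernels is monotone for this reason.\<close>

lemma powr_minus_diff_antimono:
  fixes x y h q :: real
  assumes "0 < y" "y \<le> x" "0 \<le> h" "0 < q"
  shows "x powr (- q) - (x + h) powr (- q) \<le> y powr (- q) - (y + h) powr (- q)"
proof (rule DERIV_nonpos_imp_nonincreasing[OF assms(2)])
  fix z assume z: "y \<le> z" "z \<le> x"
  have "((\<lambda>z. z powr (- q) - (z + h) powr (- q)) has_real_derivative
      - q * z powr (- q - 1) - (- q * (z + h) powr (- q - 1))) (at z)"
    using assms z by (auto intro!: derivative_eq_intros simp: powr_diff field_simps)
  moreover have "(z + h) powr (- q - 1) \<le> z powr (- q - 1)"
    using assms z by (intro powr_mono2') auto
  then have "- q * z powr (- q - 1) - (- q * (z + h) powr (- q - 1)) \<le> 0"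
    using assms by simp
  ultimately show "\<exists>d. ((\<lambda>z. z powr (- q) - (z + h) powr (- q)) has_real_derivative d) (at z) \<and> d \<le> 0"
    by blast
qed

lemma powr_le_bernoulli:
  fixes R e :: real
  assumes "1 \<le> R" "0 \<le> e" "e \<le> 1"
  shows "R powr e \<le> 1 + e * (R - 1)"
proof (cases "R = 1")
  case False
  with assms have "\<exists>z. 1 < z \<and> z < R \<and> R powr e - 1 powr e = (R - 1) * (e * z powr (e - 1))"
    by (intro MVT2) (auto intro!: derivative_eq_intros simp: powr_diff)
  then obtain z where z: "1 < z" "R powr e - 1 = (R - 1) * (e * z powr (e - 1))" by auto
  have "z powr (e - 1) \<le> 1" using z assms by (metis diff_le_0_iff_le order_less_imp_le powr_mono powr_zero_eq_one not_one_less_zero)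
  then have "(R - 1) * (e * z powr (e - 1)) \<le> (R - 1) * (e * 1)"
    using assms by (intro mult_left_mono) auto
  with z show ?thesis by (simp add: algebra_simps)
qed auto

text \<open>
  In units of \<open>\<tau>\<^sub>k\<^sup>-\<^sup>\<alpha>\<close> the terms on the right are twice the diagonal coefficient of the L2 operator, twice
  the price of the cross term with the next increment, and the diagonal entry that the monotone kernel
  needs. The constants in the proof come from \<open>R \<le> 18/5\<close>: \<open>R / (1 + R) \<le> 18/23\<close> and
  \<open>R - 1 \<le> 13/5\<close>. With \<open>e = 1 - \<alpha>\<close>, the claim becomes the positivity of a cubic in \<open>e\<close> whose minimum on
  \<open>[0, 1]\<close> is near \<open>e = 17/50\<close>.
\<close>

lemma diagonal_margin:
  fixes \<alpha> R :: real
  assumes "0 < \<alpha>" "\<alpha> < 1" "1 \<le> R" "R \<le> 18/5"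
  shows "1 / 20 \<le> 2 / (1 - \<alpha>) - 2 * (\<alpha> / ((1 - \<alpha>) * (2 - \<alpha>))) * (R powr (2 - \<alpha>) / (1 + R)) - (1 + \<alpha> / 2)"
proof -
  define e where "e = 1 - \<alpha>"
  have e: "0 < e" "e < 1" "\<alpha> = 1 - e" using assms by (auto simp: e_def)
  have "R powr (1 - \<alpha>) \<le> 1 + e * (R - 1)"
    unfolding e_def using assms by (intro powr_le_bernoulli) auto
  also have "\<dots> \<le> 1 + e * (13/5)" using assms e by simp
  finally have 1: "R powr (1 - \<alpha>) \<le> 1 + e * (13/5)" .
  have 2: "R / (1 + R) \<le> 18/23" using assms by (simp add: field_simps)
  have "R powr (2 - \<alpha>) = R * R powr (1 - \<alpha>)" using assms by (simp add: powr_mult_base)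
  then have "R powr (2 - \<alpha>) / (1 + R) = (R / (1 + R)) * R powr (1 - \<alpha>)" by simp
  also have "\<dots> \<le> (18/23) * (1 + e * (13/5))"
    using 1 2 assms by (intro mult_mono) auto
  finally have 3: "R powr (2 - \<alpha>) / (1 + R) \<le> (18/23) * (1 + e * (13/5))" .
  have "2 * (\<alpha> / ((1 - \<alpha>) * (2 - \<alpha>))) * (R powr (2 - \<alpha>) / (1 + R))
      \<le> 2 * (\<alpha> / ((1 - \<alpha>) * (2 - \<alpha>))) * ((18/23) * (1 + e * (13/5)))"
    using assms 3 by (intro mult_left_mono) auto
  moreover have "1 / 20 \<le> 2 / (1 - \<alpha>) - 2 * (\<alpha> / ((1 - \<alpha>) * (2 - \<alpha>))) * ((18/23) * (1 + e * (13/5))) - (1 + \<alpha> / 2)"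
  proof -
    have "0 \<le> (e - 17/50)\<^sup>2 * 3" by simp
    moreover have "0 \<le> e * e * e" "0 \<le> e * e" using e by auto
    ultimately have "0 \<le> 2 * (1 + e) - 2 * (1 - e) * ((18/23) * (1 + e * (13/5))) - e * (1 + e) * (3/2 - e / 2) - e * (1 + e) / 20"
      using e(2) by (simp add: power2_eq_square field_simps)
    then have "0 \<le> (2 * (1 + e) - 2 * (1 - e) * ((18/23) * (1 + e * (13/5))) - e * (1 + e) * (3/2 - e / 2) - e * (1 + e) / 20) / (e * (1 + e))"
      using e by simp
    also have "\<dots> = 2 / e - 2 * ((1 - e) / (e * (1 + e))) * ((18/23) * (1 + e * (13/5))) - (3/2 - e / 2) - 1 / 20"
    proof -
      have "2 * (1 + e) / (e * (1 + e)) = 2 / e"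
        using e by (subst mult_divide_mult_cancel_right) auto
      moreover have "2 * (1 - e) * ((18/23) * (1 + e * (13/5))) / (e * (1 + e))
           = 2 * ((1 - e) / (e * (1 + e))) * ((18/23) * (1 + e * (13/5)))"
        "e * (1 + e) * (3/2 - e / 2) / (e * (1 + e)) = 3/2 - e / 2"
        "e * (1 + e) / 20 / (e * (1 + e)) = 1 / 20"
        using e by auto
      ultimately show ?thesis by (simp only: diff_divide_distrib)
    qed
    finally show ?thesis by (simp add: e(3) diff_divide_distrib)
  qed
  ultimately show ?thesis by linarith
qed

section \<open>Meshes with nondecreasing steps\<close>

text \<open>
  The bound 18/5 on the step ratios is a rational number above \<open>\<rho>\<^sub>R\<close> for which the diagonal
  still dominates. The mesh is infinite, so that the entry for the step after \<open>t\<^sub>k\<close> is always available.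
\<close>

locale nondecreasing_mesh =
  fixes \<alpha> :: real and t :: "nat \<Rightarrow> real"
  assumes alpha: "0 < \<alpha>" "\<alpha> < 1"
    and t0: "t 0 = 0" and first_step: "0 < t 1"
    and steps_mono: "\<And>k. 1 \<le> k \<Longrightarrow> t k - t (k - 1) \<le> t (Suc k) - t k"
    and steps_ratio: "\<And>k. 1 \<le> k \<Longrightarrow> t (Suc k) - t k \<le> 18/5 * (t k - t (k - 1))"
begin

definition \<tau> :: "nat \<Rightarrow> real" where
  "\<tau> k = t k - t (k - 1)"

definition w :: "nat \<Rightarrow> real \<Rightarrow> real" where
  "w k s = (t k - s) powr (- \<alpha>)"

text \<open>
  \<open>mass v j\<close> and \<open>tilt v j\<close> are the moments of \<open>v\<close> that occur when a derivative which is affine on the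
  \<open>j\<close>-th cell is integrated against \<open>v\<close>. Summing over all cells with the derivatives of the quadratic
  interpolants, \<open>entry v j\<close> is the coefficient of the increment \<open>a\<^sub>j - a\<^sub>j\<^sub>-\<^sub>1\<close>. As \<open>\<tau> 0 = 0\<close> and division
  by 0 gives 0, \<open>entry v 0 = 0\<close>, which serves as the missing column 0 of the matrix.
\<close>

definition mass :: "(real \<Rightarrow> real) \<Rightarrow> nat \<Rightarrow> real" where
  "mass v j = integral {t (j - 1)..t j} v"

definition tilt :: "(real \<Rightarrow> real) \<Rightarrow> nat \<Rightarrow> real" where
  "tilt v j = integral {t (j - 1)..t j} (\<lambda>s. (2 * s - t (j - 1) - t j) * v s)"

definition entry :: "(real \<Rightarrow> real) \<Rightarrow> nat \<Rightarrow> real" where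
  "entry v j = (mass v j + tilt v (j - 1) / (\<tau> (j - 1) + \<tau> j) - tilt v j / (\<tau> j + \<tau> (Suc j))) / \<tau> j"

lemma tau_0 [simp]: "\<tau> 0 = 0"
  by (simp add: \<tau>_def)

lemma tau_pos: "1 \<le> k \<Longrightarrow> 0 < \<tau> k"
proof (induction k rule: nat_induct_at_least)
  case base
  then show ?case using first_step t0 by (simp add: \<tau>_def)
next
  case (Suc k)
  then show ?case using steps_mono[of k] by (simp add: \<tau>_def)
qed

lemma tau_nonneg: "0 \<le> \<tau> k"
  using tau_pos[of k] by (cases k) auto

lemma tau_mono: "\<tau> k \<le> \<tau> (Suc k)"
  using steps_mono[of k] first_step t0 by (cases k) (auto simp: \<tau>_def)

lemma tau_ratio: "1 \<le> k \<Longrightarrow> \<tau> (Suc k) \<le> 18/5 * \<tau> k"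
  using steps_ratio[of k] by (simp add: \<tau>_def)

lemma t_Suc_less: "t k < t (Suc k)"
  using tau_pos[of "Suc k"] by (simp add: \<tau>_def)

lemma t_strict_mono: "i < j \<Longrightarrow> t i < t j"
  using t_Suc_less by (rule lift_Suc_mono_less)

lemma t_mono: "i \<le> j \<Longrightarrow> t i \<le> t j"
  using t_strict_mono by (cases "i = j") (auto intro: less_imp_le)

lemma t_nonneg: "0 \<le> t i"
  using t_mono[of 0 i] t0 by simp

lemma t_pred_le: "t (j - 1) \<le> t j"
  by (intro t_mono) auto

lemma tilt_0 [simp]: "tilt v 0 = 0"
  by (simp add: tilt_def)

lemma entry_0 [simp]: "entry v 0 = 0"
  by (simp add: entry_def)

lemma
  assumes "convex_increasing (t j) v" "i \<le> j"
  shows convex_increasing_continuous_step: "continuous_on {t (i - 1)..t i} v"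
    and convex_increasing_mono_step: "mono_on {t (i - 1)..t i} v"
proof -
  have sub: "{t (i - 1)..t i} \<subseteq> {0..t j}"
    using t_nonneg[of "i - 1"] t_mono[OF assms(2)] by auto
  show "continuous_on {t (i - 1)..t i} v"
    using convex_increasing_continuous[OF assms(1)] sub continuous_on_subset by blast
  show "mono_on {t (i - 1)..t i} v"
    using convex_increasing_mono[OF assms(1)] sub mono_on_subset by blast
qed

lemma tilt_nonneg:
  assumes "convex_increasing (t j) v" "i \<le> j"
  shows "0 \<le> tilt v i"
  unfolding tilt_def using assms
  by (intro odd_moment_nonneg convex_increasing_continuous_step convex_increasing_mono_step t_pred_le)

text \<open>
  The tilt of the previous cell only adds, and the tilt of the cell itself is controlled because
  \<open>\<tau>\<^sub>j \<le> \<tau>\<^sub>j + \<tau>\<^sub>j\<^sub>+\<^sub>1\<close>.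
\<close>

lemma entry_ge_left_value:
  assumes v: "convex_increasing (t j) v" and j: "1 \<le> j"
  shows "v (t (j - 1)) \<le> entry v j"
proof -
  have "\<tau> j * v (t (j - 1)) \<le> mass v j - tilt v j / (\<tau> j + \<tau> (Suc j))"
    unfolding mass_def tilt_def \<tau>_def[of j]
    using v j tau_pos[of j, unfolded \<tau>_def] tau_pos[of "Suc j"]
    by (intro tilted_integral_ge convex_increasing_continuous_step convex_increasing_mono_step t_pred_le)
      auto
  also have "\<dots> \<le> mass v j + tilt v (j - 1) / (\<tau> (j - 1) + \<tau> j) - tilt v j / (\<tau> j + \<tau> (Suc j))"
    using tilt_nonneg[OF v, of "j - 1"] tau_nonneg[of j] tau_nonneg[of "j - 1"] by auto
  finally show ?thesis
    using tau_pos[OF j] by (simp add: entry_def field_simps)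
qed

text \<open>
  Let \<open>m\<close> be a supporting slope at \<open>t\<^sub>j\<^sub>-\<^sub>1\<close>. The mean over the \<open>j\<close>-th cell falls short of the right end
  value by at least \<open>m \<tau>\<^sub>j / 2\<close>, while the previous cell, being no longer than this one, contributes a
  tilt of at most that size. This is where nondecreasing steps are used.
\<close>

lemma entry_le_right_value:
  assumes v: "convex_increasing (t j) v" and j: "1 \<le> j"
  shows "entry v j \<le> v (t j)"
proof -
  have tj: "t (j - 1) \<in> {0..t j}" using t_nonneg t_pred_le by auto
  obtain m where m: "0 \<le> m"
    "\<And>s s'. 0 \<le> s \<Longrightarrow> s \<le> s' \<Longrightarrow> s' \<le> t (j - 1) \<Longrightarrow> v s' - v s \<le> m * (s' - s)"
    "\<And>s s'. t (j - 1) \<le> s \<Longrightarrow> s \<le> s' \<Longrightarrow> s' \<le> t j \<Longrightarrow> m * (s' - s) \<le> v s' - v s"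
    using convex_increasing_slope[OF v tj] by metis
  have I: "mass v j \<le> \<tau> j * v (t j) - m * (\<tau> j)\<^sup>2 / 2"
    unfolding mass_def \<tau>_def using v j
    by (intro integral_le_right_value t_pred_le convex_increasing_continuous_step m) auto
  have "tilt v (j - 1) \<le> m * \<tau> (j - 1) ^ 3 / 6"
    unfolding tilt_def \<tau>_def using v j t_nonneg[of "j - 1 - 1"]
    by (intro odd_moment_le t_pred_le convex_increasing_continuous_step m) auto
  then have "tilt v (j - 1) / (\<tau> (j - 1) + \<tau> j) \<le> (m * \<tau> (j - 1) ^ 3 / 6) / (\<tau> (j - 1) + \<tau> j)"
    using tau_nonneg by (intro divide_right_mono add_nonneg_nonneg) auto
  also have "\<dots> \<le> m * (\<tau> j)\<^sup>2 / 2"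
  proof -
    have t': "0 \<le> \<tau> (j - 1)" "\<tau> (j - 1) \<le> \<tau> j" "0 < \<tau> j"
      using tau_pos[of j] tau_pos[of "j - 1"] tau_mono[of "j - 1"] j by (cases "j = 1"; force)+
    have "\<tau> (j - 1) ^ 3 \<le> (\<tau> j)\<^sup>2 * (\<tau> (j - 1) + \<tau> j)"
    proof -
      have "\<tau> (j - 1) ^ 3 = (\<tau> (j - 1))\<^sup>2 * \<tau> (j - 1)" by (simp add: power3_eq_cube power2_eq_square)
      also have "\<dots> \<le> (\<tau> j)\<^sup>2 * (\<tau> (j - 1) + \<tau> j)"
        using t' by (intro mult_mono power_mono) auto
      finally show ?thesis .
    qed
    then have "m * \<tau> (j - 1) ^ 3 \<le> m * ((\<tau> j)\<^sup>2 * (\<tau> (j - 1) + \<tau> j))"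
      using m(1) by (rule mult_left_mono)
    moreover have "0 \<le> m * ((\<tau> j)\<^sup>2 * (\<tau> (j - 1) + \<tau> j))" using m(1) t' by simp
    ultimately have "m * \<tau> (j - 1) ^ 3 / 6 \<le> (m * ((\<tau> j)\<^sup>2 * (\<tau> (j - 1) + \<tau> j))) / 2"
      by linarith
    also have "\<dots> = m * (\<tau> j)\<^sup>2 / 2 * (\<tau> (j - 1) + \<tau> j)" by simp
    finally have "m * \<tau> (j - 1) ^ 3 / 6 \<le> m * (\<tau> j)\<^sup>2 / 2 * (\<tau> (j - 1) + \<tau> j)" .
    then show ?thesis using t' by (subst pos_divide_le_eq) auto
  qed
  finally have J1: "tilt v (j - 1) / (\<tau> (j - 1) + \<tau> j) \<le> m * (\<tau> j)\<^sup>2 / 2" .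
  have "0 \<le> tilt v j / (\<tau> j + \<tau> (Suc j))"
    using tilt_nonneg[OF v, of j] tau_pos[of j] tau_pos[of "Suc j"] j by auto
  with I J1 have "mass v j + tilt v (j - 1) / (\<tau> (j - 1) + \<tau> j) - tilt v j / (\<tau> j + \<tau> (Suc j)) \<le> \<tau> j * v (t j)"
    by linarith
  then show ?thesis
    using tau_pos[OF j] by (simp add: entry_def field_simps)
qed

text \<open>Consecutive entries are separated by the value of \<open>v\<close> at the common node.\<close>

lemma entry_step_mono:
  assumes v: "convex_increasing (t j) v" "0 \<le> v 0" and j: "1 \<le> j"
  shows "entry v (j - 1) \<le> entry v j"
proof (cases "j = 1")
  case True
  then show ?thesis using entry_ge_left_value[OF v(1) j] v(2) t0 by simp
next
  case False
  have "convex_increasing (t (j - 1)) v"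
    using v(1) t_pred_le by (rule convex_increasing_subinterval)
  then have "entry v (j - 1) \<le> v (t (j - 1))" using False j by (intro entry_le_right_value) auto
  also have "\<dots> \<le> entry v j" using v(1) j by (rule entry_ge_left_value)
  finally show ?thesis .
qed

lemma entry_diff:
  assumes "continuous_on {0..t j} v" "continuous_on {0..t j} v'" "1 \<le> j"
  shows "entry (\<lambda>s. v s - v' s) j = entry v j - entry v' j"
proof -
  have c: "continuous_on {t (i - 1)..t i} f" if "continuous_on {0..t j} f" "i \<le> j" for i f
    using that t_nonneg[of "i - 1"] t_mono[of i j] by (auto intro: continuous_on_subset)
  have "mass (\<lambda>s. v s - v' s) j = mass v j - mass v' j"
    unfolding mass_def using assms c by (intro integral_diff integrable_continuous_real) auto
  moreover have "tilt (\<lambda>s. v s - v' s) i = tilt v i - tilt v' i" if "i \<le> j" for i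
    unfolding tilt_def right_diff_distrib using assms c that
    by (intro integral_diff integrable_continuous_real continuous_intros) auto
  ultimately show ?thesis
    unfolding entry_def by (simp add: diff_divide_distrib add_divide_distrib)
qed

lemma convex_increasing_w: "j < k \<Longrightarrow> convex_increasing (t j) (w k)"
  unfolding convex_increasing_def
proof (intro exI[of _ "\<lambda>s. \<alpha> * (t k - s) powr (- \<alpha> - 1)"] conjI ballI mono_onI)
  assume jk: "j < k"
  fix s assume s: "s \<in> {0..t j}"
  then have "s < t k" using t_strict_mono[OF jk] by auto
  then show "(w k has_real_derivative \<alpha> * (t k - s) powr (- \<alpha> - 1)) (at s)"
    using has_derivative_reflected_powr[of s "t k" "- \<alpha>"] by (simp add: w_def[abs_def])
  show "0 \<le> \<alpha> * (t k - s) powr (- \<alpha> - 1)" using alpha by simp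
  fix s' assume s': "s' \<in> {0..t j}" "s \<le> s'"
  then have "s' < t k" using t_strict_mono[OF jk] by auto
  then show "\<alpha> * (t k - s) powr (- \<alpha> - 1) \<le> \<alpha> * (t k - s') powr (- \<alpha> - 1)"
    using s' alpha by (intro mult_left_mono powr_mono2') auto
qed

lemma convex_increasing_w_diff:
  assumes "j < k"
  shows "convex_increasing (t j) (\<lambda>s. w k s - w (Suc k) s)"
  unfolding convex_increasing_def
proof (intro exI[of _ "\<lambda>s. \<alpha> * ((t k - s) powr (- \<alpha> - 1) - (t (Suc k) - s) powr (- \<alpha> - 1))"]
    conjI ballI mono_onI)
  fix s assume s: "s \<in> {0..t j}"
  then have sk: "s < t k" "s < t (Suc k)"
    using t_strict_mono[OF assms] t_Suc_less[of k] by auto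
  have "((\<lambda>s. w k s - w (Suc k) s) has_real_derivative
    (- (- \<alpha>) * (t k - s) powr (- \<alpha> - 1)) - (- (- \<alpha>) * (t (Suc k) - s) powr (- \<alpha> - 1))) (at s)"
    unfolding w_def using sk by (intro DERIV_diff has_derivative_reflected_powr)
  then show "((\<lambda>s. w k s - w (Suc k) s) has_real_derivative
      \<alpha> * ((t k - s) powr (- \<alpha> - 1) - (t (Suc k) - s) powr (- \<alpha> - 1))) (at s)"
    by (simp add: algebra_simps)
  show "0 \<le> \<alpha> * ((t k - s) powr (- \<alpha> - 1) - (t (Suc k) - s) powr (- \<alpha> - 1))"
    using sk alpha t_Suc_less[of k] by (auto intro!: mult_nonneg_nonneg powr_mono2')
  fix s' assume s': "s' \<in> {0..t j}" "s \<le> s'"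
  then have sk': "s' < t k" using t_strict_mono[OF assms] by auto
  have "(t k - s) powr (- (\<alpha> + 1)) - ((t k - s) + \<tau> (Suc k)) powr (- (\<alpha> + 1))
      \<le> (t k - s') powr (- (\<alpha> + 1)) - ((t k - s') + \<tau> (Suc k)) powr (- (\<alpha> + 1))"
    using s' sk' alpha tau_pos[of "Suc k"] by (intro powr_minus_diff_antimono) auto
  then show "\<alpha> * ((t k - s) powr (- \<alpha> - 1) - (t (Suc k) - s) powr (- \<alpha> - 1))
      \<le> \<alpha> * ((t k - s') powr (- \<alpha> - 1) - (t (Suc k) - s') powr (- \<alpha> - 1))"
    using alpha by (intro mult_left_mono) (auto simp: \<tau>_def)
qed

lemma w_nonneg: "0 \<le> w k s"
  by (simp add: w_def)

lemma w_diff_nonneg: "s < t k \<Longrightarrow> 0 \<le> w k s - w (Suc k) s"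
  unfolding w_def using alpha t_Suc_less[of k] by (auto intro!: powr_mono2')

lemma w_integrable: "a \<le> b \<Longrightarrow> b \<le> t k \<Longrightarrow> w k integrable_on {a..b}"
  unfolding w_def[abs_def] using alpha has_integral_reflected_powr[of "- \<alpha>" a b "t k"]
  by (auto intro: has_integral_integrable)

lemma w_continuous_on: "j < k \<Longrightarrow> continuous_on {0..t j} (w k)"
  by (intro convex_increasing_continuous convex_increasing_w)

lemma mass_w_diag: "1 \<le> k \<Longrightarrow> mass (w k) k = \<tau> k powr (1 - \<alpha>) / (1 - \<alpha>)"
  unfolding mass_def w_def[abs_def] \<tau>_def
  using alpha has_integral_reflected_powr[of "- \<alpha>" "t (k - 1)" "t k" "t k"] t_pred_le[of k]
  by (intro integral_unique) simp

lemma tilt_w_diag: "1 \<le> k \<Longrightarrow> tilt (w k) k = \<tau> k powr (2 - \<alpha>) * (\<alpha> / ((1 - \<alpha>) * (2 - \<alpha>)))"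
  unfolding tilt_def w_def[abs_def] \<tau>_def
  using alpha has_integral_kernel_odd[of \<alpha> "t (k - 1)" "t k"] t_strict_mono[of "k - 1" k]
  by (intro integral_unique) auto

end

section \<open>The L2 operator in terms of increments\<close>

lemma lagrange_interp_three:
  assumes "distinct [p, q, m]"
  shows "lagrange_interp t a {p, q, m} s =
    a p * ((s - t q) / (t p - t q) * ((s - t m) / (t p - t m))) +
    a q * ((s - t p) / (t q - t p) * ((s - t m) / (t q - t m))) +
    a m * ((s - t p) / (t m - t p) * ((s - t q) / (t m - t q)))"
proof -
  have "{p, q, m} - {p} = {q, m}" "{p, q, m} - {q} = {p, m}" "{p, q, m} - {m} = {p, q}"
    using assms by auto
  then show ?thesis using assms by (simp add: lagrange_interp_def)
qed

lemma newton_form: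
  fixes x y z s :: real
  assumes "x < y" "y < z"
  shows "A * ((s - y) / (x - y) * ((s - z) / (x - z))) + B * ((s - x) / (y - x) * ((s - z) / (y - z)))
      + C * ((s - x) / (z - x) * ((s - y) / (z - y)))
    = A + (s - x) * ((B - A) / (y - x))
      + (s - x) * (s - y) * (((C - B) / (z - y) - (B - A) / (y - x)) / ((y - x) + (z - y)))"
proof -
  define u v where "u = y - x" and "v = z - y"
  have e: "0 < u" "0 < v" "x - y = - u" "x - z = - (u + v)" "y - x = u"
    "y - z = - v" "z - x = u + v" "z - y = v" "u + v > 0"
    using assms by (auto simp: u_def v_def)
  define s' where "s' = s - x"
  have s: "s - x = s'" "s - y = s' - u" "s - z = s' - u - v" using assms by (auto simp: s'_def u_def v_def)
  show ?thesis unfolding s e(3-8) using e(1,2) by (simp add: divide_simps) (simp add: algebra_simps)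
qed

context nondecreasing_mesh
begin

text \<open>First and second divided differences, the latter without the factor 2 of a second derivative.\<close>

definition dq :: "(nat \<Rightarrow> real) \<Rightarrow> nat \<Rightarrow> real" where
  "dq a j = (a j - a (j - 1)) / \<tau> j"

definition curv :: "(nat \<Rightarrow> real) \<Rightarrow> nat \<Rightarrow> real" where
  "curv a j = (dq a (Suc j) - dq a j) / (\<tau> j + \<tau> (Suc j))"

lemma H2_interp_newton:
  assumes "1 \<le> j"
  shows "H2_interp t a j s = a (j - 1) + (s - t (j - 1)) * dq a j + (s - t (j - 1)) * (s - t j) * curv a j"
proof -
  have d: "distinct [j - 1, j, j + 1]" using assms by auto
  have lt: "t (j - 1) < t j" "t j < t (j + 1)" using assms by (auto intro: t_strict_mono)
  show ?thesis
    unfolding H2_interp_def lagrange_interp_three[OF d] newton_form[OF lt] curv_def dq_def \<tau>_def by simp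
qed

lemma H2_interp_nodes:
  assumes "1 \<le> j"
  shows "H2_interp t a j (t (j - 1)) = a (j - 1)" "H2_interp t a j (t j) = a j"
    "H2_interp t a j (t (Suc j)) = a (Suc j)"
proof -
  have "t (j - 1) < t j" "t j < t (Suc j)" using assms by (auto intro: t_strict_mono)
  then show "H2_interp t a j (t (j - 1)) = a (j - 1)" "H2_interp t a j (t j) = a j"
    unfolding H2_interp_newton[OF assms] by (auto simp: dq_def \<tau>_def)
  have p: "0 < \<tau> j" "0 < \<tau> (Suc j)" using tau_pos assms by auto
  have e: "t (Suc j) - t (j - 1) = \<tau> j + \<tau> (Suc j)" "t (Suc j) - t j = \<tau> (Suc j)" by (auto simp: \<tau>_def)
  have "(\<tau> j + \<tau> (Suc j)) * \<tau> (Suc j) * curv a j = \<tau> (Suc j) * (dq a (Suc j) - dq a j)"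
    using p by (simp add: curv_def)
  moreover have "\<tau> (Suc j) * dq a (Suc j) = a (Suc j) - a j" "\<tau> j * dq a j = a j - a (j - 1)"
    using p by (auto simp: dq_def)
  ultimately show "H2_interp t a j (t (Suc j)) = a (Suc j)"
    unfolding H2_interp_newton[OF assms] e by (simp add: algebra_simps)
qed

lemma H2_interp_has_derivative:
  assumes "1 \<le> j"
  shows "(H2_interp t a j has_real_derivative dq a j + (2 * s - t (j - 1) - t j) * curv a j) (at s)"
  unfolding H2_interp_newton[OF assms, abs_def]
  by (auto intro!: derivative_eq_intros simp: algebra_simps)

lemma deriv_H2_interp:
  "1 \<le> j \<Longrightarrow> deriv (H2_interp t a j) s = dq a j + (2 * s - t (j - 1) - t j) * curv a j"
  using H2_interp_has_derivative by (rule DERIV_imp_deriv)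

lemma w_odd_integrable:
  assumes "j \<le> k"
  shows "(\<lambda>s. (2 * s - t (j - 1) - t j) * w k s) integrable_on {t (j - 1)..t j}"
proof (cases "j = k")
  case True
  then show ?thesis
    using alpha has_integral_kernel_odd[of \<alpha> "t (k - 1)" "t k"] t_strict_mono[of "k - 1" k]
    unfolding w_def[abs_def] by (cases "k = 0") (auto intro: has_integral_integrable)
next
  case False
  with assms show ?thesis using t_nonneg[of "j - 1"]
    by (intro integrable_continuous_real continuous_intros continuous_on_subset[OF w_continuous_on[of j]]) auto
qed

lemma integral_deriv_H2_interp:
  assumes "1 \<le> j" "j \<le> k"
  shows "integral {t (j - 1)..t j} (\<lambda>s. deriv (H2_interp t a j) s / (t k - s) powr \<alpha>)
      = dq a j * mass (w k) j + curv a j * tilt (w k) j"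
proof -
  have "((\<lambda>s. dq a j * w k s + curv a j * ((2 * s - t (j - 1) - t j) * w k s)) has_integral
      dq a j * mass (w k) j + curv a j * tilt (w k) j) {t (j - 1)..t j}"
    unfolding mass_def tilt_def using assms
    by (intro has_integral_add has_integral_mult_right integrable_integral w_integrable
        w_odd_integrable t_pred_le t_mono)
  moreover have "dq a j * w k s + curv a j * ((2 * s - t (j - 1) - t j) * w k s)
      = deriv (H2_interp t a j) s / (t k - s) powr \<alpha>" for s
    unfolding deriv_H2_interp[OF assms(1)] w_def powr_minus_divide add_divide_distrib
    by (simp add: mult.commute)
  ultimately show ?thesis by (intro integral_unique) simp
qed

text \<open>
  On the last cell the interpolant of cell \<open>k - 1\<close> is used; re-expanded about the midpoint of the last
  cell, its derivative has mean \<open>dq a k\<close> and the same slope.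
\<close>

lemma integral_deriv_H2_interp_last:
  assumes "2 \<le> k"
  shows "integral {t (k - 1)..t k} (\<lambda>s. deriv (H2_interp t a (k - 1)) s / (t k - s) powr \<alpha>)
      = dq a k * mass (w k) k + curv a (k - 1) * tilt (w k) k"
proof -
  obtain m where m: "k = Suc m" "1 \<le> m" using assms by (cases k) auto
  have c: "dq a (Suc m) - dq a m = curv a m * (\<tau> m + \<tau> (Suc m))"
    using tau_pos[of m] tau_pos[of "Suc m"] m by (simp add: curv_def)
  have "dq a m + (2 * s - t (m - 1) - t m) * curv a m
      = dq a (Suc m) + (2 * s - t m - t (Suc m)) * curv a m" for s
  proof -
    have "dq a (Suc m) = dq a m + curv a m * (t (Suc m) - t (m - 1))"
      using c by (simp add: \<tau>_def)
    then show ?thesis by (simp add: algebra_simps)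
  qed
  then have e: "deriv (H2_interp t a (k - 1)) s = dq a k + (2 * s - t (k - 1) - t k) * curv a (k - 1)" for s
    using m by (simp add: deriv_H2_interp)
  have "((\<lambda>s. dq a k * w k s + curv a (k - 1) * ((2 * s - t (k - 1) - t k) * w k s)) has_integral
      dq a k * mass (w k) k + curv a (k - 1) * tilt (w k) k) {t (k - 1)..t k}"
    unfolding mass_def tilt_def
    by (intro has_integral_add has_integral_mult_right integrable_integral w_integrable
        w_odd_integrable t_pred_le) auto
  moreover have "dq a k * w k s + curv a (k - 1) * ((2 * s - t (k - 1) - t k) * w k s)
      = deriv (H2_interp t a (k - 1)) s / (t k - s) powr \<alpha>" for s
    unfolding e w_def powr_minus_divide add_divide_distrib by (simp add: mult.commute)
  ultimately show ?thesis by (intro integral_unique) simp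
qed

lemma L2_op_Suc:
  assumes "2 \<le> k"
  shows "Gamma (1 - \<alpha>) * L2_op \<alpha> t k a =
    (\<Sum>j=1..k-1. dq a j * mass (w k) j + curv a j * tilt (w k) j) + dq a k * mass (w k) k + curv a (k - 1) * tilt (w k) k"
proof -
  have "Gamma (1 - \<alpha>) > 0" using alpha by (intro Gamma_real_pos) auto
  moreover have sum: "(\<Sum>j=1..k-1. integral {t (j - 1)..t j} (\<lambda>s. deriv (H2_interp t a j) s / (t k - s) powr \<alpha>))
     = (\<Sum>j=1..k-1. dq a j * mass (w k) j + curv a j * tilt (w k) j)"
    by (intro sum.cong integral_deriv_H2_interp) auto
  ultimately show ?thesis
    unfolding L2_op_def sum integral_deriv_H2_interp_last[OF assms] using assms by simp
qed

lemma L2_op_one: "Gamma (1 - \<alpha>) * L2_op \<alpha> t 1 a = dq a 1 * mass (w 1) 1"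
proof -
  have "Gamma (1 - \<alpha>) > 0" using alpha by (intro Gamma_real_pos) auto
  then have g: "Gamma (1 - \<alpha>) \<noteq> 0" by simp
  have "1 - \<alpha> \<notin> \<int>\<^sub>\<le>\<^sub>0"
    using alpha nonpos_Ints_nonpos[of "1 - \<alpha>"] by auto
  then have "Gamma (2 - \<alpha>) = (1 - \<alpha>) * Gamma (1 - \<alpha>)"
    using Gamma_plus1[of "1 - \<alpha>"] by (simp add: add.commute)
  then show ?thesis
    using g alpha tau_pos[of 1] unfolding mass_w_diag[OF order_refl]
    by (simp add: L2_op_def dq_def \<tau>_def powr_diff)
qed

section \<open>Coercivity\<close>

text \<open>
  The last cell contributes its slope through \<open>last_term\<close>, which couples the increments \<open>k\<close> and \<open>k - 1\<close>
  with the wrong sign and is treated separately. It is absent in the first step, where the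
  scheme is the one of first order.
\<close>

definition last_term :: "nat \<Rightarrow> (nat \<Rightarrow> real) \<Rightarrow> real" where
  "last_term k a = (if k = 1 then 0 else curv a (k - 1) * tilt (w k) k)"

definition diag_entry :: "nat \<Rightarrow> real" where
  "diag_entry k = (mass (w k) k + tilt (w k) (k - 1) / (\<tau> (k - 1) + \<tau> k)) / \<tau> k"

text \<open>
  Each \<open>curv a j\<close> is a difference of consecutive divided differences; a summation by parts collects the
  coefficient of each increment.
\<close>

lemma L2_op_increments:
  assumes "1 \<le> k"
  shows "Gamma (1 - \<alpha>) * L2_op \<alpha> t k a =
    (\<Sum>j=1..k-1. entry (w k) j * (a j - a (j - 1))) + diag_entry k * (a k - a (k - 1)) + last_term k a"
proof (cases "k = 1")
  case True
  then show ?thesis using L2_op_one[of a] by (simp add: diag_entry_def last_term_def dq_def)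
next
  case False
  then have k: "2 \<le> k" using assms by simp
  have *: "(\<Sum>j=1..m. dq a j * v j + curv a j * tilt v' j)
     = (\<Sum>j=1..m. (v j + tilt v' (j - 1) / (\<tau> (j - 1) + \<tau> j) - tilt v' j / (\<tau> j + \<tau> (Suc j))) / \<tau> j * (a j - a (j - 1)))
       + dq a (Suc m) * tilt v' m / (\<tau> m + \<tau> (Suc m))" for m v v'
  proof (induction m)
    case (Suc m)
    have "dq a (Suc m) * tilt v' m / (\<tau> m + \<tau> (Suc m)) + dq a (Suc m) * v (Suc m) + curv a (Suc m) * tilt v' (Suc m)
       = (v (Suc m) + tilt v' m / (\<tau> m + \<tau> (Suc m)) - tilt v' (Suc m) / (\<tau> (Suc m) + \<tau> (Suc (Suc m)))) / \<tau> (Suc m) * (a (Suc m) - a m)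
       + dq a (Suc (Suc m)) * tilt v' (Suc m) / (\<tau> (Suc m) + \<tau> (Suc (Suc m)))"
      unfolding curv_def by (simp add: dq_def[of a "Suc m"] add_divide_distrib diff_divide_distrib algebra_simps)
    with Suc show ?case by simp
  qed simp
  have "(\<Sum>j=1..k-1. dq a j * mass (w k) j + curv a j * tilt (w k) j)
     = (\<Sum>j=1..k-1. entry (w k) j * (a j - a (j - 1))) + dq a k * tilt (w k) (k - 1) / (\<tau> (k - 1) + \<tau> k)"
    unfolding * entry_def using k by simp
  then show ?thesis
    unfolding L2_op_Suc[OF k] diag_entry_def last_term_def using False
    by (simp add: dq_def add_divide_distrib algebra_simps)
qed

text \<open>
  Off the diagonal this is the matrix of \<open>L2_op_increments\<close>. The diagonal entry is the smallest one for
  which the column differences are still nonincreasing in \<open>k\<close>; the difference to \<open>diag_entry\<close> is kept to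
  compensate \<open>last_term\<close>.
\<close>

definition kern :: "nat \<Rightarrow> nat \<Rightarrow> real" where
  "kern k j = (if j = k then entry (w (Suc k)) k + entry (\<lambda>s. w k s - w (Suc k) s) (k - 1) else entry (w k) j)"

lemma entry_w_diff: "j < k \<Longrightarrow> entry (\<lambda>s. w k s - w (Suc k) s) j = entry (w k) j - entry (w (Suc k)) j"
  by (cases "j = 0") (auto intro!: entry_diff w_continuous_on)

lemma kern_triangular:
  "(\<Sum>k=1..n. kern k k * (x k)\<^sup>2) / 2 \<le> (\<Sum>k=1..n. x k * (\<Sum>j=1..k. kern k j * x j))"
proof (rule triangular_form_lower_bound)
  have off: "kern k j = entry (w k) j" if "j < k" for k j using that by (simp add: kern_def)
  have diag: "kern k k = entry (w (Suc k)) k + entry (w k) (k - 1) - entry (w (Suc k)) (k - 1)" if "1 \<le> k" for k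
    using that by (simp add: kern_def entry_w_diff)
  show "kern k 0 = 0" for k by (simp add: kern_def)
  fix k a :: nat assume a: "1 \<le> a" "a \<le> k"
  have *: "entry (w (Suc k)) (a - 1) \<le> entry (w (Suc k)) a"
    using a by (intro entry_step_mono convex_increasing_w w_nonneg) auto
  show "kern k (a - 1) \<le> kern k a"
  proof (cases "a = k")
    case True
    then show ?thesis using a * by (simp add: off diag)
  next
    case False
    then show ?thesis using a entry_step_mono[OF convex_increasing_w w_nonneg, of a k] by (simp add: off)
  qed
  show "kern (Suc k) a - kern (Suc k) (a - 1) \<le> kern k a - kern k (a - 1)"
  proof (cases "a = k")
    case True
    then show ?thesis using a by (simp add: off diag)
  next
    case False
    then have "entry (\<lambda>s. w k s - w (Suc k) s) (a - 1) \<le> entry (\<lambda>s. w k s - w (Suc k) s) a"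
      using a t_nonneg t_strict_mono[of 0 k] t0
      by (intro entry_step_mono convex_increasing_w_diff w_diff_nonneg) auto
    then show ?thesis using a False by (simp add: off entry_w_diff)
  qed
qed

text \<open>
  The multiple of the square of increment \<open>k\<close> that is given up for the cross term of \<open>last_term\<close> in step
  \<open>k + 1\<close>. The fraction is \<open>R\<^bsup>2 - \<alpha>\<^esup> / (1 + R)\<close> with the step ratio \<open>R = \<tau>\<^sub>k\<^sub>+\<^sub>1 / \<tau>\<^sub>k\<close>.
\<close>

definition cross_bound :: "nat \<Rightarrow> real" where
  "cross_bound k = (\<alpha> / ((1 - \<alpha>) * (2 - \<alpha>))) * \<tau> k powr (- \<alpha>) *
     ((\<tau> (Suc k) / \<tau> k) powr (2 - \<alpha>) / (1 + \<tau> (Suc k) / \<tau> k))"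

lemma cross_bound_nonneg: "0 \<le> cross_bound k"
  unfolding cross_bound_def using alpha tau_nonneg by (intro mult_nonneg_nonneg divide_nonneg_nonneg) auto

text \<open>
  The product is a positive multiple of \<open>x\<^sup>2 / R - x y\<close> with the increments \<open>x\<close>, \<open>y\<close> and the step ratio
  \<open>R \<le> 4\<close>. Young's inequality in the form \<open>x y \<le> x\<^sup>2 / 4 + y\<^sup>2\<close> removes \<open>x\<close> altogether. This
  choice of weights is what leaves room up to the ratio 18/5.
\<close>

lemma last_term_lower_bound:
  assumes "2 \<le> k"
  shows "- cross_bound (k - 1) * (a (k - 1) - a (k - 1 - 1))\<^sup>2 \<le> (a k - a (k - 1)) * last_term k a"
proof -
  obtain m where m: "k = Suc m" "1 \<le> m" using assms by (cases k) auto
  define x y p q where "x = a (Suc m) - a m" and "y = a m - a (m - 1)" and "p = \<tau> m" and "q = \<tau> (Suc m)"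
  define \<beta> where "\<beta> = \<alpha> / ((1 - \<alpha>) * (2 - \<alpha>))"
  have \<beta>: "0 < \<beta>" using alpha by (simp add: \<beta>_def)
  have pq: "0 < p" "p \<le> q" "q \<le> 18/5 * p"
    unfolding p_def q_def using tau_pos[of m] tau_mono[of m] tau_ratio[of m] m by auto
  define R where "R = q / p"
  have R: "1 \<le> R" "R \<le> 18/5" "q = R * p" using pq by (auto simp: R_def field_simps)
  have last_term: "last_term k a = (x / q - y / p) / (p + q) * (q powr (2 - \<alpha>) * \<beta>)"
    using m by (simp add: last_term_def curv_def dq_def tilt_w_diag x_def y_def p_def q_def \<beta>_def)
  have q2: "q powr (2 - \<alpha>) = R powr (2 - \<alpha>) * (p\<^sup>2 * p powr (- \<alpha>))"
  proof -
    have "q powr (2 - \<alpha>) = R powr (2 - \<alpha>) * p powr (2 - \<alpha>)"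
      using R pq by (simp add: powr_mult)
    also have "p powr (2 - \<alpha>) = p powr 2 * p powr (- \<alpha>)" by (simp add: powr_add[symmetric])
    also have "p powr 2 = p\<^sup>2" using pq by (simp add: powr_numeral)
    finally show ?thesis .
  qed
  have "x * ((x / q - y / p) / (p + q) * p\<^sup>2) = (x * x / R - x * y) / (1 + R)"
    using pq R(1) add_pos_pos[of p "R * p"] unfolding R(3) by (simp add: divide_simps power2_eq_square) (simp add: algebra_simps)
  moreover have "- y\<^sup>2 \<le> x * x / R - x * y"
  proof -
    have "x * x / 4 \<le> x * x / R" using R by (intro divide_left_mono) auto
    moreover have "0 \<le> (x / 2 - y)\<^sup>2" by simp
    then have "x * y \<le> y\<^sup>2 + x * x / 4" by (simp add: power2_eq_square algebra_simps)
    ultimately show ?thesis by linarith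
  qed
  then have "- y\<^sup>2 / (1 + R) \<le> (x * x / R - x * y) / (1 + R)"
    using R by (intro divide_right_mono) auto
  ultimately have "- y\<^sup>2 / (1 + R) \<le> x * ((x / q - y / p) / (p + q) * p\<^sup>2)" by simp
  then have "R powr (2 - \<alpha>) * p powr (- \<alpha>) * \<beta> * (- y\<^sup>2 / (1 + R))
      \<le> R powr (2 - \<alpha>) * p powr (- \<alpha>) * \<beta> * (x * ((x / q - y / p) / (p + q) * p\<^sup>2))"
    using \<beta> by (intro mult_left_mono) auto
  also have "\<dots> = x * last_term k a" unfolding last_term q2 by (simp add: ac_simps)
  finally show ?thesis
    using m by (simp add: cross_bound_def R_def p_def q_def x_def y_def \<beta>_def ac_simps)
qed

text \<open>
  The tilt of cell \<open>k - 1\<close> occurs in \<open>diag_entry k\<close> with the kernel of step \<open>k\<close> and in \<open>kern k k\<close> with the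
  smaller tilt of step \<open>k + 1\<close>, hence cancels in favour of the former. The mean of the kernel \<open>w (Suc k)\<close>
  over cell \<open>k\<close> exceeds its left end value by at most \<open>\<alpha> \<tau>\<^sub>k\<^sup>-\<^sup>\<alpha> / 2\<close>, and the left end values
  telescope to \<open>\<tau>\<^sub>k\<^sup>-\<^sup>\<alpha>\<close>. What is left is \<open>diagonal_margin\<close>.
\<close>

lemma diagonal_dominates:
  assumes "1 \<le> k"
  shows "\<tau> k powr (- \<alpha>) / 40 \<le> diag_entry k - kern k k / 2 - cross_bound k"
proof -
  define p where "p = \<tau> k"
  have p: "0 < p" "\<tau> k = p" using tau_pos assms by (auto simp: p_def)
  define R where "R = \<tau> (Suc k) / p"
  have R: "1 \<le> R" "R \<le> 18/5"
    using tau_mono[of k] tau_ratio[OF assms] p by (auto simp: R_def field_simps)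
  have cw: "convex_increasing (t k) (w (Suc k))" by (rule convex_increasing_w) simp
  have cd: "convex_increasing (t (k - 1)) (\<lambda>s. w k s - w (Suc k) s)"
    using assms by (intro convex_increasing_w_diff) simp
  have cont: "continuous_on {t (k - 1)..t k} (w (Suc k))"
    using cw by (rule convex_increasing_continuous_step) simp
  have Ib: "mass (w (Suc k)) k \<le> p * w (Suc k) (t (k - 1)) + \<alpha> * \<tau> (Suc k) powr (- \<alpha> - 1) * p\<^sup>2 / 2"
    unfolding mass_def p(2)[symmetric] \<tau>_def[of k]
  proof (intro integral_le_left_value t_pred_le cont)
    fix s assume s: "t (k - 1) \<le> s" "s \<le> t k"
    show "w (Suc k) s - w (Suc k) (t (k - 1)) \<le> \<alpha> * \<tau> (Suc k) powr (- \<alpha> - 1) * (s - t (k - 1))"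
    proof (cases "s = t (k - 1)")
      case False
      then have "\<exists>z. t (k - 1) < z \<and> z < s \<and> w (Suc k) s - w (Suc k) (t (k - 1))
          = (s - t (k - 1)) * (- (- \<alpha>) * (t (Suc k) - z) powr (- \<alpha> - 1))"
        unfolding w_def using s t_Suc_less[of k]
        by (intro MVT2 has_derivative_reflected_powr) auto
      then obtain z where z: "t (k - 1) < z" "z < s"
        "w (Suc k) s - w (Suc k) (t (k - 1)) = (s - t (k - 1)) * (\<alpha> * (t (Suc k) - z) powr (- \<alpha> - 1))"
        by auto
      have "(t (Suc k) - z) powr (- \<alpha> - 1) \<le> \<tau> (Suc k) powr (- \<alpha> - 1)"
        using z s alpha tau_pos[of "Suc k"] by (intro powr_mono2') (auto simp: \<tau>_def)
      then have "(s - t (k - 1)) * (\<alpha> * (t (Suc k) - z) powr (- \<alpha> - 1))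
         \<le> (s - t (k - 1)) * (\<alpha> * \<tau> (Suc k) powr (- \<alpha> - 1))"
        using s alpha by (intro mult_left_mono) auto
      then show ?thesis unfolding z(3) by (simp add: ac_simps)
    qed simp
  qed
  have "\<tau> (Suc k) powr (- \<alpha> - 1) \<le> p powr (- \<alpha> - 1)"
    using tau_mono[of k] p alpha by (intro powr_mono2') auto
  also have "p powr (- \<alpha> - 1) = p powr (- \<alpha>) / p" using p by (simp add: powr_diff)
  finally have "\<alpha> * \<tau> (Suc k) powr (- \<alpha> - 1) * p\<^sup>2 / 2 \<le> \<alpha> * (p powr (- \<alpha>) / p) * p\<^sup>2 / 2"
    using alpha by (intro divide_right_mono mult_right_mono mult_left_mono) auto
  with Ib have Ib': "mass (w (Suc k)) k \<le> p * (w (Suc k) (t (k - 1)) + \<alpha> / 2 * p powr (- \<alpha>))"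
    using p(1) by (simp add: power2_eq_square algebra_simps)
  define Jk where "Jk = tilt (w k) (k - 1)"
  have Jk: "0 \<le> Jk" unfolding Jk_def
    using assms by (intro tilt_nonneg[of "k - 1"] convex_increasing_w) auto
  have J0: "tilt (w (Suc k)) (k - 1) \<le> Jk"
  proof -
    have "0 \<le> tilt (\<lambda>s. w k s - w (Suc k) s) (k - 1)" by (rule tilt_nonneg[OF cd]) simp
    also have "\<dots> = Jk - tilt (w (Suc k)) (k - 1)"
      unfolding tilt_def Jk_def right_diff_distrib using assms
      by (intro integral_diff w_odd_integrable) auto
    finally show ?thesis by simp
  qed
  have J1: "0 \<le> tilt (w (Suc k)) k" by (rule tilt_nonneg[OF cw]) simp
  have den: "0 < \<tau> (k - 1) + p" "0 < p + \<tau> (Suc k)" using p tau_nonneg[of "k - 1"] tau_nonneg[of "Suc k"] by auto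
  have F1: "entry (w (Suc k)) k \<le> w (Suc k) (t (k - 1)) + \<alpha> / 2 * p powr (- \<alpha>) + Jk / (\<tau> (k - 1) + p) / p"
  proof -
    have "mass (w (Suc k)) k + tilt (w (Suc k)) (k - 1) / (\<tau> (k - 1) + p) - tilt (w (Suc k)) k / (p + \<tau> (Suc k))
      \<le> p * (w (Suc k) (t (k - 1)) + \<alpha> / 2 * p powr (- \<alpha>)) + Jk / (\<tau> (k - 1) + p) - 0"
      using Ib' J0 J1 den by (intro diff_mono add_mono divide_right_mono divide_nonneg_pos) auto
    then have "entry (w (Suc k)) k \<le> (p * (w (Suc k) (t (k - 1)) + \<alpha> / 2 * p powr (- \<alpha>)) + Jk / (\<tau> (k - 1) + p)) / p"
      unfolding entry_def p(2) using p by (intro divide_right_mono) auto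
    then show ?thesis using p by (simp add: add_divide_distrib)
  qed
  have F2: "entry (\<lambda>s. w k s - w (Suc k) s) (k - 1) \<le> p powr (- \<alpha>) - w (Suc k) (t (k - 1))"
  proof (cases "k = 1")
    case True
    then show ?thesis using w_diff_nonneg[of 0 1] first_step t0 p by (simp add: w_def \<tau>_def)
  next
    case False
    then have "entry (\<lambda>s. w k s - w (Suc k) s) (k - 1) \<le> w k (t (k - 1)) - w (Suc k) (t (k - 1))"
      using assms by (intro entry_le_right_value cd) auto
    then show ?thesis by (simp add: w_def p_def \<tau>_def)
  qed
  have "kern k k \<le> p powr (- \<alpha>) * (1 + \<alpha> / 2) + Jk / (\<tau> (k - 1) + p) / p"
    using F1 F2 by (simp add: kern_def algebra_simps)
  moreover have "diag_entry k = p powr (- \<alpha>) / (1 - \<alpha>) + Jk / (\<tau> (k - 1) + p) / p"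
    using p assms by (simp add: diag_entry_def mass_w_diag Jk_def add_divide_distrib powr_diff powr_minus_divide)
  moreover have "0 \<le> Jk / (\<tau> (k - 1) + p) / p" using Jk den p by simp
  moreover have "p powr (- \<alpha>) * (1 / 20) \<le> p powr (- \<alpha>) *
     (2 / (1 - \<alpha>) - 2 * (\<alpha> / ((1 - \<alpha>) * (2 - \<alpha>))) * (R powr (2 - \<alpha>) / (1 + R)) - (1 + \<alpha> / 2))"
    using alpha R by (intro mult_left_mono diagonal_margin) auto
  moreover have "cross_bound k = (\<alpha> / ((1 - \<alpha>) * (2 - \<alpha>))) * p powr (- \<alpha>) * (R powr (2 - \<alpha>) / (1 + R))"
    by (simp add: cross_bound_def R_def p)
  ultimately show ?thesis unfolding p(2)
    by (simp add: algebra_simps)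
qed

theorem L2_op_coercive:
  "(\<Sum>k=1..n. \<tau> k powr (- \<alpha>) * (a k - a (k - 1))\<^sup>2) / 40
     \<le> (\<Sum>k=1..n. (a k - a (k - 1)) * (Gamma (1 - \<alpha>) * L2_op \<alpha> t k a))"
proof -
  define x where "x k = a k - a (k - 1)" for k
  have row: "(\<Sum>j=1..k-1. entry (w k) j * x j) = (\<Sum>j=1..k. kern k j * x j) - kern k k * x k" if k: "1 \<le> k" for k
  proof -
    obtain m where m: "k = Suc m" using k by (cases k) auto
    show ?thesis unfolding m by (auto simp: kern_def intro!: sum.cong)
  qed
  have "(\<Sum>k=1..n. x k * (Gamma (1 - \<alpha>) * L2_op \<alpha> t k a))
     = (\<Sum>k=1..n. x k * (\<Sum>j=1..k. kern k j * x j) + ((diag_entry k - kern k k) * (x k)\<^sup>2 + x k * last_term k a))"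
  proof (intro sum.cong refl)
    fix k assume "k \<in> {1..n}"
    then have k: "1 \<le> k" by simp
    show "x k * (Gamma (1 - \<alpha>) * L2_op \<alpha> t k a)
        = x k * (\<Sum>j=1..k. kern k j * x j) + ((diag_entry k - kern k k) * (x k)\<^sup>2 + x k * last_term k a)"
      unfolding L2_op_increments[OF k] x_def[symmetric] row[OF k]
      by (simp add: power2_eq_square algebra_simps)
  qed
  also have "\<dots> = (\<Sum>k=1..n. x k * (\<Sum>j=1..k. kern k j * x j)) + (\<Sum>k=1..n. (diag_entry k - kern k k) * (x k)\<^sup>2)
      + (\<Sum>k=1..n. x k * last_term k a)"
    by (simp add: sum.distrib)
  finally have eq: "(\<Sum>k=1..n. x k * (Gamma (1 - \<alpha>) * L2_op \<alpha> t k a)) = \<dots>" .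
  have "- (\<Sum>k=1..n. cross_bound k * (x k)\<^sup>2) \<le> (\<Sum>k=1..n. x k * last_term k a)"
  proof -
    have "- (\<Sum>k=1..m. cross_bound k * (x k)\<^sup>2) \<le> (\<Sum>k=1..Suc m. x k * last_term k a)" for m
    proof (induction m)
      case 0
      then show ?case by (simp add: last_term_def)
    next
      case (Suc m)
      have "- cross_bound (Suc m) * (x (Suc m))\<^sup>2 \<le> x (Suc (Suc m)) * last_term (Suc (Suc m)) a"
        using last_term_lower_bound[of "Suc (Suc m)" a] by (simp add: x_def)
      with Suc show ?case by simp
    qed
    from this[of "n - 1"] have "- (\<Sum>k=1..n-1. cross_bound k * (x k)\<^sup>2) \<le> (\<Sum>k=1..n. x k * last_term k a)"
      by (cases n) auto
    moreover have "(\<Sum>k=1..n-1. cross_bound k * (x k)\<^sup>2) \<le> (\<Sum>k=1..n. cross_bound k * (x k)\<^sup>2)"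
      by (intro sum_mono2) (auto simp: cross_bound_nonneg)
    ultimately show ?thesis by simp
  qed
  moreover have "(\<Sum>k=1..n. \<tau> k powr (- \<alpha>) * (x k)\<^sup>2) / 40
      \<le> (\<Sum>k=1..n. (diag_entry k - kern k k) * (x k)\<^sup>2) + (\<Sum>k=1..n. kern k k * (x k)\<^sup>2) / 2 - (\<Sum>k=1..n. cross_bound k * (x k)\<^sup>2)"
  proof -
    have "(\<Sum>k=1..n. \<tau> k powr (- \<alpha>) * (x k)\<^sup>2) / 40 = (\<Sum>k=1..n. (\<tau> k powr (- \<alpha>) / 40) * (x k)\<^sup>2)"
      by (simp add: sum_divide_distrib)
    also have "\<dots> \<le> (\<Sum>k=1..n. (diag_entry k - kern k k / 2 - cross_bound k) * (x k)\<^sup>2)"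
      using diagonal_dominates by (intro sum_mono mult_right_mono) auto
    also have "\<dots> = (\<Sum>k=1..n. (diag_entry k - kern k k) * (x k)\<^sup>2) + (\<Sum>k=1..n. kern k k * (x k)\<^sup>2) / 2 - (\<Sum>k=1..n. cross_bound k * (x k)\<^sup>2)"
      by (simp add: sum.distrib[symmetric] sum_subtractf[symmetric] sum_divide_distrib algebra_simps)
    finally show ?thesis .
  qed
  ultimately have "(\<Sum>k=1..n. \<tau> k powr (- \<alpha>) * (x k)\<^sup>2) / 40 \<le> (\<Sum>k=1..n. x k * (Gamma (1 - \<alpha>) * L2_op \<alpha> t k a))"
    using kern_triangular[where x=x and n=n] unfolding eq by linarith
  then show ?thesis by (simp add: x_def)
qed

end

section \<open>Truncation error for functions with a weak singularity at time zero\<close>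

lemma dominated_integral:
  fixes f B :: "real \<Rightarrow> real"
  assumes cont: "continuous_on {a<..<b} f"
    and bound: "\<And>s. s \<in> {a<..<b} \<Longrightarrow> \<bar>f s\<bar> \<le> B s"
    and B: "B integrable_on {a..b}"
  shows "f integrable_on {a..b}" "\<bar>integral {a..b} f\<bar> \<le> integral {a..b} B"
    "f absolutely_integrable_on {a<..<b}"
proof -
  have B': "B integrable_on {a<..<b}" using B by (simp add: integrable_on_open_interval_real)
  show "f absolutely_integrable_on {a<..<b}"
    using bound
    by (intro measurable_bounded_by_integrable_imp_absolutely_integrable[OF _ _ B'])
      (auto intro!: continuous_imp_measurable_on_sets_lebesgue cont)
  then have f: "f integrable_on {a<..<b}" by (rule set_lebesgue_integral_eq_integral)
  then show "f integrable_on {a..b}" by (simp add: integrable_on_open_interval_real)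
  have "norm (integral {a<..<b} f) \<le> integral {a<..<b} B"
    using bound by (intro integral_norm_bound_integral f B') auto
  then show "\<bar>integral {a..b} f\<bar> \<le> integral {a..b} B"
    by (simp add: integral_open_interval_real)
qed

lemma mean_value_bound:
  fixes f :: "real \<Rightarrow> real"
  assumes cont: "continuous_on {a..b} f"
    and deriv: "\<And>s. s \<in> {a<..<b} \<Longrightarrow> (f has_real_derivative f' s) (at s)"
    and bound: "\<And>s. s \<in> {a<..<b} \<Longrightarrow> \<bar>f' s\<bar> \<le> M" and M: "0 \<le> M"
    and pq: "p \<in> {a..b}" "q \<in> {a..b}"
  shows "\<bar>f p - f q\<bar> \<le> M * (b - a)"
proof -
  have *: "\<bar>f q - f p\<bar> \<le> M * (b - a)" if pq: "p < q" "p \<in> {a..b}" "q \<in> {a..b}" for p q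
  proof -
    have "\<exists>l z. p < z \<and> z < q \<and> DERIV f z :> l \<and> f q - f p = (q - p) * l"
    proof (rule MVT[OF pq(1)])
      show "continuous_on {p..q} f" using pq by (intro continuous_on_subset[OF cont]) auto
      show "f differentiable at z" if "p < z" "z < q" for z
        using deriv[of z] that pq by (auto simp: real_differentiable_def)
    qed
    then obtain l z where z: "p < z" "z < q" "(f has_real_derivative l) (at z)" "f q - f p = (q - p) * l"
      by blast
    have "l = f' z" using z deriv[of z] pq by (intro DERIV_unique[OF z(3)]) auto
    then have "\<bar>f q - f p\<bar> = (q - p) * \<bar>f' z\<bar>" using z pq by (simp add: abs_mult)
    also have "\<dots> \<le> (b - a) * M" using pq z bound[of z] by (intro mult_mono) auto
    finally show ?thesis by (simp add: mult.commute)
  qed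
  show ?thesis
    using *[of p q] *[of q p] pq M by (cases p q rule: linorder_cases) (auto simp: abs_minus_commute)
qed

text \<open>
  Rolle's theorem applied twice gives a zero of \<open>\<phi>''\<close> and one of \<open>\<phi>'\<close>, from which the bound on
  \<open>\<phi>'''\<close> is integrated.
\<close>

lemma three_zeros_derivative_bound:
  fixes \<phi> :: "real \<Rightarrow> real"
  assumes xyz: "x < y" "y < z"
    and zero: "\<phi> x = 0" "\<phi> y = 0" "\<phi> z = 0"
    and cont: "continuous_on {x..z} \<phi>" "continuous_on {x..z} \<phi>'" "continuous_on {x..z} \<phi>''"
    and d1: "\<And>s. s \<in> {x<..<z} \<Longrightarrow> (\<phi> has_real_derivative \<phi>' s) (at s)"
    and d2: "\<And>s. s \<in> {x<..<z} \<Longrightarrow> (\<phi>' has_real_derivative \<phi>'' s) (at s)"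
    and d3: "\<And>s. s \<in> {x<..<z} \<Longrightarrow> (\<phi>'' has_real_derivative \<phi>''' s) (at s)"
    and bound: "\<And>s. s \<in> {x<..<z} \<Longrightarrow> \<bar>\<phi>''' s\<bar> \<le> M" and M: "0 \<le> M"
    and s: "s \<in> {x..z}"
  shows "\<bar>\<phi>' s\<bar> \<le> (z - x)\<^sup>2 * M"
proof -
  have rolle: "\<exists>\<xi>. p < \<xi> \<and> \<xi> < q \<and> f1 \<xi> = 0"
    if pq: "p < q" "f p = f q" and "continuous_on {p..q} f"
      and d: "\<And>s. s \<in> {p<..<q} \<Longrightarrow> (f has_real_derivative f1 s) (at s)" for p q and f f1 :: "real \<Rightarrow> real"
  proof -
    have "\<exists>\<xi>. p < \<xi> \<and> \<xi> < q \<and> DERIV f \<xi> :> 0"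
      using pq d that(3) by (intro Rolle) (auto simp: real_differentiable_def)
    then obtain \<xi> where "p < \<xi>" "\<xi> < q" "DERIV f \<xi> :> 0" by blast
    then show ?thesis using DERIV_unique[OF d[of \<xi>]] by auto
  qed
  obtain \<xi>1 where \<xi>1: "x < \<xi>1" "\<xi>1 < y" "\<phi>' \<xi>1 = 0"
    using rolle[of x y \<phi> \<phi>'] continuous_on_subset[OF cont(1), of "{x..y}"] xyz zero d1 by auto
  obtain \<xi>2 where \<xi>2: "y < \<xi>2" "\<xi>2 < z" "\<phi>' \<xi>2 = 0"
    using rolle[of y z \<phi> \<phi>'] continuous_on_subset[OF cont(1), of "{y..z}"] xyz zero d1 by auto
  obtain \<xi> where \<xi>: "\<xi>1 < \<xi>" "\<xi> < \<xi>2" "\<phi>'' \<xi> = 0"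
    using rolle[of \<xi>1 \<xi>2 \<phi>' \<phi>''] continuous_on_subset[OF cont(2), of "{\<xi>1..\<xi>2}"] \<xi>1 \<xi>2 d2 by auto
  have \<phi>'': "\<bar>\<phi>'' s\<bar> \<le> M * (z - x)" if "s \<in> {x..z}" for s
    using mean_value_bound[OF cont(3) d3 bound M that, of \<xi>] \<xi> \<xi>1 \<xi>2 by auto
  have "\<bar>\<phi>' s - \<phi>' \<xi>1\<bar> \<le> (M * (z - x)) * (z - x)"
    using \<xi>1 xyz M s by (intro mean_value_bound[OF cont(2) d2 \<phi>'']) auto
  then show ?thesis using \<xi>1 by (simp add: power2_eq_square ac_simps)
qed

text \<open>
  A function of mean zero only sees the oscillation of the weight, which is its increment over the
  interval because the weight is monotone.
\<close>

lemma mean_zero_weighted_bound: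
  fixes \<phi> v B :: "real \<Rightarrow> real"
  assumes cont: "continuous_on {a<..<b} \<phi>" and zero: "(\<phi> has_integral 0) {a..b}"
    and bound: "\<And>s. s \<in> {a<..<b} \<Longrightarrow> \<bar>\<phi> s\<bar> \<le> B s" and B: "(B has_integral \<epsilon>) {a..b}"
    and v: "continuous_on {a..b} v" "mono_on {a..b} v"
  shows "(\<lambda>s. \<phi> s * v s) integrable_on {a..b}" "\<bar>integral {a..b} (\<lambda>s. \<phi> s * v s)\<bar> \<le> \<epsilon> * (v b - v a)"
proof -
  have 1: "continuous_on {a<..<b} (\<lambda>s. \<phi> s * (v s - v a))"
    by (intro continuous_intros cont continuous_on_subset[OF v(1)]) auto
  have 2: "\<bar>\<phi> s * (v s - v a)\<bar> \<le> B s * (v b - v a)" if s: "s \<in> {a<..<b}" for s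
  proof -
    have "v a \<le> v s" "v s \<le> v b" using s by (auto intro!: mono_onD[OF v(2)])
    then show ?thesis unfolding abs_mult using bound[OF s] by (intro mult_mono) auto
  qed
  have 3: "((\<lambda>s. B s * (v b - v a)) has_integral \<epsilon> * (v b - v a)) {a..b}"
    using B by (rule has_integral_mult_left)
  note d = dominated_integral[OF 1 2 has_integral_integrable[OF 3]]
  have "((\<lambda>s. \<phi> s * (v s - v a) + \<phi> s * v a) has_integral
      (integral {a..b} (\<lambda>s. \<phi> s * (v s - v a)) + 0 * v a)) {a..b}"
    by (intro has_integral_add integrable_integral d(1) has_integral_mult_left zero)
  then have 4: "((\<lambda>s. \<phi> s * v s) has_integral integral {a..b} (\<lambda>s. \<phi> s * (v s - v a))) {a..b}"
    by (simp add: algebra_simps)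
  from 4 show "(\<lambda>s. \<phi> s * v s) integrable_on {a..b}" by (rule has_integral_integrable)
  from d(2)[unfolded integral_unique[OF 3]] show "\<bar>integral {a..b} (\<lambda>s. \<phi> s * v s)\<bar> \<le> \<epsilon> * (v b - v a)"
    unfolding integral_unique[OF 4] .
qed

text \<open>
  Bounds on the first and third derivatives are what the truncation error depends on: interpolation at
  the first three nodes, one of which is time zero, is controlled by the first derivative, and all
  other quadratic interpolation errors by the third.
\<close>

locale singular_function =
  fixes \<alpha> T K :: real and g g1 g2 g3 :: "real \<Rightarrow> real"
  assumes alpha: "0 < \<alpha>" "\<alpha> < 1"
    and g_cont: "continuous_on {0..T} g"
    and g_deriv: "\<And>s. s \<in> {0<..T} \<Longrightarrow> (g has_real_derivative g1 s) (at s within {0<..T})"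
    and g1_deriv: "\<And>s. s \<in> {0<..T} \<Longrightarrow> (g1 has_real_derivative g2 s) (at s within {0<..T})"
    and g2_deriv: "\<And>s. s \<in> {0<..T} \<Longrightarrow> (g2 has_real_derivative g3 s) (at s within {0<..T})"
    and g1_bound: "\<And>s. s \<in> {0<..T} \<Longrightarrow> \<bar>g1 s\<bar> \<le> K * s powr (\<alpha> - 1)"
    and g3_bound: "\<And>s. s \<in> {0<..T} \<Longrightarrow> \<bar>g3 s\<bar> \<le> K * s powr (\<alpha> - 3)"
    and K_nonneg: "0 \<le> K"
begin

lemma interior_deriv:
  assumes "s \<in> {0<..<T}"
  shows "(g has_real_derivative g1 s) (at s)" "(g1 has_real_derivative g2 s) (at s)"
    "(g2 has_real_derivative g3 s) (at s)"
proof -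
  have "at s within {0<..T} = at s" using assms by (intro at_within_interior interiorI[of "{0<..<T}"]) auto
  then show "(g has_real_derivative g1 s) (at s)" "(g1 has_real_derivative g2 s) (at s)"
    "(g2 has_real_derivative g3 s) (at s)"
    using assms g_deriv[of s] g1_deriv[of s] g2_deriv[of s] by auto
qed

lemma g1_cont: "continuous_on {0<..T} g1" and g2_cont: "continuous_on {0<..T} g2"
  by (rule DERIV_continuous_on[OF g1_deriv], assumption) (rule DERIV_continuous_on[OF g2_deriv])

lemma g1_has_integral:
  assumes "0 \<le> a" "a \<le> b" "b \<le> T"
  shows "(g1 has_integral g b - g a) {a..b}"
proof (rule fundamental_theorem_of_calculus_interior[OF assms(2)])
  show "continuous_on {a..b} g" using assms by (intro continuous_on_subset[OF g_cont]) auto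
  show "(g has_vector_derivative g1 s) (at s)" if "s \<in> {a<..<b}" for s
    using interior_deriv(1)[of s] that assms by (auto simp: has_real_derivative_iff_has_vector_derivative)
qed

lemma g_increment_from_0:
  assumes "0 \<le> b" "b \<le> T"
  shows "\<bar>g b - g 0\<bar> \<le> K * b powr \<alpha> / \<alpha>"
proof -
  have B: "((\<lambda>s. K * s powr (\<alpha> - 1)) has_integral K * (b powr (\<alpha> - 1 + 1) / (\<alpha> - 1 + 1))) {0..b}"
    using alpha assms by (intro has_integral_mult_right has_integral_powr_from_0) auto
  have "\<bar>integral {0..b} g1\<bar> \<le> integral {0..b} (\<lambda>s. K * s powr (\<alpha> - 1))"
    using assms g1_bound
    by (intro dominated_integral(2)[OF _ _ has_integral_integrable[OF B]] continuous_on_subset[OF g1_cont]) auto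
  then show ?thesis
    using integral_unique[OF g1_has_integral[of 0 b]] integral_unique[OF B] assms by simp
qed

text \<open>
  Both singularities are integrable, and at each \<open>s\<close> one of the two factors can be replaced by its value
  at \<open>t / 2\<close>; so the integral is bounded independently of \<open>t\<close>.
\<close>

lemma caputo_kernel_dominated:
  assumes t: "0 < t" "t \<le> T"
  shows "(\<lambda>s. g1 s * (t - s) powr (- \<alpha>)) integrable_on {0..t}"
    "\<bar>integral {0..t} (\<lambda>s. g1 s * (t - s) powr (- \<alpha>))\<bar> \<le> 2 * K / (\<alpha> * (1 - \<alpha>))"
    "(\<lambda>s. g1 s * (t - s) powr (- \<alpha>)) absolutely_integrable_on {0<..<t}"
proof -
  define B where "B s = K * ((t / 2) powr (- \<alpha>) * s powr (\<alpha> - 1) + (t / 2) powr (\<alpha> - 1) * (t - s) powr (- \<alpha>))" for s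
  have B: "(B has_integral K * ((t / 2) powr (- \<alpha>) * (t powr (\<alpha> - 1 + 1) / (\<alpha> - 1 + 1))
      + (t / 2) powr (\<alpha> - 1) * (((t - 0) powr (- \<alpha> + 1) - (t - t) powr (- \<alpha> + 1)) / (- \<alpha> + 1)))) {0..t}"
    unfolding B_def using alpha t
    by (intro has_integral_add has_integral_mult_right has_integral_powr_from_0 has_integral_reflected_powr) auto
  have 1: "continuous_on {0<..<t} (\<lambda>s. g1 s * (t - s) powr (- \<alpha>))"
    using t by (intro continuous_intros continuous_on_subset[OF g1_cont]) auto
  have 2: "\<bar>g1 s * (t - s) powr (- \<alpha>)\<bar> \<le> B s" if s: "s \<in> {0<..<t}" for s
  proof -
    have "\<bar>g1 s * (t - s) powr (- \<alpha>)\<bar> \<le> K * s powr (\<alpha> - 1) * (t - s) powr (- \<alpha>)"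
      unfolding abs_mult using g1_bound[of s] s t by (intro mult_mono) auto
    also have "\<dots> = K * (s powr (\<alpha> - 1) * (t - s) powr (- \<alpha>))" by simp
    also have "\<dots> \<le> B s"
      unfolding B_def
    proof (rule mult_left_mono[OF _ K_nonneg], cases "s \<le> t / 2")
      case True
      then have "(t - s) powr (- \<alpha>) \<le> (t / 2) powr (- \<alpha>)" using t alpha by (intro powr_mono2') auto
      then have "s powr (\<alpha> - 1) * (t - s) powr (- \<alpha>) \<le> s powr (\<alpha> - 1) * (t / 2) powr (- \<alpha>)"
        by (intro mult_left_mono) auto
      then show "s powr (\<alpha> - 1) * (t - s) powr (- \<alpha>)
          \<le> (t / 2) powr (- \<alpha>) * s powr (\<alpha> - 1) + (t / 2) powr (\<alpha> - 1) * (t - s) powr (- \<alpha>)"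
        by (intro add_increasing2 mult_nonneg_nonneg) (simp_all add: mult.commute)
    next
      case False
      then have "s powr (\<alpha> - 1) \<le> (t / 2) powr (\<alpha> - 1)" using t alpha by (intro powr_mono2') auto
      then have "s powr (\<alpha> - 1) * (t - s) powr (- \<alpha>) \<le> (t / 2) powr (\<alpha> - 1) * (t - s) powr (- \<alpha>)"
        by (intro mult_right_mono) auto
      then show "s powr (\<alpha> - 1) * (t - s) powr (- \<alpha>)
          \<le> (t / 2) powr (- \<alpha>) * s powr (\<alpha> - 1) + (t / 2) powr (\<alpha> - 1) * (t - s) powr (- \<alpha>)"
        by (intro add_increasing mult_nonneg_nonneg) simp_all
    qed
    finally show ?thesis .
  qed
  note d = dominated_integral[OF 1 2 has_integral_integrable[OF B]]
  show "(\<lambda>s. g1 s * (t - s) powr (- \<alpha>)) integrable_on {0..t}"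
    "(\<lambda>s. g1 s * (t - s) powr (- \<alpha>)) absolutely_integrable_on {0<..<t}"
    using d by auto
  have "(t / 2) powr (- \<alpha>) * t powr \<alpha> = 2 powr \<alpha>" "(t / 2) powr (\<alpha> - 1) * t powr (1 - \<alpha>) = 2 powr (1 - \<alpha>)"
    using t by (simp_all add: powr_divide powr_minus_divide powr_diff)
  moreover have "2 powr \<alpha> \<le> 2 powr 1" "2 powr (1 - \<alpha>) \<le> 2 powr (1::real)"
    using alpha powr_mono[of \<alpha> 1 2] powr_mono[of "1 - \<alpha>" 1 2] by simp_all
  ultimately have e: "(t / 2) powr (- \<alpha>) * t powr \<alpha> / \<alpha> + (t / 2) powr (\<alpha> - 1) * t powr (1 - \<alpha>) / (1 - \<alpha>)
      \<le> 2 / \<alpha> + 2 / (1 - \<alpha>)"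
    using alpha by (intro add_mono divide_right_mono) auto
  also have "\<dots> = 2 / (\<alpha> * (1 - \<alpha>))" using alpha by (simp add: field_simps)
  finally have "K * ((t / 2) powr (- \<alpha>) * t powr \<alpha> / \<alpha> + (t / 2) powr (\<alpha> - 1) * t powr (1 - \<alpha>) / (1 - \<alpha>))
      \<le> K * (2 / (\<alpha> * (1 - \<alpha>)))"
    by (intro mult_left_mono K_nonneg)
  with d(2) integral_unique[OF B] show "\<bar>integral {0..t} (\<lambda>s. g1 s * (t - s) powr (- \<alpha>))\<bar> \<le> 2 * K / (\<alpha> * (1 - \<alpha>))"
    by (simp add: mult.commute)
qed

end

locale mesh_and_function = nondecreasing_mesh \<alpha> t + singular_function \<alpha> T K g g1 g2 g3
  for \<alpha> t T K g g1 g2 g3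
begin

abbreviation samples :: "nat \<Rightarrow> real" where
  "samples j \<equiv> g (t j)"

text \<open>The derivative of \<open>H\<^sub>2\<^sup>j - g\<close>, where \<open>H\<^sub>2\<^sup>j\<close> interpolates the samples of \<open>g\<close>.\<close>

definition defect :: "nat \<Rightarrow> real \<Rightarrow> real" where
  "defect j s = (dq samples j + (2 * s - t (j - 1) - t j) * curv samples j) - g1 s"

lemma defect_cont: "continuous_on {0<..T} (defect j)"
  unfolding defect_def[abs_def] by (intro continuous_intros g1_cont)

lemma defect_has_integral_0:
  assumes "1 \<le> j" "t j \<le> T"
  shows "(defect j has_integral 0) {t (j - 1)..t j}"
proof -
  have 1: "((\<lambda>s. dq samples j + (2 * s - t (j - 1) - t j) * curv samples j) has_integral
     (H2_interp t samples j (t j) - H2_interp t samples j (t (j - 1)))) {t (j - 1)..t j}"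
    using H2_interp_has_derivative[OF assms(1), of samples]
    by (intro fundamental_theorem_of_calculus t_pred_le)
      (simp add: has_real_derivative_iff_has_vector_derivative[symmetric] has_field_derivative_at_within)
  have 2: "(g1 has_integral g (t j) - g (t (j - 1))) {t (j - 1)..t j}"
    using t_pred_le t_nonneg assms by (intro g1_has_integral) auto
  from has_integral_diff[OF 1 2] show ?thesis
    using H2_interp_nodes[OF assms(1), of samples] by (simp add: defect_def[abs_def])
qed

lemma defect_bound:
  assumes j: "2 \<le> j" "t (Suc j) \<le> T" and s: "s \<in> {t (j - 1)..t (Suc j)}"
  shows "\<bar>defect j s\<bar> \<le> (\<tau> j + \<tau> (Suc j))\<^sup>2 * (K * t (j - 1) powr (\<alpha> - 3))"
proof -
  have j1: "1 \<le> j" using j by simp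
  let ?\<phi> = "\<lambda>s. H2_interp t samples j s - g s"
  let ?\<phi>2 = "\<lambda>s. 2 * curv samples j - g2 s"
  have pos: "0 < t (j - 1)" using t_strict_mono[of 0 "j - 1"] t0 j by simp
  have sub: "{t (j - 1)..t (Suc j)} \<subseteq> {0<..T}" using pos j by auto
  have sub': "{t (j - 1)<..<t (Suc j)} \<subseteq> {0<..<T}" using pos j by auto
  have "\<bar>defect j s\<bar> \<le> (t (Suc j) - t (j - 1))\<^sup>2 * (K * t (j - 1) powr (\<alpha> - 3))"
  proof (rule three_zeros_derivative_bound[where \<phi> = ?\<phi> and y = "t j" and \<phi>'' = ?\<phi>2 and \<phi>''' = "\<lambda>s. - g3 s", OF _ _ _ _ _ _ _ _ _ _ _ _ _ s])
    show "t (j - 1) < t j" "t j < t (Suc j)" using j by (auto intro: t_strict_mono)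
    show "?\<phi> (t (j - 1)) = 0" "?\<phi> (t j) = 0" "?\<phi> (t (Suc j)) = 0"
      using H2_interp_nodes[OF j1, of samples] by simp_all
    show "continuous_on {t (j - 1)..t (Suc j)} ?\<phi>"
      unfolding H2_interp_newton[OF j1] using sub
      by (intro continuous_intros continuous_on_subset[OF g_cont]) auto
    show "continuous_on {t (j - 1)..t (Suc j)} (defect j)"
      by (rule continuous_on_subset[OF defect_cont sub])
    show "continuous_on {t (j - 1)..t (Suc j)} ?\<phi>2"
      by (intro continuous_intros continuous_on_subset[OF g2_cont sub])
    show "0 \<le> K * t (j - 1) powr (\<alpha> - 3)" using K_nonneg by simp
    fix s assume "s \<in> {t (j - 1)<..<t (Suc j)}"
    then have s: "s \<in> {0<..<T}" "t (j - 1) < s" using sub' by auto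
    show "(?\<phi> has_real_derivative defect j s) (at s)"
      unfolding defect_def by (intro DERIV_diff H2_interp_has_derivative[OF j1] interior_deriv s)
    show "(defect j has_real_derivative ?\<phi>2 s) (at s)"
      unfolding defect_def[abs_def]
      by (intro DERIV_diff interior_deriv s) (auto intro!: derivative_eq_intros)
    show "(?\<phi>2 has_real_derivative - g3 s) (at s)"
      using interior_deriv(3)[OF s(1)] by (auto intro!: derivative_eq_intros)
    have "\<bar>g3 s\<bar> \<le> K * s powr (\<alpha> - 3)" using s by (intro g3_bound) auto
    also have "\<dots> \<le> K * t (j - 1) powr (\<alpha> - 3)"
      using s pos alpha by (intro mult_left_mono powr_mono2' K_nonneg) auto
    finally show "\<bar>- g3 s\<bar> \<le> K * t (j - 1) powr (\<alpha> - 3)" by simp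
  qed
  then show ?thesis by (simp add: \<tau>_def)
qed

text \<open>
  The derivative of the first interpolant is bounded through the two divided differences, which
  are means of \<open>g'\<close> over the first two cells.
\<close>

lemma defect_bound_first:
  assumes "t 2 \<le> T" "s \<in> {0<..t 2}"
  shows "\<bar>defect 1 s + g1 s\<bar> \<le> 5 / \<alpha> * K * \<tau> 1 powr (\<alpha> - 1)"
proof -
  have p: "0 < \<tau> 1" "0 < \<tau> 2" using tau_pos by auto
  have t1: "t 1 = \<tau> 1" "t 2 = \<tau> 1 + \<tau> 2" using t0 by (auto simp: \<tau>_def eval_nat_numeral)
  define X where "X = K * \<tau> 1 powr (\<alpha> - 1) / \<alpha>"
  have X: "0 \<le> X" using K_nonneg alpha by (simp add: X_def)
  have "\<bar>g (t 1) - g 0\<bar> \<le> K * t 1 powr \<alpha> / \<alpha>"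
    using assms t1 p by (intro g_increment_from_0) auto
  then have "\<bar>g (t 1) - g (t 0)\<bar> / \<tau> 1 \<le> K * \<tau> 1 powr \<alpha> / \<alpha> / \<tau> 1"
    using p t1 t0 by (intro divide_right_mono) auto
  then have d1: "\<bar>dq samples 1\<bar> \<le> X"
    using p by (simp add: dq_def X_def powr_diff abs_divide ac_simps)
  have "\<bar>g (t 2) - g (t 1)\<bar> \<le> (K * \<tau> 1 powr (\<alpha> - 1)) * (t 2 - t 1)"
  proof (rule mean_value_bound[where f = g and f' = g1])
    show "continuous_on {t 1..t 2} g" using assms t1 p by (intro continuous_on_subset[OF g_cont]) auto
    fix s assume s: "s \<in> {t 1<..<t 2}"
    show "(g has_real_derivative g1 s) (at s)" using s assms t1 p by (intro interior_deriv) auto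
    have "\<bar>g1 s\<bar> \<le> K * s powr (\<alpha> - 1)" using s assms t1 p by (intro g1_bound) auto
    also have "\<dots> \<le> K * \<tau> 1 powr (\<alpha> - 1)" using s t1 p alpha by (intro mult_left_mono powr_mono2' K_nonneg) auto
    finally show "\<bar>g1 s\<bar> \<le> K * \<tau> 1 powr (\<alpha> - 1)" .
  qed (use t1 p K_nonneg in auto)
  then have "\<bar>dq samples 2\<bar> \<le> K * \<tau> 1 powr (\<alpha> - 1)"
    using p t1 by (simp add: dq_def pos_divide_le_eq)
  also have "\<dots> \<le> X"
    unfolding X_def using alpha K_nonneg mult_left_le[of \<alpha> "K * \<tau> 1 powr (\<alpha> - 1)"]
    by (simp add: pos_le_divide_eq)
  finally have d2: "\<bar>dq samples 2\<bar> \<le> X" .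
  have "\<bar>curv samples 1\<bar> \<le> 2 * X / (\<tau> 1 + \<tau> 2)"
  proof -
    have "\<bar>dq samples 2 - dq samples 1\<bar> \<le> 2 * X" using d1 d2 by linarith
    then have "\<bar>dq samples 2 - dq samples 1\<bar> / (\<tau> 1 + \<tau> 2) \<le> 2 * X / (\<tau> 1 + \<tau> 2)"
      using p by (intro divide_right_mono) auto
    then show ?thesis using p by (simp add: curv_def abs_divide numeral_2_eq_2)
  qed
  moreover have "\<bar>2 * s - t 0 - t 1\<bar> \<le> 2 * (\<tau> 1 + \<tau> 2)" using assms t1 t0 p by auto
  ultimately have "\<bar>(2 * s - t 0 - t 1) * curv samples 1\<bar> \<le> (2 * (\<tau> 1 + \<tau> 2)) * (2 * X / (\<tau> 1 + \<tau> 2))"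
    unfolding abs_mult using p X by (intro mult_mono) auto
  also have "\<dots> = 4 * X" using p by (simp add: field_simps)
  finally have "\<bar>(2 * s - t 0 - t 1) * curv samples 1\<bar> \<le> 4 * X" .
  moreover have "\<bar>dq samples 1 + (2 * s - t 0 - t 1) * curv samples 1\<bar>
      \<le> \<bar>dq samples 1\<bar> + \<bar>(2 * s - t 0 - t 1) * curv samples 1\<bar>" by (rule abs_triangle_ineq)
  ultimately have "\<bar>dq samples 1 + (2 * s - t 0 - t 1) * curv samples 1\<bar> \<le> 5 * X"
    using d1 by linarith
  then show ?thesis by (simp add: defect_def X_def)
qed

end

lemma sum_inverse_sqrt_le: "(\<Sum>j=1..n. real j powr (- 1/2)) \<le> 2 * real n powr (1/2)"
proof (induction n)
  case (Suc n)
  define a b where "a = sqrt (real n)" and "b = sqrt (real (Suc n))"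
  have ab: "0 \<le> a" "0 < b" "b\<^sup>2 = a\<^sup>2 + 1" by (auto simp: a_def b_def)
  have "0 \<le> (b - a)\<^sup>2" by simp
  then have "2 * a * b + 1 \<le> 2 * b * b" using ab(3) by (simp add: power2_eq_square algebra_simps)
  then have "2 * a + 1 / b \<le> 2 * b" using ab(2) by (simp add: field_simps)
  moreover have "real (Suc n) powr (- 1/2) = 1 / b" "real (Suc n) powr (1/2) = b" "real n powr (1/2) = a"
    by (auto simp: a_def b_def powr_half_sqrt powr_minus_divide)
  ultimately show ?case using Suc by simp
qed simp

context nondecreasing_mesh
begin

lemma integral_over_cells:
  fixes f :: "real \<Rightarrow> real"
  shows "f integrable_on {0..t n} \<Longrightarrow> integral {0..t n} f = (\<Sum>j=1..n. integral {t (j - 1)..t j} f)"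
proof (induction n)
  case (Suc n)
  have le: "0 \<le> t n" "t n \<le> t (Suc n)" using t_nonneg t_Suc_less less_imp_le by auto
  have "f integrable_on {0..t n}"
    using le by (intro integrable_on_subinterval[OF Suc.prems]) auto
  moreover have "integral {0..t (Suc n)} f = integral {0..t n} f + integral {t n..t (Suc n)} f"
    by (rule Henstock_Kurzweil_Integration.integral_combine[OF le Suc.prems, symmetric])
  ultimately show ?case using Suc.IH by simp
qed (simp add: t0)

lemma w_increment_le:
  assumes "1 \<le> j" "j < k"
  shows "w k (t j) - w k (t (j - 1)) \<le> \<tau> j * (\<alpha> * (t k - t j) powr (- \<alpha> - 1))"
proof -
  have lt: "t (j - 1) < t j" "t j < t k" using assms by (auto intro: t_strict_mono)
  have "\<exists>z. t (j - 1) < z \<and> z < t j \<and> w k (t j) - w k (t (j - 1))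
      = (t j - t (j - 1)) * (- (- \<alpha>) * (t k - z) powr (- \<alpha> - 1))"
    unfolding w_def using lt by (intro MVT2 has_derivative_reflected_powr) auto
  then obtain z where z: "t (j - 1) < z" "z < t j"
    "w k (t j) - w k (t (j - 1)) = \<tau> j * (\<alpha> * (t k - z) powr (- \<alpha> - 1))"
    by (auto simp: \<tau>_def)
  show ?thesis unfolding z(3) using z lt alpha tau_nonneg
    by (intro mult_left_mono powr_mono2') auto
qed

lemma w_cell_mono: "j < k \<Longrightarrow> mono_on {t (j - 1)..t j} (w k)"
  by (rule convex_increasing_mono_step[OF convex_increasing_w]) auto

lemma w_cell_cont: "j < k \<Longrightarrow> continuous_on {t (j - 1)..t j} (w k)"
  by (rule convex_increasing_continuous_step[OF convex_increasing_w]) auto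

end

abbreviation truncation_rate :: "real \<Rightarrow> real \<Rightarrow> nat \<Rightarrow> real" where
  "truncation_rate \<alpha> r k \<equiv> real k powr (\<alpha> - 3) + real k powr (1/2 - r * (1 + \<alpha>))"

section \<open>Truncation error on power-graded meshes\<close>

text \<open>
  The mesh behaves like \<open>c k\<^sup>r\<close>. The scale \<open>c\<close> will depend on the number of steps, \<open>\<kappa>\<close> will not, and all
  powers of \<open>c\<close> cancel in the truncation error.
\<close>

locale power_graded_mesh = nondecreasing_mesh \<alpha> t for \<alpha> t +
  fixes r c \<kappa> :: real
  assumes r: "1 < r" and c: "0 < c" and kappa: "1 \<le> \<kappa>"
    and tau_lower': "\<And>k. 1 \<le> k \<Longrightarrow> c * real k powr (r - 1) \<le> t k - t (k - 1)"
    and tau_upper': "\<And>k. 1 \<le> k \<Longrightarrow> t k - t (k - 1) \<le> \<kappa> * c * real k powr (r - 1)"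
    and gap: "\<And>j k. j \<le> k \<Longrightarrow> c * real (k - j) powr r \<le> t k - t j"
begin

lemma tau_lower: "1 \<le> k \<Longrightarrow> c * real k powr (r - 1) \<le> \<tau> k"
  and tau_upper: "1 \<le> k \<Longrightarrow> \<tau> k \<le> \<kappa> * c * real k powr (r - 1)"
  unfolding \<tau>_def by (rule tau_lower', assumption) (rule tau_upper')

lemma t_lower: "c * real k powr r \<le> t k"
  using gap[of 0 k] t0 by simp

text \<open>
  Up to a constant, what cell \<open>j\<close> contributes to the truncation error at \<open>t\<^sub>k\<close>: an interpolation error
  of size \<open>c\<^sup>\<alpha> j\<^bsup>r\<alpha> - 3\<^esup>\<close>, seen through the increment of the kernel.
\<close>

abbreviation cell_weight :: "nat \<Rightarrow> nat \<Rightarrow> real" where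
  "cell_weight k j \<equiv> c powr \<alpha> * real j powr (r * \<alpha> - 3) * (w k (t j) - w k (t (j - 1)))"

text \<open>
  If \<open>2 j \<le> k\<close> then \<open>t\<^sub>k - t\<^sub>j\<close> is comparable with \<open>t\<^sub>k\<close> and the increment of the kernel is small; this is
  the first term. Otherwise \<open>j\<close> is comparable with \<open>k\<close> and the factor depending on \<open>j\<close> can be frozen at
  \<open>k\<close>; this is the second term, whose sum over \<open>j\<close> telescopes.
\<close>

lemma weighted_increment_le:
  assumes j: "1 \<le> j" "j < k"
  shows "cell_weight k j
    \<le> \<alpha> * \<kappa> * 2 powr (r * (\<alpha> + 1)) * real k powr (- r * (\<alpha> + 1)) * real j powr (r * \<alpha> + r - 4)
      + 8 * real k powr (r * \<alpha> - 3) * c powr \<alpha> * (w k (t j) - w k (t (j - 1)))"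
    (is "?L \<le> ?X + ?Y")
proof -
  have "w k (t (j - 1)) \<le> w k (t j)"
    using t_pred_le[of j] j(2) by (intro mono_onD[OF w_cell_mono]) auto
  then have d: "0 \<le> w k (t j) - w k (t (j - 1))" by simp
  have X: "0 \<le> ?X" using alpha kappa by (intro mult_nonneg_nonneg) auto
  have Y: "0 \<le> ?Y" using d by (intro mult_nonneg_nonneg) auto
  show ?thesis
  proof (cases "2 * j \<le> k")
    case True
    have "c * (real k / 2) powr r \<le> c * real (k - j) powr r"
      using True j r c by (intro mult_left_mono powr_mono2) auto
    also have "\<dots> \<le> t k - t j" using j by (intro gap) auto
    finally have "(t k - t j) powr (- \<alpha> - 1) \<le> (c * (real k / 2) powr r) powr (- \<alpha> - 1)"
      using alpha c j by (intro powr_mono2') auto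
    also have "\<dots> = c powr (- \<alpha> - 1) * ((real k / 2) powr (- r * (\<alpha> + 1)))"
    proof -
      have "r * (- \<alpha> - 1) = - (r * (\<alpha> + 1))" by (simp add: algebra_simps)
      then show ?thesis using c by (simp add: powr_mult powr_powr)
    qed
    also have "(real k / 2) powr (- r * (\<alpha> + 1)) = real k powr (- r * (\<alpha> + 1)) * 2 powr (r * (\<alpha> + 1))"
      by (simp add: powr_divide powr_minus divide_simps)
    finally have 1: "(t k - t j) powr (- \<alpha> - 1)
      \<le> c powr (- \<alpha> - 1) * (real k powr (- r * (\<alpha> + 1)) * 2 powr (r * (\<alpha> + 1)))" .
    have "w k (t j) - w k (t (j - 1)) \<le> \<tau> j * (\<alpha> * (t k - t j) powr (- \<alpha> - 1))"
      using j by (rule w_increment_le)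
    also have "\<dots> \<le> (\<kappa> * c * real j powr (r - 1)) *
        (\<alpha> * (c powr (- \<alpha> - 1) * (real k powr (- r * (\<alpha> + 1)) * 2 powr (r * (\<alpha> + 1)))))"
      using 1 alpha tau_upper[OF j(1)] kappa c by (intro mult_mono mult_left_mono) auto
    finally have "?L \<le> c powr \<alpha> * real j powr (r * \<alpha> - 3) * ((\<kappa> * c * real j powr (r - 1)) *
        (\<alpha> * (c powr (- \<alpha> - 1) * (real k powr (- r * (\<alpha> + 1)) * 2 powr (r * (\<alpha> + 1))))))"
      by (intro mult_left_mono) auto
    also have "\<dots> = \<alpha> * \<kappa> * 2 powr (r * (\<alpha> + 1)) * real k powr (- r * (\<alpha> + 1)) *
        (c powr \<alpha> * c * c powr (- \<alpha> - 1)) * (real j powr (r * \<alpha> - 3) * real j powr (r - 1))"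
      by (simp only: ac_simps)
    also have "c powr \<alpha> * c * c powr (- \<alpha> - 1) = 1"
      using c by (simp add: powr_diff powr_minus_divide)
    also have "real j powr (r * \<alpha> - 3) * real j powr (r - 1) = real j powr (r * \<alpha> + r - 4)"
      by (simp add: powr_add[symmetric])
    finally have "?L \<le> ?X" by simp
    then show ?thesis using Y by linarith
  next
    case False
    have "real j powr (r * \<alpha> - 3) \<le> 8 * real k powr (r * \<alpha> - 3)"
    proof (cases "r * \<alpha> - 3 \<ge> 0")
      case True
      then have "real j powr (r * \<alpha> - 3) \<le> real k powr (r * \<alpha> - 3)"
        using j by (intro powr_mono2) auto
      then show ?thesis by (rule order_trans) simp
    next
      case neg: False
      have "real j powr (r * \<alpha> - 3) \<le> (real k / 2) powr (r * \<alpha> - 3)"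
        using j False neg by (intro powr_mono2') auto
      also have "\<dots> = 2 powr (3 - r * \<alpha>) * real k powr (r * \<alpha> - 3)"
        by (simp add: powr_divide powr_diff)
      also have "\<dots> \<le> 2 powr 3 * real k powr (r * \<alpha> - 3)"
        using r alpha by (intro mult_right_mono powr_mono) auto
      finally show ?thesis by simp
    qed
    then have "c powr \<alpha> * real j powr (r * \<alpha> - 3) * (w k (t j) - w k (t (j - 1)))
       \<le> c powr \<alpha> * (8 * real k powr (r * \<alpha> - 3)) * (w k (t j) - w k (t (j - 1)))"
      using d by (intro mult_right_mono mult_left_mono) auto
    also have "\<dots> = ?Y" by (simp add: ac_simps)
    finally show ?thesis using X by linarith
  qed
qed

text \<open>
  The sum of \<open>j\<^bsup>x\<^esup>\<close>, with \<open>x = r\<alpha> + r - 4\<close> of any sign, is compared with the sum of \<open>j\<^bsup>-1/2\<^esup>\<close>. This avoids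
  a logarithmic case at \<open>x = -1\<close>, and the exponent 1/2 lost is harmless because
  \<open>r(1 + \<alpha>) - 1/2\<close> is still large enough for the final summation.
\<close>

lemma weighted_increments_sum_le:
  assumes k: "2 \<le> k"
  shows "(\<Sum>j=1..k-1. cell_weight k j)
    \<le> (2 * \<alpha> * \<kappa> * 2 powr (r * (\<alpha> + 1)) + 8) * truncation_rate \<alpha> r k"
proof -
  define x where "x = r * \<alpha> + r - 4"
  define C where "C = \<alpha> * \<kappa> * 2 powr (r * (\<alpha> + 1))"
  have C: "0 \<le> C" using alpha kappa by (simp add: C_def)
  have k0: "0 < real k" using k by simp
  have "(\<Sum>j=1..k-1. cell_weight k j)
     \<le> (\<Sum>j=1..k-1. C * real k powr (- r * (\<alpha> + 1)) * real j powr x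
         + 8 * real k powr (r * \<alpha> - 3) * c powr \<alpha> * (w k (t j) - w k (t (j - 1))))"
    unfolding C_def x_def by (intro sum_mono weighted_increment_le) auto
  also have "\<dots> = C * real k powr (- r * (\<alpha> + 1)) * (\<Sum>j=1..k-1. real j powr x)
      + 8 * real k powr (r * \<alpha> - 3) * c powr \<alpha> * (\<Sum>j=1..k-1. w k (t j) - w k (t (j - 1)))"
    by (simp add: sum.distrib sum_distrib_left)
  also have "(\<Sum>j=1..k-1. w k (t j) - w k (t (j - 1))) = w k (t (k - 1)) - w k (t 0)"
  proof -
    have "(\<Sum>j=1..m. w k (t j) - w k (t (j - 1))) = w k (t m) - w k (t 0)" for m
      by (induction m) auto
    then show ?thesis .
  qed
  also have "C * real k powr (- r * (\<alpha> + 1)) * (\<Sum>j=1..k-1. real j powr x)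
      \<le> C * real k powr (- r * (\<alpha> + 1)) * (2 * real k powr (1/2) * (1 + real k powr (x + 1/2)))"
  proof (intro mult_left_mono)
    have "(\<Sum>j=1..k-1. real j powr x) \<le> (\<Sum>j=1..k-1. real j powr (- 1/2) * (1 + real k powr (x + 1/2)))"
    proof (intro sum_mono)
      fix j assume j: "j \<in> {1..k - 1}"
      have "real j powr (x + 1/2) \<le> 1 + real k powr (x + 1/2)"
      proof (cases "x + 1/2 \<ge> 0")
        case True
        then have "real j powr (x + 1/2) \<le> real k powr (x + 1/2)" using j by (intro powr_mono2) auto
        then show ?thesis by simp
      next
        case False
        then have "real j powr (x + 1/2) \<le> 1 powr (x + 1/2)" using j by (intro powr_mono2') auto
        then show ?thesis by (simp add: add_increasing2)
      qed
      then have "real j powr (- 1/2) * real j powr (x + 1/2) \<le> real j powr (- 1/2) * (1 + real k powr (x + 1/2))"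
        by (intro mult_left_mono) auto
      then show "real j powr x \<le> real j powr (- 1/2) * (1 + real k powr (x + 1/2))"
        by (simp add: powr_add[symmetric])
    qed
    also have "\<dots> = (\<Sum>j=1..k-1. real j powr (- 1/2)) * (1 + real k powr (x + 1/2))"
      by (simp add: sum_distrib_right)
    also have "\<dots> \<le> (2 * real k powr (1/2)) * (1 + real k powr (x + 1/2))"
    proof (intro mult_right_mono)
      have "(\<Sum>j=1..k-1. real j powr (- 1/2)) \<le> (\<Sum>j=1..k. real j powr (- 1/2))"
        by (intro sum_mono2) auto
      then show "(\<Sum>j=1..k-1. real j powr (- 1/2)) \<le> 2 * real k powr (1/2)"
        using sum_inverse_sqrt_le[of k] by linarith
    qed auto
    finally show "(\<Sum>j=1..k-1. real j powr x) \<le> 2 * real k powr (1/2) * (1 + real k powr (x + 1/2))" .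
  qed (use C in auto)
  also have "C * real k powr (- r * (\<alpha> + 1)) * (2 * real k powr (1/2) * (1 + real k powr (x + 1/2)))
      = 2 * C * (real k powr (1/2 - r * (1 + \<alpha>)) + real k powr (- 3))"
  proof -
    have "real k powr (- r * (\<alpha> + 1)) * real k powr (1/2) = real k powr (1/2 - r * (1 + \<alpha>))"
      by (simp add: powr_add[symmetric] algebra_simps)
    moreover have "real k powr (1/2 - r * (1 + \<alpha>)) * real k powr (x + 1/2) = real k powr (- 3)"
      by (simp add: powr_add[symmetric] x_def algebra_simps)
    ultimately have "real k powr (- r * (\<alpha> + 1)) * real k powr (1/2) * (1 + real k powr (x + 1/2))
        = real k powr (1/2 - r * (1 + \<alpha>)) + real k powr (- 3)"
      by (simp add: distrib_left)
    then show ?thesis by (simp add: ac_simps)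
  qed
  also have "2 * C * (real k powr (1/2 - r * (1 + \<alpha>)) + real k powr (- 3))
      \<le> 2 * C * (real k powr (1/2 - r * (1 + \<alpha>)) + real k powr (\<alpha> - 3))"
    using C alpha k by (intro mult_left_mono add_left_mono powr_mono) auto
  also have "8 * real k powr (r * \<alpha> - 3) * c powr \<alpha> * (w k (t (k - 1)) - w k (t 0)) \<le> 8 * real k powr (\<alpha> - 3)"
  proof -
    have "w k (t (k - 1)) - w k (t 0) \<le> w k (t (k - 1))" using w_nonneg by simp
    also have "\<dots> = \<tau> k powr (- \<alpha>)" by (simp add: w_def \<tau>_def)
    also have "\<dots> \<le> (c * real k powr (r - 1)) powr (- \<alpha>)"
      using tau_lower[of k] k c alpha by (intro powr_mono2') auto
    also have "\<dots> = c powr (- \<alpha>) * real k powr (- (r - 1) * \<alpha>)"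
      using c by (simp add: powr_mult powr_powr algebra_simps)
    finally have "8 * real k powr (r * \<alpha> - 3) * c powr \<alpha> * (w k (t (k - 1)) - w k (t 0))
      \<le> 8 * real k powr (r * \<alpha> - 3) * c powr \<alpha> * (c powr (- \<alpha>) * real k powr (- (r - 1) * \<alpha>))"
      by (intro mult_left_mono) auto
    also have "\<dots> = 8 * (c powr \<alpha> * c powr (- \<alpha>)) * (real k powr (r * \<alpha> - 3) * real k powr (- (r - 1) * \<alpha>))"
      by (simp only: ac_simps)
    also have "c powr \<alpha> * c powr (- \<alpha>) = 1" using c by (simp add: powr_add[symmetric])
    also have "real k powr (r * \<alpha> - 3) * real k powr (- (r - 1) * \<alpha>) = real k powr (\<alpha> - 3)"
      by (simp add: powr_add[symmetric] algebra_simps)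
    finally show ?thesis by simp
  qed
  also have "2 * C * (real k powr (1/2 - r * (1 + \<alpha>)) + real k powr (\<alpha> - 3)) + 8 * real k powr (\<alpha> - 3)
      \<le> (2 * C + 8) * truncation_rate \<alpha> r k"
    by (simp add: algebra_simps)
  finally show ?thesis by (simp add: C_def ac_simps)
qed

end

definition defect_const :: "real \<Rightarrow> real \<Rightarrow> real" where
  "defect_const r \<kappa> = 22 * \<kappa>\<^sup>2 * 3 powr (3 * r)"

definition truncation_const :: "real \<Rightarrow> real \<Rightarrow> real \<Rightarrow> real" where
  "truncation_const \<alpha> r \<kappa> = 3 / (\<alpha> * (1 - \<alpha>))
     + \<kappa> * (defect_const r \<kappa> + 48 / \<alpha> * 2 powr r) / (1 - \<alpha>)
     + \<kappa> * (defect_const r \<kappa> + 6 / \<alpha>) * (2 * \<alpha> * \<kappa> * 2 powr (r * (\<alpha> + 1)) + 8)"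

locale power_graded_function =
  power_graded_mesh \<alpha> t r c \<kappa> + mesh_and_function \<alpha> t T K g g1 g2 g3
  for \<alpha> t r c \<kappa> T K g g1 g2 g3
begin

text \<open>
  The bound is stated in terms of an index \<open>i\<close> that may be \<open>j\<close> or \<open>j + 1\<close>, because the last cell uses the
  interpolant of the cell before it. In either case \<open>j - 1 \<ge> i / 3\<close>, whence the powers of 3.
\<close>

lemma defect_power_bound:
  assumes j: "2 \<le> j" "t (Suc j) \<le> T" and i: "j \<le> i" "i \<le> Suc j" and s: "s \<in> {t (j - 1)..t (Suc j)}"
  shows "\<bar>defect j s\<bar> \<le> defect_const r \<kappa> * K * c powr (\<alpha> - 1) * real i powr (r * \<alpha> - r - 2)"
proof -
  define x where "x = real i"
  have x: "0 < x" using i j by (simp add: x_def)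
  have "\<tau> j + \<tau> (Suc j) \<le> 23/5 * \<tau> j" using tau_ratio[of j] j by simp
  also have "\<dots> \<le> 23/5 * (\<kappa> * c * real j powr (r - 1))" using tau_upper[of j] j by simp
  also have "\<dots> \<le> 23/5 * (\<kappa> * c * x powr (r - 1))"
    using kappa c r i by (intro mult_left_mono powr_mono2) (auto simp: x_def)
  finally have "(\<tau> j + \<tau> (Suc j))\<^sup>2 \<le> (23/5 * (\<kappa> * c * x powr (r - 1)))\<^sup>2"
    using tau_nonneg by (intro power_mono) auto
  also have "\<dots> = (529/25) * \<kappa>\<^sup>2 * c\<^sup>2 * x powr (2 * r - 2)"
  proof -
    have "(x powr (r - 1))\<^sup>2 = x powr (2 * r - 2)"
      by (simp add: power2_eq_square powr_add[symmetric])
    then show ?thesis by (simp add: power_mult_distrib power2_eq_square)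
  qed
  also have "\<dots> \<le> 22 * \<kappa>\<^sup>2 * c\<^sup>2 * x powr (2 * r - 2)" by (intro mult_right_mono) auto
  finally have 1: "(\<tau> j + \<tau> (Suc j))\<^sup>2 \<le> 22 * \<kappa>\<^sup>2 * c\<^sup>2 * x powr (2 * r - 2)" .
  have "c * (x / 3) powr r \<le> c * real (j - 1) powr r"
    using c r i j by (intro mult_left_mono powr_mono2) (auto simp: x_def)
  also have "\<dots> \<le> t (j - 1)" by (rule t_lower)
  finally have "t (j - 1) powr (\<alpha> - 3) \<le> (c * (x / 3) powr r) powr (\<alpha> - 3)"
    using alpha c x by (intro powr_mono2') auto
  also have "\<dots> = c powr (\<alpha> - 3) * (x / 3) powr (r * (\<alpha> - 3))"
    using c by (simp add: powr_mult powr_powr)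
  also have "(x / 3) powr (r * (\<alpha> - 3)) = x powr (r * (\<alpha> - 3)) * 3 powr (r * (3 - \<alpha>))"
    using x by (simp add: powr_divide powr_diff right_diff_distrib)
  also have "c powr (\<alpha> - 3) * (x powr (r * (\<alpha> - 3)) * 3 powr (r * (3 - \<alpha>)))
      \<le> c powr (\<alpha> - 3) * (x powr (r * (\<alpha> - 3)) * 3 powr (3 * r))"
    using r alpha by (intro mult_left_mono powr_mono) auto
  finally have 2: "t (j - 1) powr (\<alpha> - 3) \<le> c powr (\<alpha> - 3) * (x powr (r * (\<alpha> - 3)) * 3 powr (3 * r))" .
  have "\<bar>defect j s\<bar> \<le> (\<tau> j + \<tau> (Suc j))\<^sup>2 * (K * t (j - 1) powr (\<alpha> - 3))"
    by (rule defect_bound[OF j s])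
  also have "\<dots> \<le> (22 * \<kappa>\<^sup>2 * c\<^sup>2 * x powr (2 * r - 2)) * (K * (c powr (\<alpha> - 3) * (x powr (r * (\<alpha> - 3)) * 3 powr (3 * r))))"
    using 1 2 K_nonneg by (intro mult_mono) auto
  also have "\<dots> = defect_const r \<kappa> * K * (c\<^sup>2 * c powr (\<alpha> - 3)) * (x powr (2 * r - 2) * x powr (r * (\<alpha> - 3)))"
    by (simp only: defect_const_def ac_simps)
  also have "c\<^sup>2 * c powr (\<alpha> - 3) = c powr (\<alpha> - 1)"
  proof -
    have "c\<^sup>2 = c powr 2" using c by (simp add: powr_numeral)
    then show ?thesis by (simp add: powr_add[symmetric])
  qed
  also have "x powr (2 * r - 2) * x powr (r * (\<alpha> - 3)) = x powr (r * \<alpha> - r - 2)"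
    by (simp add: powr_add[symmetric] algebra_simps)
  finally show ?thesis by (simp add: x_def)
qed

lemma defect_const_nonneg: "0 \<le> defect_const r \<kappa>"
  by (simp add: defect_const_def)

text \<open>
  Here \<open>defect j\<close> has mean zero and \<open>mean_zero_weighted_bound\<close> applies. On the first cell it is dominated
  by a multiple of \<open>s\<^bsup>\<alpha> - 1\<^esup>\<close> plus a constant, on the others by a constant.
\<close>

lemma cell_error:
  assumes j: "1 \<le> j" "j < k" and k: "t k \<le> T"
  shows "(\<lambda>s. defect j s * w k s) integrable_on {t (j - 1)..t j}"
    "\<bar>integral {t (j - 1)..t j} (\<lambda>s. defect j s * w k s)\<bar>
      \<le> \<kappa> * (defect_const r \<kappa> + 6 / \<alpha>) * K * cell_weight k j"
proof -
  have tj: "t (Suc j) \<le> T" "t j \<le> T" using t_mono[of "Suc j" k] t_mono[of j k] j k by auto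
  have cont: "continuous_on {t (j - 1)<..<t j} (defect j)"
    using tj t_nonneg[of "j - 1"] by (intro continuous_on_subset[OF defect_cont]) auto
  have "\<exists>B \<epsilon>. (\<forall>s\<in>{t (j - 1)<..<t j}. \<bar>defect j s\<bar> \<le> B s) \<and> (B has_integral \<epsilon>) {t (j - 1)..t j} \<and>
      \<epsilon> \<le> \<kappa> * (defect_const r \<kappa> + 6 / \<alpha>) * K * (c powr \<alpha> * real j powr (r * \<alpha> - 3))"
  proof (cases "j = 1")
    case True
    define X where "X = 5 / \<alpha> * K * \<tau> 1 powr (\<alpha> - 1)"
    have t1: "t 1 = \<tau> 1" "0 < \<tau> 1" using t0 tau_pos[of 1] by (auto simp: \<tau>_def)
    have t2: "t 2 \<le> T" using tj True by (simp add: numeral_2_eq_2)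
    have "((\<lambda>s. K * s powr (\<alpha> - 1) + X) has_integral
        K * (\<tau> 1 powr (\<alpha> - 1 + 1) / (\<alpha> - 1 + 1)) + (\<tau> 1 - 0) * X) {0..\<tau> 1}"
      using alpha t1 has_integral_const_real[of X 0 "\<tau> 1"]
      by (intro has_integral_add has_integral_mult_right has_integral_powr_from_0) auto
    moreover have "K * (\<tau> 1 powr (\<alpha> - 1 + 1) / (\<alpha> - 1 + 1)) + (\<tau> 1 - 0) * X = 6 / \<alpha> * K * \<tau> 1 powr \<alpha>"
      using t1 by (simp add: X_def powr_diff field_simps)
    ultimately have B: "((\<lambda>s. K * s powr (\<alpha> - 1) + X) has_integral 6 / \<alpha> * K * \<tau> 1 powr \<alpha>) {0..\<tau> 1}"
      by (simp only:)
    have "\<tau> 1 powr \<alpha> \<le> (\<kappa> * c) powr \<alpha>"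
      using tau_upper[of 1] t1 alpha by (intro powr_mono2) auto
    also have "\<dots> = \<kappa> powr \<alpha> * c powr \<alpha>" using kappa c by (simp add: powr_mult)
    also have "\<kappa> powr \<alpha> * c powr \<alpha> \<le> \<kappa> * c powr \<alpha>"
      using powr_mono[of \<alpha> 1 \<kappa>] kappa alpha by (intro mult_right_mono) auto
    finally have "6 / \<alpha> * K * \<tau> 1 powr \<alpha> \<le> 6 / \<alpha> * K * (\<kappa> * c powr \<alpha>)"
      using alpha K_nonneg by (intro mult_left_mono) auto
    also have "\<dots> = \<kappa> * (0 + 6 / \<alpha>) * K * c powr \<alpha>" by simp
    also have "\<dots> \<le> \<kappa> * (defect_const r \<kappa> + 6 / \<alpha>) * K * c powr \<alpha>"
      using kappa alpha K_nonneg defect_const_nonneg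
      by (intro mult_right_mono mult_left_mono add_right_mono) auto
    finally have e: "6 / \<alpha> * K * \<tau> 1 powr \<alpha> \<le> \<kappa> * (defect_const r \<kappa> + 6 / \<alpha>) * K * c powr \<alpha>" .
    have "\<bar>defect 1 s\<bar> \<le> K * s powr (\<alpha> - 1) + X" if "s \<in> {0<..<\<tau> 1}" for s
    proof -
      have "s \<in> {0<..t 2}" "s \<in> {0<..T}" using that t1 t2 t_Suc_less[of 1] by (auto simp: numeral_2_eq_2)
      then show ?thesis using defect_bound_first[OF t2, of s] g1_bound[of s] unfolding X_def by linarith
    qed
    then show ?thesis using B e True t1 t0 by (intro exI[of _ "\<lambda>s. K * s powr (\<alpha> - 1) + X"] exI) auto
  next
    case False
    then have j2: "2 \<le> j" using j by simp
    define X where "X = defect_const r \<kappa> * K * c powr (\<alpha> - 1) * real j powr (r * \<alpha> - r - 2)"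
    have X: "0 \<le> X" using defect_const_nonneg K_nonneg by (simp add: X_def)
    have B: "((\<lambda>s. X) has_integral \<tau> j * X) {t (j - 1)..t j}"
      using has_integral_const_real[of X "t (j - 1)" "t j"] t_pred_le[of j] by (simp add: \<tau>_def)
    have "\<tau> j * X \<le> (\<kappa> * c * real j powr (r - 1)) * X"
      using tau_upper[OF j(1)] X by (intro mult_right_mono)
    also have "\<dots> = \<kappa> * defect_const r \<kappa> * K * (c * c powr (\<alpha> - 1)) * (real j powr (r - 1) * real j powr (r * \<alpha> - r - 2))"
      by (simp only: X_def ac_simps)
    also have "c * c powr (\<alpha> - 1) = c powr \<alpha>" using c by (simp add: powr_diff)
    also have "real j powr (r - 1) * real j powr (r * \<alpha> - r - 2) = real j powr (r * \<alpha> - 3)"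
      by (simp add: powr_add[symmetric])
    also have "\<kappa> * defect_const r \<kappa> * K * c powr \<alpha> * real j powr (r * \<alpha> - 3)
        \<le> \<kappa> * (defect_const r \<kappa> + 6 / \<alpha>) * K * c powr \<alpha> * real j powr (r * \<alpha> - 3)"
      using kappa alpha K_nonneg by (intro mult_right_mono mult_left_mono) auto
    finally have e: "\<tau> j * X \<le> \<kappa> * (defect_const r \<kappa> + 6 / \<alpha>) * K * (c powr \<alpha> * real j powr (r * \<alpha> - 3))"
      by (simp add: ac_simps)
    have "\<bar>defect j s\<bar> \<le> X" if "s \<in> {t (j - 1)<..<t j}" for s
      unfolding X_def using that t_Suc_less[of j] j2 tj by (intro defect_power_bound) auto
    then show ?thesis using B e by (intro exI[of _ "\<lambda>s. X"] exI) auto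
  qed
  then obtain B \<epsilon> where B: "\<And>s. s\<in>{t (j - 1)<..<t j} \<Longrightarrow> \<bar>defect j s\<bar> \<le> B s"
    "(B has_integral \<epsilon>) {t (j - 1)..t j}"
    and \<epsilon>: "\<epsilon> \<le> \<kappa> * (defect_const r \<kappa> + 6 / \<alpha>) * K * (c powr \<alpha> * real j powr (r * \<alpha> - 3))"
    by blast
  note m = mean_zero_weighted_bound[OF cont defect_has_integral_0[OF j(1) tj(2)] B w_cell_cont[OF j(2)] w_cell_mono[OF j(2)]]
  show "(\<lambda>s. defect j s * w k s) integrable_on {t (j - 1)..t j}" by (rule m)
  have "w k (t (j - 1)) \<le> w k (t j)"
    using t_pred_le[of j] j(2) by (intro mono_onD[OF w_cell_mono]) auto
  then have "\<epsilon> * (w k (t j) - w k (t (j - 1))) \<le>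
      \<kappa> * (defect_const r \<kappa> + 6 / \<alpha>) * K * (c powr \<alpha> * real j powr (r * \<alpha> - 3)) * (w k (t j) - w k (t (j - 1)))"
    using \<epsilon> by (intro mult_right_mono) auto
  with m(2) show "\<bar>integral {t (j - 1)..t j} (\<lambda>s. defect j s * w k s)\<bar>
      \<le> \<kappa> * (defect_const r \<kappa> + 6 / \<alpha>) * K * cell_weight k j"
    by (simp add: mult.assoc)
qed

text \<open>
  The kernel is singular on the last cell but integrable, so a pointwise bound on the defect is
  enough. For \<open>k = 2\<close> the interpolant is that of the first cell, and since \<open>k\<close> is fixed any bound of
  order 1 will do.
\<close>

lemma last_cell_error:
  assumes k: "2 \<le> k" "t k \<le> T"
  shows "(\<lambda>s. defect (k - 1) s * w k s) integrable_on {t (k - 1)..t k}"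
    "\<bar>integral {t (k - 1)..t k} (\<lambda>s. defect (k - 1) s * w k s)\<bar>
      \<le> \<kappa> * (defect_const r \<kappa> + 48 / \<alpha> * 2 powr r) / (1 - \<alpha>) * K * real k powr (\<alpha> - 3)"
proof -
  have k1: "Suc (k - 1) = k" "1 \<le> k" using k by auto
  have "\<exists>X\<ge>0. (\<forall>s\<in>{t (k - 1)<..<t k}. \<bar>defect (k - 1) s\<bar> \<le> X) \<and>
      X * (\<kappa> * c powr (1 - \<alpha>) * real k powr ((r - 1) * (1 - \<alpha>)))
        \<le> \<kappa> * (defect_const r \<kappa> + 48 / \<alpha> * 2 powr r) * K * real k powr (\<alpha> - 3)"
  proof (cases "k = 2")
    case True
    have t1: "t 1 = \<tau> 1" "0 < \<tau> 1" using t0 tau_pos[of 1] by (auto simp: \<tau>_def)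
    have T: "t 2 \<le> T" using k True by simp
    define X where "X = 6 / \<alpha> * K * c powr (\<alpha> - 1)"
    have "\<tau> 1 powr (\<alpha> - 1) \<le> c powr (\<alpha> - 1)"
      using tau_lower[of 1] c alpha by (intro powr_mono2') auto
    then have c1: "K * \<tau> 1 powr (\<alpha> - 1) \<le> K * c powr (\<alpha> - 1)" by (intro mult_left_mono K_nonneg)
    have "\<bar>defect 1 s\<bar> \<le> X" if s: "s \<in> {t 1<..<t 2}" for s
    proof -
      have s': "s \<in> {0<..t 2}" "s \<in> {0<..T}" using s T t1 by auto
      have "\<bar>g1 s\<bar> \<le> K * s powr (\<alpha> - 1)" using s' by (intro g1_bound)
      also have "\<dots> \<le> K * \<tau> 1 powr (\<alpha> - 1)" using s t1 alpha by (intro mult_left_mono powr_mono2' K_nonneg) auto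
      finally have "\<bar>defect 1 s\<bar> \<le> K * \<tau> 1 powr (\<alpha> - 1) + 5 / \<alpha> * (K * \<tau> 1 powr (\<alpha> - 1))"
        using defect_bound_first[OF T s'(1)] by (simp add: mult.assoc)
      also have "\<dots> \<le> 1 / \<alpha> * (K * c powr (\<alpha> - 1)) + 5 / \<alpha> * (K * c powr (\<alpha> - 1))"
      proof (rule add_mono)
        show "5 / \<alpha> * (K * \<tau> 1 powr (\<alpha> - 1)) \<le> 5 / \<alpha> * (K * c powr (\<alpha> - 1))"
          using alpha by (intro mult_left_mono[OF c1]) auto
        have "K * \<tau> 1 powr (\<alpha> - 1) \<le> 1 * (K * c powr (\<alpha> - 1))" using c1 by simp
        also have "\<dots> \<le> 1 / \<alpha> * (K * c powr (\<alpha> - 1))" using alpha K_nonneg by (intro mult_right_mono) auto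
        finally show "K * \<tau> 1 powr (\<alpha> - 1) \<le> 1 / \<alpha> * (K * c powr (\<alpha> - 1))" .
      qed
      also have "\<dots> = X" by (simp add: X_def add_divide_distrib[symmetric])
      finally show ?thesis .
    qed
    moreover have "X * (\<kappa> * c powr (1 - \<alpha>) * real k powr ((r - 1) * (1 - \<alpha>)))
        \<le> \<kappa> * (defect_const r \<kappa> + 48 / \<alpha> * 2 powr r) * K * real k powr (\<alpha> - 3)"
    proof -
      have "X * (\<kappa> * c powr (1 - \<alpha>) * real k powr ((r - 1) * (1 - \<alpha>)))
          = 6 / \<alpha> * K * \<kappa> * (c powr (\<alpha> - 1) * c powr (1 - \<alpha>)) * 2 powr ((r - 1) * (1 - \<alpha>))"
        using True by (simp add: X_def)
      also have "c powr (\<alpha> - 1) * c powr (1 - \<alpha>) = 1" using c by (simp add: powr_add[symmetric])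
      also have "6 / \<alpha> * K * \<kappa> * 1 * 2 powr ((r - 1) * (1 - \<alpha>)) \<le> 6 / \<alpha> * K * \<kappa> * 1 * (8 * 2 powr r * 2 powr (\<alpha> - 3))"
      proof (intro mult_left_mono)
        have "(r - 1) * (1 - \<alpha>) \<le> r + \<alpha>" using r alpha
          by (smt (verit) mult_left_le)
        then have "2 powr ((r - 1) * (1 - \<alpha>)) \<le> 2 powr (r + \<alpha>)" by (intro powr_mono) auto
        also have "\<dots> = 8 * 2 powr r * 2 powr (\<alpha> - 3)" by (simp add: powr_diff powr_add)
        finally show "2 powr ((r - 1) * (1 - \<alpha>)) \<le> 8 * 2 powr r * 2 powr (\<alpha> - 3)" .
      qed (use alpha K_nonneg kappa in auto)
      also have "\<dots> = \<kappa> * (0 + 48 / \<alpha> * 2 powr r) * K * real k powr (\<alpha> - 3)" using True by simp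
      also have "\<dots> \<le> \<kappa> * (defect_const r \<kappa> + 48 / \<alpha> * 2 powr r) * K * real k powr (\<alpha> - 3)"
        using kappa K_nonneg defect_const_nonneg by (intro mult_right_mono mult_left_mono) auto
      finally show ?thesis .
    qed
    moreover have "0 \<le> X" using alpha K_nonneg by (simp add: X_def)
    ultimately show ?thesis using True by (intro exI[of _ X]) auto
  next
    case False
    define X where "X = defect_const r \<kappa> * K * c powr (\<alpha> - 1) * real k powr (r * \<alpha> - r - 2)"
    have "\<bar>defect (k - 1) s\<bar> \<le> X" if "s \<in> {t (k - 1)<..<t k}" for s
      unfolding X_def using that False k t_pred_le[of "k - 1"] by (intro defect_power_bound) (auto simp: k1)
    moreover have "X * (\<kappa> * c powr (1 - \<alpha>) * real k powr ((r - 1) * (1 - \<alpha>)))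
        \<le> \<kappa> * (defect_const r \<kappa> + 48 / \<alpha> * 2 powr r) * K * real k powr (\<alpha> - 3)"
    proof -
      have "X * (\<kappa> * c powr (1 - \<alpha>) * real k powr ((r - 1) * (1 - \<alpha>)))
        = \<kappa> * (defect_const r \<kappa> + 0) * K * (c powr (\<alpha> - 1) * c powr (1 - \<alpha>))
          * (real k powr (r * \<alpha> - r - 2) * real k powr ((r - 1) * (1 - \<alpha>)))"
        by (simp add: X_def ac_simps)
      also have "c powr (\<alpha> - 1) * c powr (1 - \<alpha>) = 1" using c by (simp add: powr_add[symmetric])
      also have "real k powr (r * \<alpha> - r - 2) * real k powr ((r - 1) * (1 - \<alpha>)) = real k powr (\<alpha> - 3)"
        by (simp add: powr_add[symmetric] algebra_simps)
      also have "\<kappa> * (defect_const r \<kappa> + 0) * K * 1 * real k powr (\<alpha> - 3)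
          \<le> \<kappa> * (defect_const r \<kappa> + 48 / \<alpha> * 2 powr r) * K * 1 * real k powr (\<alpha> - 3)"
        using kappa K_nonneg alpha by (intro mult_right_mono mult_left_mono add_left_mono) auto
      finally show ?thesis by simp
    qed
    moreover have "0 \<le> X" using defect_const_nonneg K_nonneg by (simp add: X_def)
    ultimately show ?thesis by blast
  qed
  then obtain X where X: "0 \<le> X" "\<And>s. s\<in>{t (k - 1)<..<t k} \<Longrightarrow> \<bar>defect (k - 1) s\<bar> \<le> X"
    and XK: "X * (\<kappa> * c powr (1 - \<alpha>) * real k powr ((r - 1) * (1 - \<alpha>)))
        \<le> \<kappa> * (defect_const r \<kappa> + 48 / \<alpha> * 2 powr r) * K * real k powr (\<alpha> - 3)"
    by blast
  have B: "((\<lambda>s. X * w k s) has_integral X * (\<tau> k powr (1 - \<alpha>) / (1 - \<alpha>))) {t (k - 1)..t k}"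
    using integrable_integral[OF w_integrable[OF t_pred_le[of k] order_refl]] mass_w_diag[OF k1(2)]
    by (intro has_integral_mult_right) (simp add: mass_def)
  have cont: "continuous_on {t (k - 1)<..<t k} (\<lambda>s. defect (k - 1) s * w k s)"
    unfolding w_def using k t_nonneg[of "k - 1"]
    by (intro continuous_intros continuous_on_subset[OF defect_cont]) auto
  have bd: "\<bar>defect (k - 1) s * w k s\<bar> \<le> X * w k s" if "s \<in> {t (k - 1)<..<t k}" for s
    unfolding abs_mult using X(2)[OF that] w_nonneg[of k s] by (intro mult_mono) auto
  note d = dominated_integral[OF cont bd has_integral_integrable[OF B]]
  show "(\<lambda>s. defect (k - 1) s * w k s) integrable_on {t (k - 1)..t k}" by (rule d)
  have "\<tau> k powr (1 - \<alpha>) \<le> (\<kappa> * c * real k powr (r - 1)) powr (1 - \<alpha>)"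
    using tau_upper[OF k1(2)] tau_nonneg alpha by (intro powr_mono2) auto
  also have "\<dots> = \<kappa> powr (1 - \<alpha>) * c powr (1 - \<alpha>) * real k powr ((r - 1) * (1 - \<alpha>))"
    using kappa c by (simp add: powr_mult powr_powr)
  also have "\<dots> \<le> \<kappa> * c powr (1 - \<alpha>) * real k powr ((r - 1) * (1 - \<alpha>))"
    using powr_mono[of "1 - \<alpha>" 1 \<kappa>] kappa alpha by (intro mult_right_mono) auto
  finally have "X * (\<tau> k powr (1 - \<alpha>) / (1 - \<alpha>))
      \<le> X * ((\<kappa> * c powr (1 - \<alpha>) * real k powr ((r - 1) * (1 - \<alpha>))) / (1 - \<alpha>))"
    using X(1) alpha by (intro mult_left_mono divide_right_mono) auto
  also have "\<dots> = X * (\<kappa> * c powr (1 - \<alpha>) * real k powr ((r - 1) * (1 - \<alpha>))) / (1 - \<alpha>)" by simp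
  also have "\<dots> \<le> \<kappa> * (defect_const r \<kappa> + 48 / \<alpha> * 2 powr r) * K * real k powr (\<alpha> - 3) / (1 - \<alpha>)"
    using XK alpha by (intro divide_right_mono) auto
  finally show "\<bar>integral {t (k - 1)..t k} (\<lambda>s. defect (k - 1) s * w k s)\<bar>
      \<le> \<kappa> * (defect_const r \<kappa> + 48 / \<alpha> * 2 powr r) / (1 - \<alpha>) * K * real k powr (\<alpha> - 3)"
    using d(2) integral_unique[OF B] by simp
qed

theorem truncation_error:
  assumes k: "1 \<le> k" "t k \<le> T"
  shows "\<bar>Gamma (1 - \<alpha>) * L2_op \<alpha> t k samples - integral {0..t k} (\<lambda>s. g1 s * w k s)\<bar>
    \<le> truncation_const \<alpha> r \<kappa> * K * truncation_rate \<alpha> r k"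
proof -
  define C1 C2 C3 C4 where "C1 = 3 / (\<alpha> * (1 - \<alpha>))"
    and "C2 = \<kappa> * (defect_const r \<kappa> + 48 / \<alpha> * 2 powr r) / (1 - \<alpha>)"
    and "C3 = \<kappa> * (defect_const r \<kappa> + 6 / \<alpha>)"
    and "C4 = 2 * \<alpha> * \<kappa> * 2 powr (r * (\<alpha> + 1)) + 8"
  have C: "0 \<le> C1" "0 \<le> C2" "0 \<le> C3" "0 \<le> C4"
    using alpha kappa defect_const_nonneg by (auto simp: C1_def C2_def C3_def C4_def)
  define R where "R = truncation_rate \<alpha> r k"
  have R: "0 \<le> R" "real k powr (\<alpha> - 3) \<le> R" by (auto simp: R_def)
  have tk: "0 < t k" using t_strict_mono[of 0 k] t0 k by simp
  have g1w: "(\<lambda>s. g1 s * w k s) integrable_on {0..t k}"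
    "\<bar>integral {0..t k} (\<lambda>s. g1 s * w k s)\<bar> \<le> 2 * K / (\<alpha> * (1 - \<alpha>))"
    unfolding w_def using caputo_kernel_dominated[OF tk k(2)] by auto
  have "\<bar>Gamma (1 - \<alpha>) * L2_op \<alpha> t k samples - integral {0..t k} (\<lambda>s. g1 s * w k s)\<bar> \<le> (C1 + C2 + C3 * C4) * K * R"
  proof (cases "k = 1")
    case True
    have p: "t 1 = \<tau> 1" "0 < \<tau> 1" using t0 tau_pos[of 1] by (auto simp: \<tau>_def)
    have "\<bar>Gamma (1 - \<alpha>) * L2_op \<alpha> t 1 samples\<bar> = \<bar>g (t 1) - g (t 0)\<bar> / \<tau> 1 * (\<tau> 1 powr (1 - \<alpha>) / (1 - \<alpha>))"
      unfolding L2_op_one mass_w_diag[OF order_refl] using p alpha by (simp add: dq_def abs_mult abs_divide)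
    also have "\<dots> \<le> (K * \<tau> 1 powr \<alpha> / \<alpha>) / \<tau> 1 * (\<tau> 1 powr (1 - \<alpha>) / (1 - \<alpha>))"
      using g_increment_from_0[of "t 1"] p t0 True k alpha
      by (intro mult_right_mono divide_right_mono) auto
    also have "\<dots> = K / (\<alpha> * (1 - \<alpha>))" using p by (simp add: powr_diff)
    finally have "\<bar>Gamma (1 - \<alpha>) * L2_op \<alpha> t k samples - integral {0..t k} (\<lambda>s. g1 s * w k s)\<bar>
        \<le> K / (\<alpha> * (1 - \<alpha>)) + 2 * K / (\<alpha> * (1 - \<alpha>))"
      using g1w(2) True by simp
    also have "\<dots> = C1 * K * 1" by (simp add: C1_def add_divide_distrib[symmetric])
    also have "\<dots> \<le> C1 * K * R" using C K_nonneg True by (intro mult_left_mono) (auto simp: R_def)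
    also have "\<dots> \<le> (C1 + C2 + C3 * C4) * K * R"
      using C K_nonneg R by (intro mult_right_mono) auto
    finally show ?thesis .
  next
    case False
    then have k2: "2 \<le> k" using k by simp
    have split: "integral {t (j - 1)..t j} (\<lambda>s. deriv (H2_interp t samples i) s / (t k - s) powr \<alpha>)
        = integral {t (j - 1)..t j} (\<lambda>s. defect i s * w k s) + integral {t (j - 1)..t j} (\<lambda>s. g1 s * w k s)"
      if "1 \<le> i" "j \<le> k" "(\<lambda>s. defect i s * w k s) integrable_on {t (j - 1)..t j}" for i j
    proof -
      have "(\<lambda>s. g1 s * w k s) integrable_on {t (j - 1)..t j}"
        using that t_mono[of j k] t_nonneg[of "j - 1"] by (intro integrable_on_subinterval[OF g1w(1)]) auto
      from Henstock_Kurzweil_Integration.integral_add[OF that(3) this] show ?thesis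
        unfolding deriv_H2_interp[OF that(1)] defect_def w_def powr_minus_divide
        by (simp add: left_diff_distrib diff_divide_distrib)
    qed
    have "Gamma (1 - \<alpha>) > 0" using alpha by (intro Gamma_real_pos) auto
    then have "Gamma (1 - \<alpha>) * L2_op \<alpha> t k samples =
        (\<Sum>j=1..k-1. integral {t (j - 1)..t j} (\<lambda>s. deriv (H2_interp t samples j) s / (t k - s) powr \<alpha>))
         + integral {t (k - 1)..t k} (\<lambda>s. deriv (H2_interp t samples (k - 1)) s / (t k - s) powr \<alpha>)"
      using False unfolding L2_op_def by simp
    also have "\<dots> = (\<Sum>j=1..k-1. integral {t (j - 1)..t j} (\<lambda>s. defect j s * w k s)
          + integral {t (j - 1)..t j} (\<lambda>s. g1 s * w k s))
         + (integral {t (k - 1)..t k} (\<lambda>s. defect (k - 1) s * w k s) + integral {t (k - 1)..t k} (\<lambda>s. g1 s * w k s))"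
      using k2 k cell_error(1) last_cell_error(1)
      by (intro arg_cong2[where f = "(+)"] sum.cong split refl) auto
    also have "\<dots> = (\<Sum>j=1..k-1. integral {t (j - 1)..t j} (\<lambda>s. defect j s * w k s))
         + integral {t (k - 1)..t k} (\<lambda>s. defect (k - 1) s * w k s)
         + ((\<Sum>j=1..k-1. integral {t (j - 1)..t j} (\<lambda>s. g1 s * w k s)) + integral {t (k - 1)..t k} (\<lambda>s. g1 s * w k s))"
      by (simp add: sum.distrib)
    also have "(\<Sum>j=1..k-1. integral {t (j - 1)..t j} (\<lambda>s. g1 s * w k s)) + integral {t (k - 1)..t k} (\<lambda>s. g1 s * w k s)
        = integral {0..t k} (\<lambda>s. g1 s * w k s)"
    proof -
      obtain m where m: "k = Suc m" using k by (cases k) auto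
      show ?thesis unfolding integral_over_cells[OF g1w(1)] unfolding m by simp
    qed
    finally have "\<bar>Gamma (1 - \<alpha>) * L2_op \<alpha> t k samples - integral {0..t k} (\<lambda>s. g1 s * w k s)\<bar>
       = \<bar>(\<Sum>j=1..k-1. integral {t (j - 1)..t j} (\<lambda>s. defect j s * w k s))
         + integral {t (k - 1)..t k} (\<lambda>s. defect (k - 1) s * w k s)\<bar>" by simp
    also have "\<dots> \<le> (\<Sum>j=1..k-1. \<bar>integral {t (j - 1)..t j} (\<lambda>s. defect j s * w k s)\<bar>)
         + \<bar>integral {t (k - 1)..t k} (\<lambda>s. defect (k - 1) s * w k s)\<bar>"
      by (intro order_trans[OF abs_triangle_ineq] add_right_mono sum_abs)
    also have "\<dots> \<le> (\<Sum>j=1..k-1. C3 * K * cell_weight k j)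
         + C2 * K * real k powr (\<alpha> - 3)"
      unfolding C3_def C2_def using k2 k by (intro add_mono sum_mono cell_error(2) last_cell_error(2)) auto
    also have "\<dots> = C3 * K * (\<Sum>j=1..k-1. cell_weight k j)
         + C2 * K * real k powr (\<alpha> - 3)"
      by (simp add: sum_distrib_left)
    also have "\<dots> \<le> C3 * K * (C4 * R) + C2 * K * R"
      unfolding C4_def using C K_nonneg R weighted_increments_sum_le[OF k2]
      by (intro add_mono mult_left_mono) (auto simp: R_def)
    also have "\<dots> = (0 + C2 + C3 * C4) * K * R" by (simp add: algebra_simps)
    also have "\<dots> \<le> (C1 + C2 + C3 * C4) * K * R"
      using C K_nonneg R by (intro mult_right_mono add_mono) auto
    finally show ?thesis .
  qed
  then show ?thesis by (simp add: truncation_const_def C1_def C2_def C3_def C4_def R_def)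
qed

end

section \<open>The modified graded mesh\<close>

lemma powr_tangent_le:
  fixes x y r :: real
  assumes "1 < r" "0 \<le> x" "0 \<le> y"
  shows "x powr r + r * x powr (r - 1) * (y - x) \<le> y powr r"
proof -
  have mvt: "\<exists>z. a < z \<and> z < b \<and> b powr r - a powr r = (b - a) * (r * z powr (r - 1))" if "0 < a" "a < b" for a b :: real
    using that by (intro MVT2) (auto intro!: derivative_eq_intros simp: powr_diff)
  consider "x = 0" | "y = 0" "0 < x" | "0 < x" "x < y" | "0 < y" "y < x" | "x = y" using assms by linarith
  then show ?thesis
  proof cases
    case 2
    have "x powr r = x powr (r - 1) * x" using 2 by (simp add: powr_diff)
    then have "x powr r + r * x powr (r - 1) * (y - x) = (1 - r) * x powr r" using 2 by (simp add: algebra_simps)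
    also have "\<dots> \<le> 0" using assms by (intro mult_nonpos_nonneg) auto
    finally show ?thesis using 2 by simp
  next
    case 3
    then obtain z where z: "x < z" "z < y" "y powr r - x powr r = (y - x) * (r * z powr (r - 1))"
      using mvt by blast
    have "(y - x) * (r * x powr (r - 1)) \<le> (y - x) * (r * z powr (r - 1))"
      using z 3 assms by (intro mult_left_mono powr_mono2) auto
    then show ?thesis using z(3) by (simp add: algebra_simps)
  next
    case 4
    then obtain z where z: "y < z" "z < x" "x powr r - y powr r = (x - y) * (r * z powr (r - 1))"
      using mvt by blast
    have "(x - y) * (r * z powr (r - 1)) \<le> (x - y) * (r * x powr (r - 1))"
      using z 4 assms by (intro mult_left_mono powr_mono2) auto
    then show ?thesis using z(3) by (simp add: algebra_simps)
  qed (use assms in auto)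
qed

lemma powr_superadditive:
  fixes x y r :: real
  assumes "1 < r" "0 \<le> x" "0 \<le> y"
  shows "x powr r + y powr r \<le> (x + y) powr r"
proof -
  have e: "z * z powr (r - 1) = z powr r" if "0 \<le> z" for z
    using powr_mult_base[OF that, of "r - 1"] by simp
  have "x * x powr (r - 1) + y * y powr (r - 1) \<le> x * (x + y) powr (r - 1) + y * (x + y) powr (r - 1)"
    using assms by (intro add_mono mult_left_mono powr_mono2) auto
  also have "\<dots> = (x + y) * (x + y) powr (r - 1)" by (simp add: algebra_simps)
  finally show ?thesis using assms by (simp add: e)
qed

definition powr_step :: "real \<Rightarrow> real \<Rightarrow> real" where
  "powr_step r x = (x + 1) powr r - x powr r"

lemma powr_step_pos: "1 < r \<Longrightarrow> 0 \<le> x \<Longrightarrow> 0 < powr_step r x"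
  unfolding powr_step_def using powr_less_mono2[of r x "x + 1"] by simp

lemma powr_step_mono:
  assumes "1 < r" "0 \<le> x" shows "powr_step r x \<le> powr_step r (x + 1)"
  using powr_tangent_le[OF assms(1), of "x + 1" x] powr_tangent_le[OF assms(1), of "x + 1" "x + 2"] assms
  by (simp add: powr_step_def add.assoc)

lemma powr_step_upper:
  assumes "1 < r" "0 \<le> x" shows "powr_step r x \<le> r * (x + 1) powr (r - 1)"
  using powr_tangent_le[OF assms(1), of "x + 1" x] assms by (simp add: powr_step_def)

lemma powr_step_lower:
  assumes "1 < r" "0 \<le> x" shows "(x + 1) powr (r - 1) \<le> powr_step r x"
proof -
  have "x powr r = x * x powr (r - 1)" using powr_mult_base[OF assms(2), of "r - 1"] by simp
  also have "\<dots> \<le> x * (x + 1) powr (r - 1)" using assms by (intro mult_left_mono powr_mono2) auto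
  finally have "x powr r \<le> x * (x + 1) powr (r - 1)" .
  moreover have "(x + 1) powr r = (x + 1) * (x + 1) powr (r - 1)"
    using powr_mult_base[of "x + 1" "r - 1"] assms by simp
  ultimately show ?thesis by (simp add: powr_step_def algebra_simps)
qed

text \<open>
  By convexity, \<open>f(x) = (x + 1)\<^sup>r - x\<^sup>r\<close> satisfies \<open>(x + 1) f'(x) \<ge> (r - 1) f(x)\<close> and
  \<open>(x + 1) f'(x + 1) \<le> (r - 1) f(x + 1)\<close>. So the logarithmic derivative of \<open>f\<close> is smaller at \<open>x + 1\<close>
  than at \<open>x\<close>.
\<close>

lemma powr_step_ratio_antimono:
  assumes r: "1 < r" and x: "0 \<le> x"
  shows "powr_step r (x + 2) / powr_step r (x + 1) \<le> powr_step r (x + 1) / powr_step r x"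
proof -
  define h where "h z = powr_step r (z + 1) / powr_step r z" for z
  define f' where "f' z = r * ((z + 1) powr (r - 1) - z powr (r - 1))" for z
  have df: "(powr_step r has_real_derivative f' z) (at z)" if "0 < z" for z
    unfolding powr_step_def[abs_def] f'_def using that
    by (auto intro!: derivative_eq_intros simp: powr_diff field_simps)
  have cont: "continuous_on {0..} (powr_step r)"
    unfolding powr_step_def[abs_def] using r by (intro continuous_intros continuous_on_powr') auto
  have e: "z * z powr (r - 1) = z powr r" if "0 \<le> z" for z
    using powr_mult_base[OF that, of "r - 1"] by simp
  have lower: "(r - 1) * powr_step r z \<le> (z + 1) * f' z" if z: "0 < z" for z
  proof -
    have "(z + 1) * f' z = r * ((z + 1) * (z + 1) powr (r - 1)) - r * (z * z powr (r - 1)) - r * z powr (r - 1)"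
      by (simp add: f'_def algebra_simps)
    also have "\<dots> = r * (z + 1) powr r - r * z powr r - r * z powr (r - 1)"
      using z by (simp only: e less_imp_le add_nonneg_nonneg zero_le_one)
    finally show ?thesis
      using powr_tangent_le[OF r, of z "z + 1"] z by (simp add: powr_step_def algebra_simps)
  qed
  have upper: "z * f' z \<le> (r - 1) * powr_step r z" if z: "0 < z" for z
  proof -
    have "z * f' z = r * ((z + 1) * (z + 1) powr (r - 1)) - r * (z + 1) powr (r - 1) - r * (z * z powr (r - 1))"
      by (simp add: f'_def algebra_simps)
    also have "\<dots> = r * (z + 1) powr r - r * (z + 1) powr (r - 1) - r * z powr r"
      using z by (simp only: e less_imp_le add_nonneg_nonneg zero_le_one)
    finally show ?thesis
      using powr_tangent_le[OF r, of "z + 1" z] z by (simp add: powr_step_def algebra_simps)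
  qed
  have "h (x + 1) \<le> h x"
  proof (rule DERIV_nonpos_imp_decreasing_open[where f = h])
    show "continuous_on {x..x + 1} h"
      unfolding h_def using x r powr_step_pos[of r]
      by (intro continuous_intros continuous_on_compose2[OF cont, of _ "\<lambda>z. z + 1"] continuous_on_subset[OF cont])
        (auto simp: less_imp_neq[symmetric] dest!: powr_step_pos[OF r])
    fix z assume "x < z" "z < x + 1"
    then have z: "0 < z" using x by simp
    have p: "0 < powr_step r z" "0 < powr_step r (z + 1)" using powr_step_pos r z by auto
    have d1: "((\<lambda>z. powr_step r (z + 1)) has_real_derivative f' (z + 1)) (at z)"
      using df[of "z + 1"] z by (simp add: DERIV_shift)
    have "(h has_real_derivative (f' (z + 1) * powr_step r z - powr_step r (z + 1) * f' z) / (powr_step r z * powr_step r z)) (at z)"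
      unfolding h_def using p by (intro DERIV_divide d1 df z) auto
    moreover have "(f' (z + 1) * powr_step r z - powr_step r (z + 1) * f' z) / (powr_step r z * powr_step r z) \<le> 0"
    proof (rule divide_nonpos_nonneg)
      have "(z + 1) * f' (z + 1) * powr_step r z \<le> (r - 1) * powr_step r (z + 1) * powr_step r z"
        using p z by (intro mult_right_mono upper) auto
      also have "\<dots> = powr_step r (z + 1) * ((r - 1) * powr_step r z)" by simp
      also have "\<dots> \<le> powr_step r (z + 1) * ((z + 1) * f' z)"
        using p z by (intro mult_left_mono lower) auto
      finally have "(z + 1) * (f' (z + 1) * powr_step r z - powr_step r (z + 1) * f' z) \<le> 0"
        by (simp add: algebra_simps)
      then show "f' (z + 1) * powr_step r z - powr_step r (z + 1) * f' z \<le> 0"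
        using z by (simp add: mult_le_0_iff)
    qed simp
    ultimately show "\<exists>y. (h has_real_derivative y) (at z) \<and> y \<le> 0" by blast
  qed simp
  then show ?thesis by (simp add: h_def add.assoc)
qed

lemma rho_R_bounds: "2 \<le> rho_R" "rho_R \<le> 18/5"
proof -
  have "1 \<le> sqrt 17" by simp
  then show "2 \<le> rho_R" by (simp add: rho_R_def)
  have "sqrt 17 \<le> 21/5" by (rule real_le_lsqrt) (auto simp: power2_eq_square)
  then show "rho_R \<le> 18/5" by (simp add: rho_R_def)
qed

text \<open>The minimum defining \<open>k\<^sub>0\<close> exists because the ratios tend to 1.\<close>

lemma mesh_k0_ratio:
  assumes r: "1 < r"
  shows "powr_step r (real (mesh_k0 r) + 1) / powr_step r (real (mesh_k0 r)) \<le> rho_R"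
proof -
  define P where "P k \<longleftrightarrow> (real (k + 2) powr r - real (k + 1) powr r) / (real (k + 1) powr r - real k powr r) \<le> rho_R" for k
  have P: "P k \<longleftrightarrow> powr_step r (real k + 1) / powr_step r (real k) \<le> rho_R" for k
    by (simp add: P_def powr_step_def add.commute)
  have "(\<lambda>k. (1 + 2 / real k) powr (r - 1)) \<longlonglongrightarrow> (1 + 0) powr (r - 1)"
    by (intro tendsto_intros lim_const_over_n) auto
  then have "\<forall>\<^sub>F k in sequentially. (1 + 2 / real k) powr (r - 1) < 2"
    by (rule order_tendstoD(2)) simp
  moreover have "\<forall>\<^sub>F k in sequentially. (0::nat) < k" by (rule eventually_gt_at_top)
  ultimately have "\<forall>\<^sub>F k in sequentially. P k"
  proof eventually_elim
    case (elim k)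
    have "r * real k powr (r - 1) \<le> powr_step r (real k)"
      using powr_tangent_le[OF r, of "real k" "real k + 1"] by (simp add: powr_step_def)
    moreover have "powr_step r (real k + 1) \<le> r * (real k + 2) powr (r - 1)"
      using powr_step_upper[OF r, of "real k + 1"] by (simp add: add.assoc)
    moreover have "(real k + 2) powr (r - 1) \<le> 2 * real k powr (r - 1)"
    proof -
      have "(real k + 2) powr (r - 1) = ((1 + 2 / real k) * real k) powr (r - 1)"
        using elim by (simp add: distrib_right)
      also have "\<dots> = (1 + 2 / real k) powr (r - 1) * real k powr (r - 1)" by (simp add: powr_mult)
      also have "\<dots> \<le> 2 * real k powr (r - 1)" using elim by (intro mult_right_mono) auto
      finally show ?thesis .
    qed
    then have "r * (real k + 2) powr (r - 1) \<le> r * (2 * real k powr (r - 1))" using r by (intro mult_left_mono) auto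
    ultimately have "powr_step r (real k + 1) \<le> 2 * powr_step r (real k)" by simp
    then have "powr_step r (real k + 1) / powr_step r (real k) \<le> 2"
      using powr_step_pos[OF r, of "real k"] by (simp add: pos_divide_le_eq)
    then show ?case unfolding P using rho_R_bounds by linarith
  qed
  then have "\<exists>k. P k" by (meson eventually_sequentially order_refl)
  then have "P (LEAST k. P k)" by (rule LeastI_ex)
  then have "P (mesh_k0 r)" by (simp add: mesh_k0_def P_def[abs_def])
  then show ?thesis by (simp add: P)
qed

lemma mesh_step_ratio:
  assumes r: "1 < r"
  shows "powr_step r (real (mesh_k0 r + n) + 1) \<le> 18/5 * powr_step r (real (mesh_k0 r + n))"
proof -
  have "powr_step r (real (mesh_k0 r + n) + 1) / powr_step r (real (mesh_k0 r + n)) \<le> rho_R"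
  proof (induction n)
    case 0
    then show ?case using mesh_k0_ratio[OF r] by simp
  next
    case (Suc n)
    then show ?case using powr_step_ratio_antimono[OF r, of "real (mesh_k0 r + n)"] by (simp add: ac_simps)
  qed
  then have "powr_step r (real (mesh_k0 r + n) + 1) / powr_step r (real (mesh_k0 r + n)) \<le> 18/5"
    using rho_R_bounds by linarith
  then show ?thesis using powr_step_pos[OF r, of "real (mesh_k0 r + n)"] by (simp add: pos_divide_le_eq)
qed

definition mesh_scale :: "real \<Rightarrow> real \<Rightarrow> nat \<Rightarrow> real" where
  "mesh_scale T r N = T / (real (N + mesh_k0 r) powr r - real (mesh_k0 r) powr r)"

definition mesh_kappa :: "real \<Rightarrow> real" where
  "mesh_kappa r = r * (1 + real (mesh_k0 r)) powr (r - 1)"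

lemma graded_mesh_eq:
  "graded_mesh T r N k = mesh_scale T r N * (real (k + mesh_k0 r) powr r - real (mesh_k0 r) powr r)"
  by (simp add: graded_mesh_def mesh_scale_def)

lemma graded_mesh_Suc:
  "graded_mesh T r N (Suc k) - graded_mesh T r N k = mesh_scale T r N * powr_step r (real (k + mesh_k0 r))"
  by (simp add: graded_mesh_eq powr_step_def algebra_simps)

lemma mesh_denominator_ge:
  assumes "1 < r"
  shows "real N powr r \<le> real (N + mesh_k0 r) powr r - real (mesh_k0 r) powr r"
  using powr_superadditive[OF assms, of "real N" "real (mesh_k0 r)"] by simp

lemma
  assumes "1 < r" "0 < T" "1 \<le> N"
  shows mesh_scale_pos: "0 < mesh_scale T r N"
    and mesh_scale_le: "mesh_scale T r N \<le> T * real N powr (- r)"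
    and graded_mesh_last: "graded_mesh T r N N = T"
proof -
  have N: "0 < real N powr r" using assms by simp
  then have D: "0 < real (N + mesh_k0 r) powr r - real (mesh_k0 r) powr r"
    using mesh_denominator_ge[OF assms(1), of N] by linarith
  then show "0 < mesh_scale T r N" using assms by (simp add: mesh_scale_def)
  have "mesh_scale T r N \<le> T / real N powr r"
    unfolding mesh_scale_def using mesh_denominator_ge[OF assms(1), of N] assms by (intro divide_left_mono mult_pos_pos D N) auto
  then show "mesh_scale T r N \<le> T * real N powr (- r)" by (simp add: powr_minus_divide)
  show "graded_mesh T r N N = T" using D by (simp add: graded_mesh_def)
qed

lemma graded_mesh_power_graded:
  assumes r: "1 < r" and T: "0 < T" and N: "1 \<le> N" and alpha: "0 < \<alpha>" "\<alpha> < 1"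
  shows "power_graded_mesh \<alpha> (graded_mesh T r N) r (mesh_scale T r N) (mesh_kappa r)"
proof -
  let ?t = "graded_mesh T r N" and ?c = "mesh_scale T r N" and ?k0 = "real (mesh_k0 r)"
  have c: "0 < ?c" using mesh_scale_pos[OF r T N] .
  have Suc': "?t k - ?t (k - 1) = ?c * powr_step r (real (k - 1 + mesh_k0 r))" if "1 \<le> k" for k
    using graded_mesh_Suc[of T r N "k - 1"] that by simp
  have ss: "real (k - 1 + mesh_k0 r) + 1 = real (k + mesh_k0 r)" if "1 \<le> k" for k using that by simp
  show ?thesis
  proof
    show "0 < \<alpha>" "\<alpha> < 1" "1 < r" "0 < ?c" using alpha r c by auto
    show t0: "?t 0 = 0" by (simp add: graded_mesh_def)
    show "0 < ?t 1" using Suc'[of 1] t0 c powr_step_pos[OF r, of ?k0] by simp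
    fix k :: nat assume k: "1 \<le> k"
    have "?c * powr_step r (real (k - 1 + mesh_k0 r)) \<le> ?c * powr_step r (real (k - 1 + mesh_k0 r) + 1)"
      using c by (intro mult_left_mono powr_step_mono r) auto
    then show "?t k - ?t (k - 1) \<le> ?t (Suc k) - ?t k"
      unfolding Suc'[OF k] graded_mesh_Suc ss[OF k] .
    have "?c * powr_step r (real (k - 1 + mesh_k0 r) + 1) \<le> ?c * (18/5 * powr_step r (real (k - 1 + mesh_k0 r)))"
      using c mesh_step_ratio[OF r, of "k - 1"] by (intro mult_left_mono) (auto simp: add.commute)
    then show "?t (Suc k) - ?t k \<le> 18/5 * (?t k - ?t (k - 1))"
      unfolding Suc'[OF k] graded_mesh_Suc ss[OF k] by simp
    have "real k powr (r - 1) \<le> real (k + mesh_k0 r) powr (r - 1)" using r by (intro powr_mono2) auto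
    also have "\<dots> \<le> powr_step r (real (k - 1 + mesh_k0 r))"
      using powr_step_lower[OF r, of "real (k - 1 + mesh_k0 r)"] ss[OF k] by simp
    finally show "?c * real k powr (r - 1) \<le> ?t k - ?t (k - 1)"
      unfolding Suc'[OF k] using c by (intro mult_left_mono) auto
    have "powr_step r (real (k - 1 + mesh_k0 r)) \<le> r * real (k + mesh_k0 r) powr (r - 1)"
      using powr_step_upper[OF r, of "real (k - 1 + mesh_k0 r)"] ss[OF k] by simp
    also have "\<dots> \<le> r * ((1 + ?k0) * real k) powr (r - 1)"
    proof (intro mult_left_mono powr_mono2)
      have "?k0 * 1 \<le> ?k0 * real k" using k by (intro mult_left_mono) auto
      then show "real (k + mesh_k0 r) \<le> (1 + ?k0) * real k" by (simp add: algebra_simps)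
    qed (use r in auto)
    also have "\<dots> = mesh_kappa r * real k powr (r - 1)" by (simp add: mesh_kappa_def powr_mult)
    finally have "?c * powr_step r (real (k - 1 + mesh_k0 r)) \<le> ?c * (mesh_kappa r * real k powr (r - 1))"
      using c by (intro mult_left_mono) auto
    then show "?t k - ?t (k - 1) \<le> mesh_kappa r * ?c * real k powr (r - 1)"
      unfolding Suc'[OF k] by (simp add: ac_simps)
  next
    have "1 * 1 \<le> r * (1 + ?k0) powr (r - 1)"
      using r by (intro mult_mono ge_one_powr_ge_zero) auto
    then show "1 \<le> mesh_kappa r" by (simp add: mesh_kappa_def)
  next
    fix j k :: nat assume jk: "j \<le> k"
    have "real (k - j) powr r + real (j + mesh_k0 r) powr r \<le> (real (k - j) + real (j + mesh_k0 r)) powr r"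
      by (intro powr_superadditive r) auto
    also have "real (k - j) + real (j + mesh_k0 r) = real (k + mesh_k0 r)" using jk by simp
    finally have "?c * real (k - j) powr r \<le> ?c * (real (k + mesh_k0 r) powr r - real (j + mesh_k0 r) powr r)"
      using c by (intro mult_left_mono) auto
    then show "?c * real (k - j) powr r \<le> ?t k - ?t j"
      by (simp add: graded_mesh_eq algebra_simps)
  qed
qed

section \<open>The inner product of $L^2(\Omega)$\<close>

lemma L2_D:
  assumes "f \<in> L2 \<Omega>"
  shows "f \<in> borel_measurable (lebesgue_on \<Omega>)" "integrable (lebesgue_on \<Omega>) (\<lambda>x. (norm (f x))\<^sup>2)"
  using assms by (auto simp: L2_def)

lemma L2_inner_integrable:
  fixes f g :: "real^'d \<Rightarrow> 'b::euclidean_space"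
  assumes "f \<in> L2 \<Omega>" "g \<in> L2 \<Omega>"
  shows "integrable (lebesgue_on \<Omega>) (\<lambda>x. f x \<bullet> g x)"
proof (rule Bochner_Integration.integrable_bound)
  show "integrable (lebesgue_on \<Omega>) (\<lambda>x. (norm (f x))\<^sup>2 + (norm (g x))\<^sup>2)"
    using assms by (intro Bochner_Integration.integrable_add L2_D)
  show "(\<lambda>x. f x \<bullet> g x) \<in> borel_measurable (lebesgue_on \<Omega>)"
    using assms by (intro borel_measurable_inner L2_D)
  have "norm (f x \<bullet> g x) \<le> norm ((norm (f x))\<^sup>2 + (norm (g x))\<^sup>2)" for x
  proof -
    have "\<bar>f x \<bullet> g x\<bar> \<le> norm (f x) * norm (g x)" by (rule Cauchy_Schwarz_ineq2)
    also have "\<dots> \<le> (norm (f x))\<^sup>2 + (norm (g x))\<^sup>2"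
      using sum_squares_bound[of "norm (f x)" "norm (g x)"]
        mult_nonneg_nonneg[OF norm_ge_zero[of "f x"] norm_ge_zero[of "g x"]] by linarith
    finally show ?thesis by simp
  qed
  then show "AE x in lebesgue_on \<Omega>. norm (f x \<bullet> g x) \<le> norm ((norm (f x))\<^sup>2 + (norm (g x))\<^sup>2)" by simp
qed

lemma L2_scaleR: "f \<in> L2 \<Omega> \<Longrightarrow> (\<lambda>x. c *\<^sub>R f x) \<in> L2 \<Omega>"
  unfolding L2_def by (auto simp: power_mult_distrib)

lemma L2_add:
  fixes f g :: "real^'d \<Rightarrow> 'b::euclidean_space"
  assumes "f \<in> L2 \<Omega>" "g \<in> L2 \<Omega>"
  shows "(\<lambda>x. f x + g x) \<in> L2 \<Omega>"
proof -
  have e: "(norm (f x + g x))\<^sup>2 = (norm (f x))\<^sup>2 + 2 * (f x \<bullet> g x) + (norm (g x))\<^sup>2" for x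
    by (simp add: power2_norm_eq_inner inner_add_left inner_add_right inner_commute)
  have "integrable (lebesgue_on \<Omega>) (\<lambda>x. (norm (f x + g x))\<^sup>2)"
    unfolding e using assms
    by (intro Bochner_Integration.integrable_add L2_D integrable_mult_right L2_inner_integrable)
  then show ?thesis
    using assms by (auto simp: L2_def)
qed

lemma L2_diff:
  fixes f g :: "real^'d \<Rightarrow> 'b::euclidean_space"
  assumes "f \<in> L2 \<Omega>" "g \<in> L2 \<Omega>"
  shows "(\<lambda>x. f x - g x) \<in> L2 \<Omega>"
  using L2_add[OF assms(1) L2_scaleR[OF assms(2), of "-1"]] by simp

lemma L2_zero: "(\<lambda>x. 0) \<in> L2 \<Omega>"
  by (simp add: L2_def)

lemma L2_cmult:
  fixes f :: "real^'d \<Rightarrow> real"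
  shows "f \<in> L2 \<Omega> \<Longrightarrow> (\<lambda>x. c * f x) \<in> L2 \<Omega>"
  using L2_scaleR[of f \<Omega> c] by simp

lemma L2_sum:
  fixes f :: "'i \<Rightarrow> real^'d \<Rightarrow> 'b::euclidean_space"
  assumes "\<And>i. i \<in> I \<Longrightarrow> f i \<in> L2 \<Omega>"
  shows "(\<lambda>x. \<Sum>i\<in>I. f i x) \<in> L2 \<Omega>"
  using assms by (induction I rule: infinite_finite_induct) (auto intro: L2_add L2_zero)

lemma L2_inner_commute: "L2_inner \<Omega> f g = L2_inner \<Omega> g f"
  by (simp add: L2_inner_def inner_commute)

lemma L2_inner_diff_left:
  fixes f g :: "real^'d \<Rightarrow> 'b::euclidean_space"
  assumes "f \<in> L2 \<Omega>" "g \<in> L2 \<Omega>" "h \<in> L2 \<Omega>"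
  shows "L2_inner \<Omega> (\<lambda>x. f x - g x) h = L2_inner \<Omega> f h - L2_inner \<Omega> g h"
  unfolding L2_inner_def inner_diff_left using assms
  by (intro Bochner_Integration.integral_diff L2_inner_integrable)

lemma L2_inner_diff_right:
  fixes f g :: "real^'d \<Rightarrow> 'b::euclidean_space"
  assumes "f \<in> L2 \<Omega>" "g \<in> L2 \<Omega>" "h \<in> L2 \<Omega>"
  shows "L2_inner \<Omega> h (\<lambda>x. f x - g x) = L2_inner \<Omega> h f - L2_inner \<Omega> h g"
  using L2_inner_diff_left[OF assms] by (simp add: L2_inner_commute)

lemma L2_inner_cmult_left:
  fixes f :: "real^'d \<Rightarrow> real"
  shows "L2_inner \<Omega> (\<lambda>x. c * f x) h = c * L2_inner \<Omega> f h"
  unfolding L2_inner_def by (simp add: mult.assoc)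

lemma L2_inner_sum_left:
  fixes f :: "'i \<Rightarrow> real^'d \<Rightarrow> real"
  assumes "\<And>i. i \<in> I \<Longrightarrow> f i \<in> L2 \<Omega>" "h \<in> L2 \<Omega>"
  shows "L2_inner \<Omega> (\<lambda>x. \<Sum>i\<in>I. f i x) h = (\<Sum>i\<in>I. L2_inner \<Omega> (f i) h)"
  unfolding L2_inner_def inner_sum_left using assms
  by (intro Bochner_Integration.integral_sum L2_inner_integrable)

lemma L2_inner_self_nonneg: "0 \<le> L2_inner \<Omega> f f"
  unfolding L2_inner_def by (intro integral_nonneg_AE) simp

lemma L2_norm_nonneg [simp]: "0 \<le> L2_norm \<Omega> f"
  by (simp add: L2_norm_def L2_inner_self_nonneg)

lemma L2_norm_power2: "(L2_norm \<Omega> f)\<^sup>2 = L2_inner \<Omega> f f"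
  by (simp add: L2_norm_def L2_inner_self_nonneg)

lemma L2_norm_le_H1_norm: "L2_norm \<Omega> v \<le> H1_norm \<Omega> v"
  unfolding H1_norm_def by (rule real_le_rsqrt) simp

lemma H10_D:
  assumes "v \<in> H10 \<Omega>"
  shows "v \<in> L2 \<Omega>" "weak_grad \<Omega> v \<in> L2 \<Omega>"
proof -
  from assms have "v \<in> L2 \<Omega>" "\<exists>g. has_weak_gradient \<Omega> v g" by (auto simp: H10_def H1_def)
  then show "v \<in> L2 \<Omega>" "weak_grad \<Omega> v \<in> L2 \<Omega>"
    using someI_ex[of "has_weak_gradient \<Omega> v"] by (auto simp: weak_grad_def has_weak_gradient_def)
qed

lemma L2_Cauchy_Schwarz:
  fixes f g :: "real^'d \<Rightarrow> 'b::euclidean_space"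
  assumes "f \<in> L2 \<Omega>" "g \<in> L2 \<Omega>"
  shows "\<bar>L2_inner \<Omega> f g\<bar> \<le> L2_norm \<Omega> f * L2_norm \<Omega> g"
proof -
  define a b d where "a = L2_inner \<Omega> f f" and "b = L2_inner \<Omega> f g" and "d = L2_inner \<Omega> g g"
  have quad: "0 \<le> a - 2 * s * b + s\<^sup>2 * d" for s
  proof -
    have sg: "(\<lambda>x. s *\<^sub>R g x) \<in> L2 \<Omega>" using assms by (intro L2_scaleR)
    have s1: "L2_inner \<Omega> h (\<lambda>x. s *\<^sub>R g x) = s * L2_inner \<Omega> h g"
      "L2_inner \<Omega> (\<lambda>x. s *\<^sub>R g x) h = s * L2_inner \<Omega> g h" for h
      by (simp_all add: L2_inner_def)
    have c: "L2_inner \<Omega> g f = b" by (simp add: b_def L2_inner_commute)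
    have "0 \<le> L2_inner \<Omega> (\<lambda>x. f x - s *\<^sub>R g x) (\<lambda>x. f x - s *\<^sub>R g x)" by (rule L2_inner_self_nonneg)
    also have "\<dots> = (a - s * b) - (s * b - s * (s * d))"
      unfolding L2_inner_diff_left[OF assms(1) sg L2_diff[OF assms(1) sg]]
        L2_inner_diff_right[OF assms(1) sg assms(1)] L2_inner_diff_right[OF assms(1) sg sg] s1 c
      by (simp add: a_def b_def d_def)
    finally show ?thesis by (simp add: power2_eq_square algebra_simps)
  qed
  have "b\<^sup>2 \<le> a * d"
  proof (cases "d = 0")
    case True
    have "b = 0"
    proof (rule ccontr)
      assume "b \<noteq> 0"
      then show False using quad[of "(a + 1) / (2 * b)"] True by simp
    qed
    then show ?thesis using True by simp
  next
    case False
    then have d: "0 < d" using L2_inner_self_nonneg[of \<Omega> g] by (simp add: d_def less_le)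
    have "0 \<le> (a - 2 * (b / d) * b + (b / d)\<^sup>2 * d) * d" using quad[of "b / d"] d by simp
    also have "\<dots> = a * d - b\<^sup>2" using d by (simp add: power2_eq_square field_simps)
    finally show ?thesis by simp
  qed
  then have "\<bar>b\<bar> \<le> sqrt (a * d)" by (intro real_le_rsqrt) simp
  then show ?thesis by (simp add: a_def b_def d_def L2_norm_def real_sqrt_mult)
qed

lemma L2_norm_le_of_AE_bound:
  fixes f :: "real^'d \<Rightarrow> real"
  assumes "\<Omega> \<in> lmeasurable" "f \<in> L2 \<Omega>" "AE x in lebesgue_on \<Omega>. \<bar>f x\<bar> \<le> B" "0 \<le> B"
  shows "L2_norm \<Omega> f \<le> B * sqrt (measure lebesgue \<Omega>)"
proof -
  have m: "\<Omega> \<in> sets lebesgue" using assms(1) by auto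
  interpret finite_measure "lebesgue_on \<Omega>" using assms(1) by (rule finite_measure_lebesgue_on)
  have "L2_inner \<Omega> f f \<le> (\<integral>x. B\<^sup>2 \<partial>lebesgue_on \<Omega>)"
    unfolding L2_inner_def
  proof (rule integral_mono_AE)
    show "integrable (lebesgue_on \<Omega>) (\<lambda>x. f x \<bullet> f x)" using assms by (intro L2_inner_integrable)
    show "AE x in lebesgue_on \<Omega>. f x \<bullet> f x \<le> B\<^sup>2"
      using assms(3) by eventually_elim (metis inner_real_def power2_abs power2_eq_square abs_ge_zero power_mono)
  qed auto
  also have "\<dots> = B\<^sup>2 * measure lebesgue \<Omega>"
    using m by (simp add: measure_restrict_space)
  finally have "L2_inner \<Omega> f f \<le> (B * sqrt (measure lebesgue \<Omega>))\<^sup>2"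
    by (simp add: power_mult_distrib)
  then have "sqrt (L2_inner \<Omega> f f) \<le> B * sqrt (measure lebesgue \<Omega>)"
    using assms(4) by (intro real_le_lsqrt) auto
  then show ?thesis by (simp add: L2_norm_def)
qed

lemma borel_measurable_lebesgue_on_AE:
  fixes f g :: "'a::euclidean_space \<Rightarrow> real"
  assumes S: "S \<in> sets lebesgue" and f: "f \<in> borel_measurable (lebesgue_on S)"
    and ae: "AE x in lebesgue_on S. f x = g x"
  shows "g \<in> borel_measurable (lebesgue_on S)"
proof -
  have "(\<lambda>x. if x \<in> S then f x else 0) \<in> borel_measurable lebesgue"
    using f S by (simp add: borel_measurable_if)
  moreover have "AE x in lebesgue. (if x \<in> S then f x else 0) = (if x \<in> S then g x else 0)"
    using ae S by (auto simp: AE_restrict_space_iff)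
  ultimately have "(\<lambda>x. if x \<in> S then g x else 0) \<in> borel_measurable lebesgue"
    by (rule borel_measurable_AE)
  then show ?thesis using S by (simp add: borel_measurable_if)
qed

text \<open>
  Both sides are limits of the pairings of \<open>\<psi>\<close> with the integrals of the approximating simple functions,
  for which the identity is a finite sum; the Cauchy-Schwarz inequality in space controls the distances.
\<close>

lemma L2_inner_bochner_integral:
  fixes \<Omega> :: "(real^'d) set"
  assumes S: "S \<in> lmeasurable" and \<psi>: "\<psi> \<in> L2 \<Omega>"
    and I: "has_L2_bochner_integral \<Omega> S g I"
    and int: "integrable (lebesgue_on S) (\<lambda>s. L2_inner \<Omega> (g s) \<psi>)"
  shows "L2_inner \<Omega> I \<psi> = (\<integral>s. L2_inner \<Omega> (g s) \<psi> \<partial>lebesgue_on S)"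
proof -
  have Sm: "S \<in> sets lebesgue" using S by auto
  from I obtain \<phi> where g: "\<And>s. s \<in> S \<Longrightarrow> g s \<in> L2 \<Omega>" and w: "I \<in> L2 \<Omega>"
    and simple: "\<And>n. L2_simple_function \<Omega> S (\<phi> n)"
    and di: "\<And>n. integrable (lebesgue_on S) (\<lambda>s. L2_norm \<Omega> (\<lambda>x. g s x - \<phi> n s x))"
    and d0: "(\<lambda>n. \<integral>s. L2_norm \<Omega> (\<lambda>x. g s x - \<phi> n s x) \<partial>lebesgue_on S) \<longlonglongrightarrow> 0"
    and i0: "(\<lambda>n. L2_norm \<Omega> (\<lambda>x. L2_simple_integral S (\<phi> n) x - I x)) \<longlonglongrightarrow> 0"
    unfolding has_L2_bochner_integral_def by blast
  define P where "P n = L2_inner \<Omega> (L2_simple_integral S (\<phi> n)) \<psi>" for n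
  have fin: "finite (\<phi> n ` S)" and sub: "\<phi> n ` S \<subseteq> L2 \<Omega>"
    and lev: "\<And>c. c \<in> \<phi> n ` S \<Longrightarrow> {s \<in> S. \<phi> n s = c} \<in> sets lebesgue" for n
    using simple[of n] by (auto simp: L2_simple_function_def)
  have simpL2: "L2_simple_integral S (\<phi> n) \<in> L2 \<Omega>" for n
    unfolding L2_simple_integral_def[abs_def] using sub[of n] by (intro L2_sum L2_cmult) auto
  have phi_int: "has_bochner_integral (lebesgue_on S) (\<lambda>s. L2_inner \<Omega> (\<phi> n s) \<psi>) (P n)" for n
  proof -
    have 1: "has_bochner_integral (lebesgue_on S) (\<lambda>s. indicator {s \<in> S. \<phi> n s = c} s * L2_inner \<Omega> c \<psi>)
        (measure lebesgue {s \<in> S. \<phi> n s = c} * L2_inner \<Omega> c \<psi>)" if c: "c \<in> \<phi> n ` S" for c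
    proof -
      let ?A = "{s \<in> S. \<phi> n s = c}"
      have A: "?A \<in> sets (lebesgue_on S)" "?A \<subseteq> S"
        using lev[OF c] Sm by (auto simp: sets_restrict_space_iff)
      have "emeasure (lebesgue_on S) ?A \<le> emeasure (lebesgue_on S) S"
        using A Sm by (intro emeasure_mono) (auto simp: sets_restrict_space_iff)
      also have "\<dots> < \<infinity>" using S Sm by (auto simp: emeasure_restrict_space fmeasurable_def)
      finally have "has_bochner_integral (lebesgue_on S) (\<lambda>s. indicator ?A s * L2_inner \<Omega> c \<psi>)
          (measure (lebesgue_on S) ?A * L2_inner \<Omega> c \<psi>)"
        using A by (intro has_bochner_integral_mult_left has_bochner_integral_real_indicator) auto
      moreover have "measure (lebesgue_on S) ?A = measure lebesgue ?A"
        using A Sm by (intro measure_restrict_space) auto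
      ultimately show ?thesis by simp
    qed
    have A: "has_bochner_integral (lebesgue_on S)
        (\<lambda>s. \<Sum>c\<in>\<phi> n ` S. indicator {s \<in> S. \<phi> n s = c} s * L2_inner \<Omega> c \<psi>)
        (\<Sum>c\<in>\<phi> n ` S. measure lebesgue {s \<in> S. \<phi> n s = c} * L2_inner \<Omega> c \<psi>)"
      by (intro has_bochner_integral_sum 1)
    have B: "(\<Sum>c\<in>\<phi> n ` S. measure lebesgue {s \<in> S. \<phi> n s = c} * L2_inner \<Omega> c \<psi>) = P n"
    proof -
      have "P n = L2_inner \<Omega> (\<lambda>x. \<Sum>c\<in>\<phi> n ` S. measure lebesgue {s \<in> S. \<phi> n s = c} * c x) \<psi>"
        by (simp add: P_def L2_simple_integral_def[abs_def])
      also have "\<dots> = (\<Sum>c\<in>\<phi> n ` S. L2_inner \<Omega> (\<lambda>x. measure lebesgue {s \<in> S. \<phi> n s = c} * c x) \<psi>)"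
        using sub[of n] \<psi> by (intro L2_inner_sum_left L2_cmult) auto
      finally show ?thesis by (simp add: L2_inner_cmult_left)
    qed
    have C: "(\<Sum>c\<in>\<phi> n ` S. indicator {s \<in> S. \<phi> n s = c} s * L2_inner \<Omega> c \<psi>) = L2_inner \<Omega> (\<phi> n s) \<psi>"
      if s: "s \<in> space (lebesgue_on S)" for s
    proof -
      have "s \<in> S" using s by simp
      then have "(\<Sum>c\<in>\<phi> n ` S. indicator {s \<in> S. \<phi> n s = c} s * L2_inner \<Omega> c \<psi>)
          = (\<Sum>c\<in>\<phi> n ` S. if c = \<phi> n s then L2_inner \<Omega> c \<psi> else 0)"
        by (intro sum.cong) auto
      also have "\<dots> = L2_inner \<Omega> (\<phi> n s) \<psi>" using fin[of n] \<open>s \<in> S\<close> by simp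
      finally show ?thesis .
    qed
    show ?thesis by (rule iffD1[OF has_bochner_integral_cong[OF refl C refl] A[unfolded B]])
  qed
  have "P \<longlonglongrightarrow> L2_inner \<Omega> I \<psi>"
  proof (rule LIM_zero_cancel, rule Lim_null_comparison)
    show "\<forall>\<^sub>F n in sequentially. norm (P n - L2_inner \<Omega> I \<psi>)
        \<le> L2_norm \<Omega> (\<lambda>x. L2_simple_integral S (\<phi> n) x - I x) * L2_norm \<Omega> \<psi>"
      unfolding P_def using L2_Cauchy_Schwarz[OF L2_diff[OF simpL2 w] \<psi>]
      by (simp add: L2_inner_diff_left[OF simpL2 w \<psi>])
    show "(\<lambda>n. L2_norm \<Omega> (\<lambda>x. L2_simple_integral S (\<phi> n) x - I x) * L2_norm \<Omega> \<psi>) \<longlonglongrightarrow> 0"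
      using tendsto_mult_right[OF i0, of "L2_norm \<Omega> \<psi>"] by simp
  qed
  moreover have "P \<longlonglongrightarrow> (\<integral>s. L2_inner \<Omega> (g s) \<psi> \<partial>lebesgue_on S)"
  proof (rule LIM_zero_cancel, rule Lim_null_comparison)
    have "norm (P n - (\<integral>s. L2_inner \<Omega> (g s) \<psi> \<partial>lebesgue_on S))
        \<le> (\<integral>s. L2_norm \<Omega> (\<lambda>x. g s x - \<phi> n s x) \<partial>lebesgue_on S) * L2_norm \<Omega> \<psi>" for n
    proof -
      have pi: "integrable (lebesgue_on S) (\<lambda>s. L2_inner \<Omega> (\<phi> n s) \<psi>)"
        "P n = (\<integral>s. L2_inner \<Omega> (\<phi> n s) \<psi> \<partial>lebesgue_on S)"
        using phi_int[of n] by (auto simp: has_bochner_integral_iff)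
      have "norm (P n - (\<integral>s. L2_inner \<Omega> (g s) \<psi> \<partial>lebesgue_on S))
          = norm (\<integral>s. L2_inner \<Omega> (\<phi> n s) \<psi> - L2_inner \<Omega> (g s) \<psi> \<partial>lebesgue_on S)"
        unfolding pi(2) using pi(1) int by simp
      also have "\<dots> \<le> (\<integral>s. norm (L2_inner \<Omega> (\<phi> n s) \<psi> - L2_inner \<Omega> (g s) \<psi>) \<partial>lebesgue_on S)"
        by (rule integral_norm_bound)
      also have "\<dots> \<le> (\<integral>s. L2_norm \<Omega> (\<lambda>x. g s x - \<phi> n s x) * L2_norm \<Omega> \<psi> \<partial>lebesgue_on S)"
      proof (rule Bochner_Integration.integral_mono)
        show "integrable (lebesgue_on S) (\<lambda>s. norm (L2_inner \<Omega> (\<phi> n s) \<psi> - L2_inner \<Omega> (g s) \<psi>))"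
          using pi(1) int by simp
        show "integrable (lebesgue_on S) (\<lambda>s. L2_norm \<Omega> (\<lambda>x. g s x - \<phi> n s x) * L2_norm \<Omega> \<psi>)"
          using di[of n] by simp
        fix s assume "s \<in> space (lebesgue_on S)"
        then have s: "s \<in> S" by simp
        then have "\<phi> n s \<in> L2 \<Omega>" using sub[of n] by auto
        then show "norm (L2_inner \<Omega> (\<phi> n s) \<psi> - L2_inner \<Omega> (g s) \<psi>)
            \<le> L2_norm \<Omega> (\<lambda>x. g s x - \<phi> n s x) * L2_norm \<Omega> \<psi>"
          using L2_Cauchy_Schwarz[OF L2_diff[OF g[OF s]] \<psi>, of "\<phi> n s"]
            L2_inner_diff_left[OF g[OF s] _ \<psi>, of "\<phi> n s"] by simp
      qed
      finally show ?thesis by simp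
    qed
    then show "\<forall>\<^sub>F n in sequentially. norm (P n - (\<integral>s. L2_inner \<Omega> (g s) \<psi> \<partial>lebesgue_on S))
        \<le> (\<integral>s. L2_norm \<Omega> (\<lambda>x. g s x - \<phi> n s x) \<partial>lebesgue_on S) * L2_norm \<Omega> \<psi>" by simp
    show "(\<lambda>n. (\<integral>s. L2_norm \<Omega> (\<lambda>x. g s x - \<phi> n s x) \<partial>lebesgue_on S) * L2_norm \<Omega> \<psi>) \<longlonglongrightarrow> 0"
      using tendsto_mult_right[OF d0, of "L2_norm \<Omega> \<psi>"] by simp
  qed
  ultimately show ?thesis by (rule LIMSEQ_unique)
qed

section \<open>The L2 operator on sequences of functions\<close>

text \<open>
  Linear functionals of the first \<open>k + 1\<close> members of a sequence. A functional of this form, such as the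
  L2 operator, turns sequences in $L^2(\Omega)$ into elements of $L^2(\Omega)$ and commutes with pairings.
\<close>

definition linear_upto :: "nat \<Rightarrow> ((nat \<Rightarrow> real) \<Rightarrow> real) \<Rightarrow> bool" where
  "linear_upto k L \<longleftrightarrow> (\<exists>\<beta>. \<forall>a. L a = (\<Sum>j\<le>k. \<beta> j * a j))"

lemma linear_upto_component: "j \<le> k \<Longrightarrow> linear_upto k (\<lambda>a. a j)"
  unfolding linear_upto_def
  by (intro exI[of _ "\<lambda>i. if i = j then 1 else 0"]) (simp add: if_distrib[of "\<lambda>x. x * _"] cong: if_cong)

lemma linear_upto_zero: "linear_upto k (\<lambda>a. 0)"
  unfolding linear_upto_def by (intro exI[of _ "\<lambda>_. 0"]) simp

lemma linear_upto_add: "linear_upto k L \<Longrightarrow> linear_upto k M \<Longrightarrow> linear_upto k (\<lambda>a. L a + M a)"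
  unfolding linear_upto_def
proof (elim exE)
  fix \<beta> \<gamma> assume "\<forall>a. L a = (\<Sum>j\<le>k. \<beta> j * a j)" "\<forall>a. M a = (\<Sum>j\<le>k. \<gamma> j * a j)"
  then show "\<exists>\<beta>. \<forall>a. L a + M a = (\<Sum>j\<le>k. \<beta> j * a j)"
    by (intro exI[of _ "\<lambda>j. \<beta> j + \<gamma> j"]) (simp add: distrib_right sum.distrib)
qed

lemma linear_upto_cmult: "linear_upto k L \<Longrightarrow> linear_upto k (\<lambda>a. c * L a)"
  unfolding linear_upto_def
proof (elim exE)
  fix \<beta> assume "\<forall>a. L a = (\<Sum>j\<le>k. \<beta> j * a j)"
  then show "\<exists>\<beta>. \<forall>a. c * L a = (\<Sum>j\<le>k. \<beta> j * a j)"
    by (intro exI[of _ "\<lambda>j. c * \<beta> j"]) (simp add: sum_distrib_left mult.assoc)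
qed

lemma linear_upto_diff: "linear_upto k L \<Longrightarrow> linear_upto k M \<Longrightarrow> linear_upto k (\<lambda>a. L a - M a)"
  using linear_upto_add[OF _ linear_upto_cmult[of k M "-1"], of L] by simp

lemma linear_upto_sum:
  "(\<And>i. i \<in> S \<Longrightarrow> linear_upto k (L i)) \<Longrightarrow> linear_upto k (\<lambda>a. \<Sum>i\<in>S. L i a)"
  by (induction S rule: infinite_finite_induct) (auto intro: linear_upto_zero linear_upto_add)

lemma (in nondecreasing_mesh) linear_upto_L2_op:
  assumes "1 \<le> k" shows "linear_upto k (L2_op \<alpha> t k)"
proof -
  have dq: "linear_upto k (\<lambda>a. dq a j)" if "j \<le> k" for j
    using linear_upto_cmult[OF linear_upto_diff[OF linear_upto_component[OF that] linear_upto_component[of "j - 1" k]], of "1 / \<tau> j"] that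
    by (simp add: dq_def)
  have last_term: "linear_upto k (last_term k)"
  proof (cases "k = 1")
    case False
    have "linear_upto k (\<lambda>a. (1 / (\<tau> (k - 1) + \<tau> (Suc (k - 1))) * tilt (w k) k) * (dq a (Suc (k - 1)) - dq a (k - 1)))"
      using assms by (intro linear_upto_cmult linear_upto_diff dq) auto
    then show ?thesis using False by (simp add: last_term_def[abs_def] curv_def mult.commute)
  qed (simp add: last_term_def[abs_def] linear_upto_zero)
  have "linear_upto k (\<lambda>a. (1 / Gamma (1 - \<alpha>)) *
      ((\<Sum>j=1..k-1. entry (w k) j * (a j - a (j - 1))) + diag_entry k * (a k - a (k - 1)) + last_term k a))"
    using last_term by (intro linear_upto_cmult linear_upto_add linear_upto_sum linear_upto_diff linear_upto_component) auto
  moreover have "Gamma (1 - \<alpha>) \<noteq> 0"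
    using alpha by (intro less_imp_neq[THEN not_sym] Gamma_real_pos) auto
  ultimately show ?thesis
    unfolding L2_op_increments[OF assms, symmetric] by simp
qed

lemma linear_upto_L2:
  fixes W :: "nat \<Rightarrow> real^'d \<Rightarrow> real"
  assumes "linear_upto k L" "\<And>j. j \<le> k \<Longrightarrow> W j \<in> L2 \<Omega>"
  shows "(\<lambda>x. L (\<lambda>j. W j x)) \<in> L2 \<Omega>"
    "\<psi> \<in> L2 \<Omega> \<Longrightarrow> L2_inner \<Omega> (\<lambda>x. L (\<lambda>j. W j x)) \<psi> = L (\<lambda>j. L2_inner \<Omega> (W j) \<psi>)"
proof -
  obtain \<beta> where \<beta>: "\<And>a. L a = (\<Sum>j\<le>k. \<beta> j * a j)" using assms(1) by (auto simp: linear_upto_def)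
  show "(\<lambda>x. L (\<lambda>j. W j x)) \<in> L2 \<Omega>"
    unfolding \<beta> using assms(2) by (intro L2_sum L2_cmult) auto
  assume \<psi>: "\<psi> \<in> L2 \<Omega>"
  have "L2_inner \<Omega> (\<lambda>x. \<Sum>j\<le>k. \<beta> j * W j x) \<psi> = (\<Sum>j\<le>k. L2_inner \<Omega> (\<lambda>x. \<beta> j * W j x) \<psi>)"
    using assms(2) \<psi> by (intro L2_inner_sum_left L2_cmult) auto
  then show "L2_inner \<Omega> (\<lambda>x. L (\<lambda>j. W j x)) \<psi> = L (\<lambda>j. L2_inner \<Omega> (W j) \<psi>)"
    unfolding \<beta> by (simp add: L2_inner_cmult_left)
qed

lemma linear_upto_minus:
  assumes "linear_upto k L" shows "L (\<lambda>j. a j - b j) = L a - L b"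
proof -
  obtain \<beta> where \<beta>: "\<And>a. L a = (\<Sum>j\<le>k. \<beta> j * a j)" using assms by (auto simp: linear_upto_def)
  show ?thesis unfolding \<beta> by (simp add: right_diff_distrib sum_subtractf)
qed

section \<open>Error of the scheme\<close>

locale subdiffusion =
  fixes \<alpha> T r :: real
    and \<Omega> :: "(real^'d) set"
    and u f :: "real \<Rightarrow> real^'d \<Rightarrow> real"
    and u0 :: "real^'d \<Rightarrow> real"
    and Du :: "nat \<Rightarrow> real \<Rightarrow> real^'d \<Rightarrow> real"
    and Cb :: "nat \<Rightarrow> real"
  assumes alpha: "0 < \<alpha>" "\<alpha> < 1"
    and T: "0 < T"
    and r: "1 < r"
    and domain: "bounded_lipschitz_domain \<Omega>"
    and regularity: "C_time_H10 3 \<Omega> T u Du"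
    and continuity: "C_time_L2 \<Omega> T u"
    and initial: "AE x in lebesgue_on \<Omega>. u 0 x = u0 x"
    and equation: "weak_subdiffusion_eq \<Omega> T \<alpha> f u (Du 1)"
    and bounds: "\<forall>l\<in>{1, 3}. \<forall>t\<in>{0<..T}. AE x in lebesgue_on \<Omega>.
                   \<bar>Du l t x\<bar> \<le> Cb l * (1 + t powr (\<alpha> - real l))"
begin

abbreviation ip :: "(real^'d \<Rightarrow> 'b::euclidean_space) \<Rightarrow> (real^'d \<Rightarrow> 'b) \<Rightarrow> real" where
  "ip \<equiv> L2_inner \<Omega>"

abbreviation nrm :: "(real^'d \<Rightarrow> 'b::euclidean_space) \<Rightarrow> real" where
  "nrm \<equiv> L2_norm \<Omega>"

abbreviation grad :: "(real^'d \<Rightarrow> real) \<Rightarrow> real^'d \<Rightarrow> real^'d" where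
  "grad \<equiv> weak_grad \<Omega>"

lemma Omega_lmeasurable: "\<Omega> \<in> lmeasurable"
  using domain by (auto simp: bounded_lipschitz_domain_def intro: lmeasurable_open)

lemma Du_L2: "l \<le> 3 \<Longrightarrow> s \<in> {0<..T} \<Longrightarrow> Du l s \<in> L2 \<Omega>"
  using regularity by (auto simp: C_time_H10_def intro: H10_D)

lemma Du_0: "s \<in> {0<..T} \<Longrightarrow> Du 0 s = u s"
  using regularity by (auto simp: C_time_H10_def)

lemma u_H10: "s \<in> {0<..T} \<Longrightarrow> u s \<in> H10 \<Omega>"
  using regularity Du_0[of s] by (force simp: C_time_H10_def)

lemma u_L2: "s \<in> {0..T} \<Longrightarrow> u s \<in> L2 \<Omega>"
  using continuity by (auto simp: C_time_L2_def)

lemma pairing_continuous: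
  assumes "\<psi> \<in> L2 \<Omega>"
  shows "continuous_on {0..T} (\<lambda>s. ip (u s) \<psi>)"
  unfolding continuous_on_def
proof (intro ballI)
  fix t assume t: "t \<in> {0..T}"
  show "((\<lambda>s. ip (u s) \<psi>) \<longlongrightarrow> ip (u t) \<psi>) (at t within {0..T})"
  proof (rule LIM_zero_cancel, rule Lim_null_comparison)
    show "\<forall>\<^sub>F s in at t within {0..T}. norm (ip (u s) \<psi> - ip (u t) \<psi>)
        \<le> nrm (\<lambda>x. u s x - u t x) * nrm \<psi>"
      unfolding eventually_at_filter
    proof (rule always_eventually, intro allI impI)
      fix s assume "s \<in> {0..T}"
      then show "norm (ip (u s) \<psi> - ip (u t) \<psi>) \<le> nrm (\<lambda>x. u s x - u t x) * nrm \<psi>"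
        using L2_Cauchy_Schwarz[OF L2_diff[OF u_L2 u_L2[OF t]] assms, of s]
          L2_inner_diff_left[OF u_L2 u_L2[OF t] assms, of s] by simp
    qed
    have "((\<lambda>s. nrm (\<lambda>x. u s x - u t x)) \<longlongrightarrow> 0) (at t within {0..T})"
      using continuity t by (auto simp: C_time_L2_def)
    then show "((\<lambda>s. nrm (\<lambda>x. u s x - u t x) * nrm \<psi>) \<longlongrightarrow> 0) (at t within {0..T})"
      by (rule tendsto_mult_left_zero)
  qed
qed

lemma pairing_derivative:
  assumes \<psi>: "\<psi> \<in> L2 \<Omega>" and l: "l < 3" and t: "t \<in> {0<..T}"
  shows "((\<lambda>s. ip (Du l s) \<psi>) has_real_derivative ip (Du (Suc l) t) \<psi>) (at t within {0<..T})"
  unfolding has_field_derivative_iff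
proof (rule LIM_zero_cancel, rule Lim_null_comparison)
  show "\<forall>\<^sub>F s in at t within {0<..T}.
      norm ((ip (Du l s) \<psi> - ip (Du l t) \<psi>) / (s - t) - ip (Du (Suc l) t) \<psi>)
        \<le> H1_norm \<Omega> (\<lambda>x. (Du l s x - Du l t x) / (s - t) - Du (Suc l) t x) * nrm \<psi>"
    unfolding eventually_at_filter
  proof (rule always_eventually, intro allI impI)
    fix s assume s: "s \<in> {0<..T}"
    have m: "Du l s \<in> L2 \<Omega>" "Du l t \<in> L2 \<Omega>" "Du (Suc l) t \<in> L2 \<Omega>"
      using s t l by (auto intro!: Du_L2)
    let ?q = "\<lambda>x. (1 / (s - t)) * (Du l s x - Du l t x)"
    have q: "?q \<in> L2 \<Omega>" by (intro L2_cmult L2_diff m)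
    have "ip (\<lambda>x. ?q x - Du (Suc l) t x) \<psi>
        = (1 / (s - t)) * (ip (Du l s) \<psi> - ip (Du l t) \<psi>) - ip (Du (Suc l) t) \<psi>"
      unfolding L2_inner_diff_left[OF q m(3) \<psi>] L2_inner_cmult_left L2_inner_diff_left[OF m(1,2) \<psi>] ..
    then have "norm ((ip (Du l s) \<psi> - ip (Du l t) \<psi>) / (s - t) - ip (Du (Suc l) t) \<psi>)
        = \<bar>ip (\<lambda>x. ?q x - Du (Suc l) t x) \<psi>\<bar>" by simp
    also have "\<dots> \<le> nrm (\<lambda>x. ?q x - Du (Suc l) t x) * nrm \<psi>"
      by (rule L2_Cauchy_Schwarz[OF L2_diff[OF q m(3)] \<psi>])
    also have "\<dots> \<le> H1_norm \<Omega> (\<lambda>x. ?q x - Du (Suc l) t x) * nrm \<psi>"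
      by (intro mult_right_mono L2_norm_le_H1_norm) simp
    finally show "norm ((ip (Du l s) \<psi> - ip (Du l t) \<psi>) / (s - t) - ip (Du (Suc l) t) \<psi>)
        \<le> H1_norm \<Omega> (\<lambda>x. (Du l s x - Du l t x) / (s - t) - Du (Suc l) t x) * nrm \<psi>" by simp
  qed
  have "((\<lambda>s. H1_norm \<Omega> (\<lambda>x. (Du l s x - Du l t x) / (s - t) - Du (Suc l) t x)) \<longlongrightarrow> 0) (at t within {0<..T})"
    using regularity l t by (auto simp: C_time_H10_def)
  then show "((\<lambda>s. H1_norm \<Omega> (\<lambda>x. (Du l s x - Du l t x) / (s - t) - Du (Suc l) t x) * nrm \<psi>) \<longlongrightarrow> 0) (at t within {0<..T})"
    by (rule tendsto_mult_left_zero)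
qed

definition growth_const :: real where
  "growth_const = (\<bar>Cb 1\<bar> * (T powr (1 - \<alpha>) + 1) + \<bar>Cb 3\<bar> * (T powr (3 - \<alpha>) + 1)) * sqrt (measure lebesgue \<Omega>)"

lemma growth_const_nonneg: "0 \<le> growth_const"
  by (simp add: growth_const_def)

lemma pairing_bound:
  assumes \<psi>: "\<psi> \<in> L2 \<Omega>" and l: "l \<in> {1, 3}" and t: "t \<in> {0<..T}"
  shows "\<bar>ip (Du l t) \<psi>\<bar> \<le> growth_const * nrm \<psi> * t powr (\<alpha> - real l)"
proof -
  define B where "B = \<bar>Cb l\<bar> * (T powr (real l - \<alpha>) + 1)"
  have l2: "Du l t \<in> L2 \<Omega>" using l t by (intro Du_L2) auto
  have "1 = t powr (real l - \<alpha>) * t powr (\<alpha> - real l)" using t by (simp add: powr_add[symmetric])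
  also have "\<dots> \<le> T powr (real l - \<alpha>) * t powr (\<alpha> - real l)"
    using t l alpha by (intro mult_right_mono powr_mono2) auto
  finally have one: "1 \<le> T powr (real l - \<alpha>) * t powr (\<alpha> - real l)" .
  have "Cb l * (1 + t powr (\<alpha> - real l)) \<le> \<bar>Cb l\<bar> * (1 + t powr (\<alpha> - real l))"
    by (intro mult_right_mono) auto
  also have "\<dots> \<le> \<bar>Cb l\<bar> * (T powr (real l - \<alpha>) * t powr (\<alpha> - real l) + t powr (\<alpha> - real l))"
    using one by (intro mult_left_mono) auto
  also have "\<dots> = B * t powr (\<alpha> - real l)" by (simp add: B_def algebra_simps)
  finally have b: "Cb l * (1 + t powr (\<alpha> - real l)) \<le> B * t powr (\<alpha> - real l)" .
  have "AE x in lebesgue_on \<Omega>. \<bar>Du l t x\<bar> \<le> Cb l * (1 + t powr (\<alpha> - real l))"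
    using bounds l t by blast
  then have "AE x in lebesgue_on \<Omega>. \<bar>Du l t x\<bar> \<le> B * t powr (\<alpha> - real l)"
    by eventually_elim (use b in linarith)
  then have "nrm (Du l t) \<le> (B * t powr (\<alpha> - real l)) * sqrt (measure lebesgue \<Omega>)"
    by (intro L2_norm_le_of_AE_bound Omega_lmeasurable l2) (auto simp: B_def)
  also have "\<dots> = (B * sqrt (measure lebesgue \<Omega>)) * t powr (\<alpha> - real l)" by simp
  also have "\<dots> \<le> growth_const * t powr (\<alpha> - real l)"
    unfolding growth_const_def B_def using l by (intro mult_right_mono) auto
  finally have "nrm (Du l t) * nrm \<psi> \<le> growth_const * t powr (\<alpha> - real l) * nrm \<psi>"
    by (intro mult_right_mono) auto
  with L2_Cauchy_Schwarz[OF l2 \<psi>] show ?thesis by (simp add: ac_simps)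
qed

text \<open>
  Pairing with a fixed \<open>\<psi>\<close> turns the vector-valued solution into a real function to which the truncation
  estimate applies; almost everywhere bounds become bounds of the norm.
\<close>

lemma pairing_singular_function:
  assumes \<psi>: "\<psi> \<in> L2 \<Omega>"
  shows "singular_function \<alpha> T (growth_const * nrm \<psi>) (\<lambda>s. ip (u s) \<psi>)
    (\<lambda>s. ip (Du 1 s) \<psi>) (\<lambda>s. ip (Du 2 s) \<psi>) (\<lambda>s. ip (Du 3 s) \<psi>)"
proof
  show "0 < \<alpha>" "\<alpha> < 1" by (fact alpha)+
  show "continuous_on {0..T} (\<lambda>s. ip (u s) \<psi>)" by (rule pairing_continuous[OF \<psi>])
  show "0 \<le> growth_const * nrm \<psi>" using growth_const_nonneg by simp
  fix s assume s: "s \<in> {0<..T}"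
  show "((\<lambda>s. ip (u s) \<psi>) has_real_derivative ip (Du 1 s) \<psi>) (at s within {0<..T})"
  proof (rule has_field_derivative_transform_within[OF _ zero_less_one s])
    show "((\<lambda>s. ip (Du 0 s) \<psi>) has_real_derivative ip (Du 1 s) \<psi>) (at s within {0<..T})"
      using pairing_derivative[OF \<psi> _ s, of 0] by simp
  qed (simp add: Du_0)
  show "((\<lambda>s. ip (Du 1 s) \<psi>) has_real_derivative ip (Du 2 s) \<psi>) (at s within {0<..T})"
    using pairing_derivative[OF \<psi> _ s, of 1] by (simp add: numeral_2_eq_2)
  show "((\<lambda>s. ip (Du 2 s) \<psi>) has_real_derivative ip (Du 3 s) \<psi>) (at s within {0<..T})"
    using pairing_derivative[OF \<psi> _ s, of 2] by (simp add: numeral_3_eq_3)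
  show "\<bar>ip (Du 1 s) \<psi>\<bar> \<le> growth_const * nrm \<psi> * s powr (\<alpha> - 1)"
    using pairing_bound[OF \<psi> _ s, of 1] by simp
  show "\<bar>ip (Du 3 s) \<psi>\<bar> \<le> growth_const * nrm \<psi> * s powr (\<alpha> - 3)"
    using pairing_bound[OF \<psi> _ s, of 3] by simp
qed

lemma caputo_pairing:
  assumes w: "has_caputo_derivative \<Omega> \<alpha> (Du 1) t w" and t: "t \<in> {0<..T}"
  shows "w \<in> L2 \<Omega>"
    "\<psi> \<in> L2 \<Omega> \<Longrightarrow> Gamma (1 - \<alpha>) * ip w \<psi>
       = integral {0..t} (\<lambda>s. ip (Du 1 s) \<psi> * (t - s) powr (- \<alpha>))"
proof -
  obtain I where I: "has_L2_bochner_integral \<Omega> {0<..<t} (\<lambda>s x. Du 1 s x / (t - s) powr \<alpha>) I"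
    and wI: "w = (\<lambda>x. 1 / Gamma (1 - \<alpha>) * I x)"
    using w by (auto simp: has_caputo_derivative_def)
  have "I \<in> L2 \<Omega>" using I by (simp add: has_L2_bochner_integral_def)
  then show "w \<in> L2 \<Omega>" unfolding wI by (rule L2_cmult)
  assume \<psi>: "\<psi> \<in> L2 \<Omega>"
  interpret singular_function \<alpha> T "growth_const * nrm \<psi>" "\<lambda>s. ip (u s) \<psi>"
    "\<lambda>s. ip (Du 1 s) \<psi>" "\<lambda>s. ip (Du 2 s) \<psi>" "\<lambda>s. ip (Du 3 s) \<psi>"
    by (rule pairing_singular_function[OF \<psi>])
  have e: "ip (\<lambda>x. Du 1 s x / (t - s) powr \<alpha>) \<psi> = ip (Du 1 s) \<psi> * (t - s) powr (- \<alpha>)" for s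
    using L2_inner_cmult_left[of \<Omega> "(t - s) powr (- \<alpha>)" "Du 1 s" \<psi>]
    by (simp add: powr_minus_divide mult.commute)
  have ai: "integrable (lebesgue_on {0<..<t}) (\<lambda>s. ip (Du 1 s) \<psi> * (t - s) powr (- \<alpha>))"
    using t by (intro absolutely_integrable_imp_integrable caputo_kernel_dominated(3)) auto
  have "ip I \<psi> = (\<integral>s. ip (\<lambda>x. Du 1 s x / (t - s) powr \<alpha>) \<psi> \<partial>lebesgue_on {0<..<t})"
    using ai unfolding e[symmetric] by (intro L2_inner_bochner_integral[OF _ \<psi> I]) (auto intro: lmeasurable_open)
  also have "\<dots> = integral {0<..<t} (\<lambda>s. ip (Du 1 s) \<psi> * (t - s) powr (- \<alpha>))"
    unfolding e by (rule lebesgue_integral_eq_integral[OF ai]) simp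
  also have "\<dots> = integral {0..t} (\<lambda>s. ip (Du 1 s) \<psi> * (t - s) powr (- \<alpha>))"
    by (simp add: integral_open_interval_real)
  finally have "ip I \<psi> = integral {0..t} (\<lambda>s. ip (Du 1 s) \<psi> * (t - s) powr (- \<alpha>))" .
  moreover have "Gamma (1 - \<alpha>) \<noteq> 0"
    using alpha by (intro less_imp_neq[THEN not_sym] Gamma_real_pos) auto
  ultimately show "Gamma (1 - \<alpha>) * ip w \<psi>
       = integral {0..t} (\<lambda>s. ip (Du 1 s) \<psi> * (t - s) powr (- \<alpha>))"
    unfolding wI L2_inner_cmult_left by simp
qed

definition residual_bound :: "nat \<Rightarrow> real" where
  "residual_bound k = truncation_const \<alpha> r (mesh_kappa r) * growth_const / Gamma (1 - \<alpha>) *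
     truncation_rate \<alpha> r k"

definition error_const :: real where
  "error_const = 40 * Gamma (1 - \<alpha>) * (mesh_kappa r * T) powr \<alpha>
     * (truncation_const \<alpha> r (mesh_kappa r) * growth_const / Gamma (1 - \<alpha>))\<^sup>2"

context
  fixes N :: nat
  assumes N: "1 \<le> N"
begin

abbreviation "mesh \<equiv> graded_mesh T r N"

interpretation pg: power_graded_mesh \<alpha> mesh r "mesh_scale T r N" "mesh_kappa r"
  by (rule graded_mesh_power_graded[OF r T N alpha])

lemma mesh_in: "k \<le> N \<Longrightarrow> mesh k \<in> {0..T}"
  using pg.t_mono[of k N] pg.t_nonneg[of k] graded_mesh_last[OF r T N] by simp

lemma mesh_in_pos: "1 \<le> k \<Longrightarrow> k \<le> N \<Longrightarrow> mesh k \<in> {0<..T}"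
  using mesh_in[of k] pg.t_strict_mono[of 0 k] pg.t0 by simp

text \<open>The estimate for real functions is applied to the pairing with the residual itself.\<close>

lemma residual_norm:
  assumes k: "1 \<le> k" "k \<le> N" and w: "has_caputo_derivative \<Omega> \<alpha> (Du 1) (mesh k) w"
  shows "(\<lambda>x. L2_op \<alpha> mesh k (\<lambda>j. u (mesh j) x) - w x) \<in> L2 \<Omega>"
    "nrm (\<lambda>x. L2_op \<alpha> mesh k (\<lambda>j. u (mesh j) x) - w x) \<le> residual_bound k"
proof -
  define R where "R = (\<lambda>x. L2_op \<alpha> mesh k (\<lambda>j. u (mesh j) x) - w x)"
  have lin: "linear_upto k (L2_op \<alpha> mesh k)" using k by (intro pg.linear_upto_L2_op)
  have um: "u (mesh j) \<in> L2 \<Omega>" if "j \<le> k" for j using that k by (intro u_L2 mesh_in) auto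
  have Lu: "(\<lambda>x. L2_op \<alpha> mesh k (\<lambda>j. u (mesh j) x)) \<in> L2 \<Omega>" by (rule linear_upto_L2(1)[OF lin um])
  have wL: "w \<in> L2 \<Omega>" by (rule caputo_pairing(1)[OF w mesh_in_pos[OF k]])
  have RL: "R \<in> L2 \<Omega>" unfolding R_def by (intro L2_diff Lu wL)
  have G: "0 < Gamma (1 - \<alpha>)" using alpha by (intro Gamma_real_pos) auto
  interpret pf: power_graded_function \<alpha> mesh r "mesh_scale T r N" "mesh_kappa r" T "growth_const * nrm R"
    "\<lambda>s. ip (u s) R" "\<lambda>s. ip (Du 1 s) R" "\<lambda>s. ip (Du 2 s) R" "\<lambda>s. ip (Du 3 s) R"
    by (intro power_graded_function.intro mesh_and_function.intro pairing_singular_function RL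
        pg.power_graded_mesh_axioms pg.nondecreasing_mesh_axioms)
  have Lp: "ip (\<lambda>x. L2_op \<alpha> mesh k (\<lambda>j. u (mesh j) x)) R
      = L2_op \<alpha> mesh k (\<lambda>j. ip (u (mesh j)) R)"
    by (rule linear_upto_L2(2)[OF lin um RL])
  have "Gamma (1 - \<alpha>) * ip R R
      = Gamma (1 - \<alpha>) * L2_op \<alpha> mesh k (\<lambda>j. ip (u (mesh j)) R)
        - integral {0..mesh k} (\<lambda>s. ip (Du 1 s) R * pg.w k s)"
    unfolding R_def[THEN arg_cong[where f = "\<lambda>R'. ip R' R"]] L2_inner_diff_left[OF Lu wL RL]
      Lp right_diff_distrib
      caputo_pairing(2)[OF w mesh_in_pos[OF k] RL] pg.w_def ..
  also have "\<dots> \<le> truncation_const \<alpha> r (mesh_kappa r) * (growth_const * nrm R)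
      * truncation_rate \<alpha> r k"
    using pf.truncation_error[of k] k mesh_in[OF k(2)] by auto
  also have "\<dots> = Gamma (1 - \<alpha>) * (residual_bound k * nrm R)"
    using G by (simp add: residual_bound_def)
  finally have le: "nrm R * nrm R \<le> residual_bound k * nrm R"
    using G by (simp add: L2_norm_power2[symmetric] power2_eq_square)
  have "nrm R \<le> residual_bound k"
  proof (cases "nrm R = 0")
    case True
    have "0 \<le> truncation_const \<alpha> r (mesh_kappa r)"
      unfolding truncation_const_def using alpha pg.kappa pf.defect_const_nonneg
      by (intro add_nonneg_nonneg mult_nonneg_nonneg divide_nonneg_nonneg) auto
    then show ?thesis using True G growth_const_nonneg by (simp add: residual_bound_def)
  next
    case False
    then have "0 < nrm R" using L2_norm_nonneg[of \<Omega> R] by linarith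
    then show ?thesis using le by simp
  qed
  with RL show "(\<lambda>x. L2_op \<alpha> mesh k (\<lambda>j. u (mesh j) x) - w x) \<in> L2 \<Omega>"
    "nrm (\<lambda>x. L2_op \<alpha> mesh k (\<lambda>j. u (mesh j) x) - w x) \<le> residual_bound k"
    by (simp_all add: R_def)
qed

text \<open>Coercivity for real sequences holds at every point of \<open>\<Omega>\<close> and is integrated.\<close>

lemma scheme_coercive:
  fixes e :: "nat \<Rightarrow> real^'d \<Rightarrow> real"
  assumes e: "\<And>k. k \<le> n \<Longrightarrow> e k \<in> L2 \<Omega>"
  shows "(\<Sum>k=1..n. pg.\<tau> k powr (- \<alpha>) * (nrm (\<lambda>x. e k x - e (k - 1) x))\<^sup>2) / 40
    \<le> Gamma (1 - \<alpha>) * (\<Sum>k=1..n. ip (\<lambda>x. L2_op \<alpha> mesh k (\<lambda>j. e j x)) (\<lambda>x. e k x - e (k - 1) x))"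
proof -
  have d: "(\<lambda>x. e k x - e (k - 1) x) \<in> L2 \<Omega>" if "k \<in> {1..n}" for k using that by (intro L2_diff e) auto
  have L: "(\<lambda>x. L2_op \<alpha> mesh k (\<lambda>j. e j x)) \<in> L2 \<Omega>" if "k \<in> {1..n}" for k
    using that by (intro linear_upto_L2(1)[OF pg.linear_upto_L2_op] e) auto
  define l where "l x = (\<Sum>k=1..n. (pg.\<tau> k powr (- \<alpha>) / 40) * ((e k x - e (k - 1) x) \<bullet> (e k x - e (k - 1) x)))" for x
  define h where "h x = (\<Sum>k=1..n. Gamma (1 - \<alpha>) * (L2_op \<alpha> mesh k (\<lambda>j. e j x) \<bullet> (e k x - e (k - 1) x)))" for x
  have "(\<integral>x. l x \<partial>lebesgue_on \<Omega>) \<le> (\<integral>x. h x \<partial>lebesgue_on \<Omega>)"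
  proof (rule Bochner_Integration.integral_mono)
    show "integrable (lebesgue_on \<Omega>) l" "integrable (lebesgue_on \<Omega>) h"
      unfolding l_def h_def using d L
      by (auto intro!: Bochner_Integration.integrable_sum integrable_mult_right L2_inner_integrable
          simp del: inner_real_def)
    show "l x \<le> h x" for x
      using pg.L2_op_coercive[where n = n and a = "\<lambda>j. e j x"]
      by (simp add: l_def h_def sum_divide_distrib power2_eq_square ac_simps)
  qed
  moreover have "(\<integral>x. l x \<partial>lebesgue_on \<Omega>)
      = (\<Sum>k=1..n. (pg.\<tau> k powr (- \<alpha>) / 40) * ip (\<lambda>x. e k x - e (k - 1) x) (\<lambda>x. e k x - e (k - 1) x))"
    unfolding l_def L2_inner_def using d
    by (subst Bochner_Integration.integral_sum)
      (auto intro!: integrable_mult_right L2_inner_integrable simp del: inner_real_def)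
  moreover have "(\<integral>x. h x \<partial>lebesgue_on \<Omega>)
      = (\<Sum>k=1..n. Gamma (1 - \<alpha>) * ip (\<lambda>x. L2_op \<alpha> mesh k (\<lambda>j. e j x)) (\<lambda>x. e k x - e (k - 1) x))"
    unfolding h_def L2_inner_def using d L
    by (subst Bochner_Integration.integral_sum)
      (auto intro!: integrable_mult_right L2_inner_integrable simp del: inner_real_def)
  ultimately show ?thesis
    by (simp add: L2_norm_power2 sum_divide_distrib sum_distrib_left)
qed

text \<open>
  The equation is tested with \<open>u(t\<^sub>k)\<close>, \<open>u\<^sup>k\<close>, \<open>u(t\<^sub>k\<^sub>-\<^sub>1)\<close> and \<open>u\<^sup>k\<^sup>-\<^sup>1\<close> one after another and the results are
  combined, because the weak gradient is a choice made separately for each function: only the chosen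
  gradients of these four functions then occur, and they occur in the combination \<open>G\<^sub>k - G\<^sub>k\<^sub>-\<^sub>1\<close> of the
  differences whose norms are to be estimated. The weights in Young's inequality are such that
  the increments are absorbed by \<open>scheme_coercive\<close>.
\<close>

lemma energy_estimate:
  assumes sol: "L2_scheme_solution \<Omega> \<alpha> mesh N f u0 U" and n: "1 \<le> n" "n \<le> N"
  shows "(nrm (\<lambda>x. grad (u (mesh n)) x - grad (U n) x))\<^sup>2
    \<le> 20 * Gamma (1 - \<alpha>) * (\<Sum>k=1..n. pg.\<tau> k powr \<alpha> * (residual_bound k)\<^sup>2)"
proof -
  have Gp: "0 < Gamma (1 - \<alpha>)" using alpha by (intro Gamma_real_pos) auto
  have Om: "\<Omega> \<in> sets lebesgue" using Omega_lmeasurable by auto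
  \<comment> \<open>\<open>U 0\<close> agrees with \<open>u 0\<close> only almost everywhere; after replacing it the initial error is exactly 0.\<close>
  define V where "V k = (if k = 0 then u 0 else U k)" for k
  define e where "e k = (\<lambda>x. u (mesh k) x - V k x)" for k
  define d where "d k = (\<lambda>x. e k x - e (k - 1) x)" for k
  define G where "G k = (\<lambda>x. if k = 0 then 0 else grad (u (mesh k)) x - grad (U k) x)" for k
  define Le where "Le k = (\<lambda>x. L2_op \<alpha> mesh k (\<lambda>j. e j x))" for k
  have lin: "linear_upto k (L2_op \<alpha> mesh k)" if "1 \<le> k" for k using that by (rule pg.linear_upto_L2_op)
  have UH: "U k \<in> H10 \<Omega>" if "1 \<le> k" "k \<le> N" for k using sol that by (simp add: L2_scheme_solution_def)
  have uH: "u (mesh k) \<in> H10 \<Omega>" if "1 \<le> k" "k \<le> N" for k using that by (intro u_H10 mesh_in_pos)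
  have uL: "u (mesh k) \<in> L2 \<Omega>" if "k \<le> N" for k using that by (intro u_L2 mesh_in)
  have VL: "V k \<in> L2 \<Omega>" if "k \<le> N" for k
    using that UH[of k] u_L2[of 0] T by (cases "k = 0") (auto simp: V_def intro: H10_D)
  have eL: "e k \<in> L2 \<Omega>" if "k \<le> N" for k unfolding e_def using that by (intro L2_diff uL VL)
  have e0: "e 0 = (\<lambda>x. 0)" by (simp add: e_def V_def pg.t0)
  have dL: "d k \<in> L2 \<Omega>" if "k \<le> N" for k unfolding d_def using that by (intro L2_diff eL) auto
  have GL: "G k \<in> L2 \<Omega>" if "k \<le> N" for k
    using that UH[of k] uH[of k] by (cases "k = 0") (auto simp: G_def intro!: L2_diff L2_zero H10_D)
  have LeL: "Le k \<in> L2 \<Omega>" if "1 \<le> k" "k \<le> N" for k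
    unfolding Le_def using that by (intro linear_upto_L2(1)[OF lin] eL) auto
  have "\<forall>k\<in>{1..N}. \<exists>w. has_caputo_derivative \<Omega> \<alpha> (Du 1) (mesh k) w \<and>
      (\<forall>v\<in>H10 \<Omega>. ip w v = - ip (grad (u (mesh k))) (grad v) + ip (f (mesh k)) v)"
    using equation mesh_in_pos unfolding weak_subdiffusion_eq_def by auto
  then obtain W where W: "\<And>k. k \<in> {1..N} \<Longrightarrow> has_caputo_derivative \<Omega> \<alpha> (Du 1) (mesh k) (W k)"
    "\<And>k v. k \<in> {1..N} \<Longrightarrow> v \<in> H10 \<Omega> \<Longrightarrow> ip (W k) v
       = - ip (grad (u (mesh k))) (grad v) + ip (f (mesh k)) v"
    by (metis bchoice)
  define R where "R k = (\<lambda>x. L2_op \<alpha> mesh k (\<lambda>j. u (mesh j) x) - W k x)" for k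
  have RL: "R k \<in> L2 \<Omega>" "nrm (R k) \<le> residual_bound k" if "1 \<le> k" "k \<le> N" for k
    unfolding R_def using that residual_norm[OF that W(1)] by auto
  define Q where "Q k = (\<lambda>x. R k x - Le k x)" for k
  have QL: "Q k \<in> L2 \<Omega>" if "1 \<le> k" "k \<le> N" for k unfolding Q_def using that by (intro L2_diff RL LeL)
  have test: "ip (Q k) v = ip (G k) (grad v)"
    if k: "1 \<le> k" "k \<le> N" and v: "v \<in> H10 \<Omega>" for k v
  proof -
    let ?LV = "\<lambda>x. L2_op \<alpha> mesh k (\<lambda>j. V j x)"
    let ?LU = "\<lambda>x. L2_op \<alpha> mesh k (\<lambda>j. U j x)"
    have LV: "?LV \<in> L2 \<Omega>" using k by (intro linear_upto_L2(1)[OF lin] VL) auto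
    have WL: "W k \<in> L2 \<Omega>" using k by (intro caputo_pairing(1)[OF W(1) mesh_in_pos]) auto
    have "AE x in lebesgue_on \<Omega>. U 0 x = u0 x" using sol by (simp add: L2_scheme_solution_def)
    then have ae: "AE x in lebesgue_on \<Omega>. ?LV x = ?LU x"
      using initial
    proof eventually_elim
      case (elim x)
      then have "(\<lambda>j. V j x) = (\<lambda>j. U j x)" by (auto simp: V_def)
      then show ?case by simp
    qed
    have LUm: "?LU \<in> borel_measurable (lebesgue_on \<Omega>)"
      by (rule borel_measurable_lebesgue_on_AE[OF Om L2_D(1)[OF LV] ae])
    have "ip ?LV v = ip ?LU v"
      unfolding L2_inner_def using L2_D(1)[OF LV] LUm L2_D(1)[OF H10_D(1)[OF v]] ae
      by (intro integral_cong_AE) (auto intro!: borel_measurable_times)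
    also have "\<dots> = - ip (grad (U k)) (grad v) + ip (f (mesh k)) v"
      using sol k v by (simp add: L2_scheme_solution_def)
    finally have 1: "ip ?LV v = - ip (grad (U k)) (grad v) + ip (f (mesh k)) v" .
    have "Q k = (\<lambda>x. ?LV x - W k x)"
      unfolding Q_def R_def Le_def e_def linear_upto_minus[OF lin[OF k(1)]] by (simp add: fun_eq_iff)
    then have "ip (Q k) v = ip ?LV v - ip (W k) v"
      using L2_inner_diff_left[OF LV WL H10_D(1)[OF v]] by simp
    also have "\<dots> = ip (grad (u (mesh k))) (grad v) - ip (grad (U k)) (grad v)"
      using 1 W(2)[of k v] k v by simp
    also have "\<dots> = ip (G k) (grad v)"
      using k L2_inner_diff_left[OF H10_D(2)[OF uH[OF k]] H10_D(2)[OF UH[OF k]] H10_D(2)[OF v]]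
      by (simp add: G_def)
    finally show ?thesis .
  qed
  have test_e: "ip (Q k) (e i) = ip (G k) (G i)" if k: "1 \<le> k" "k \<le> N" and i: "i \<le> N" for k i
  proof (cases "i = 0")
    case True
    then show ?thesis using e0 by (simp add: G_def L2_inner_def)
  next
    case False
    then have i1: "1 \<le> i" by simp
    have "e i = (\<lambda>x. u (mesh i) x - U i x)" using False by (simp add: e_def V_def)
    then have "ip (Q k) (e i) = ip (Q k) (u (mesh i)) - ip (Q k) (U i)"
      using L2_inner_diff_right[OF H10_D(1)[OF uH[OF i1 i]] H10_D(1)[OF UH[OF i1 i]] QL[OF k]] by simp
    also have "\<dots> = ip (G k) (grad (u (mesh i))) - ip (G k) (grad (U i))"
      unfolding test[OF k uH[OF i1 i]] test[OF k UH[OF i1 i]] ..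
    also have "\<dots> = ip (G k) (G i)"
      using False L2_inner_diff_right[OF H10_D(2)[OF uH[OF i1 i]] H10_D(2)[OF UH[OF i1 i]] GL[OF k(2)]]
      by (simp add: G_def)
    finally show ?thesis .
  qed
  have step: "((nrm (G k))\<^sup>2 - (nrm (G (k - 1)))\<^sup>2) / 2 \<le> ip (Q k) (d k)"
    if k: "1 \<le> k" "k \<le> N" for k
  proof -
    have "ip (Q k) (d k) = ip (G k) (G k) - ip (G k) (G (k - 1))"
      unfolding d_def using k test_e[OF k, of k] test_e[OF k, of "k - 1"] QL[OF k] eL[of k] eL[of "k - 1"]
      by (simp add: L2_inner_diff_right)
    moreover have "ip (G k) (G (k - 1)) \<le> nrm (G k) * nrm (G (k - 1))"
    proof -
      have "k - 1 \<le> N" using k by simp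
      then show ?thesis using L2_Cauchy_Schwarz[OF GL[OF k(2)] GL[of "k - 1"]] by simp
    qed
    moreover have "2 * (nrm (G k) * nrm (G (k - 1))) \<le> (nrm (G k))\<^sup>2 + (nrm (G (k - 1)))\<^sup>2"
      using sum_squares_bound[of "nrm (G k)" "nrm (G (k - 1))"] by (simp add: mult.assoc)
    ultimately show ?thesis by (simp add: L2_norm_power2[symmetric] field_simps)
  qed
  have "(nrm (G m))\<^sup>2 / 2 \<le> (\<Sum>k=1..m. ip (Q k) (d k))" if "m \<le> N" for m
    using that
  proof (induction m)
    case 0
    then show ?case by (simp add: G_def L2_norm_def L2_inner_def)
  next
    case (Suc m)
    then show ?case using step[of "Suc m"] by (simp add: diff_divide_distrib)
  qed
  then have "(nrm (G n))\<^sup>2 / 2 \<le> (\<Sum>k=1..n. ip (Q k) (d k))" using n by simp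
  also have "\<dots> = (\<Sum>k=1..n. ip (R k) (d k)) - (\<Sum>k=1..n. ip (Le k) (d k))"
    unfolding sum_subtractf[symmetric] Q_def using n RL LeL dL
    by (intro sum.cong L2_inner_diff_left) auto
  also have "(\<Sum>k=1..n. ip (R k) (d k)) \<le> (\<Sum>k=1..n. 10 * Gamma (1 - \<alpha>) * (pg.\<tau> k powr \<alpha> * (residual_bound k)\<^sup>2)
      + pg.\<tau> k powr (- \<alpha>) * (nrm (d k))\<^sup>2 / (40 * Gamma (1 - \<alpha>)))"
  proof (intro sum_mono)
    fix k assume "k \<in> {1..n}"
    then have k: "1 \<le> k" "k \<le> N" using n by auto
    define p \<rho> \<delta> where "p = pg.\<tau> k powr \<alpha>" and "\<rho> = residual_bound k" and "\<delta> = nrm (d k)"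
    have p: "0 < p" using pg.tau_pos[OF k(1)] by (simp add: p_def)
    define c where "c = Gamma (1 - \<alpha>) * p"
    have c: "0 < c" using p Gp by (simp add: c_def)
    have "ip (R k) (d k) \<le> nrm (R k) * nrm (d k)"
      using L2_Cauchy_Schwarz[OF RL(1)[OF k] dL[OF k(2)]] by simp
    also have "\<dots> \<le> \<rho> * \<delta>"
      unfolding \<rho>_def \<delta>_def using RL(2)[OF k] by (intro mult_right_mono) auto
    also have "\<dots> \<le> 10 * c * \<rho>\<^sup>2 + \<delta>\<^sup>2 / (40 * c)"
    proof -
      have "0 \<le> (20 * c * \<rho> - \<delta>)\<^sup>2 / (40 * c)" using c by simp
      also have "\<dots> = 10 * c * \<rho>\<^sup>2 + \<delta>\<^sup>2 / (40 * c) - \<rho> * \<delta>"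
        using c by (simp add: power2_eq_square field_simps)
      finally show ?thesis by simp
    qed
    also have "\<dots> = 10 * Gamma (1 - \<alpha>) * (p * \<rho>\<^sup>2) + pg.\<tau> k powr (- \<alpha>) * \<delta>\<^sup>2 / (40 * Gamma (1 - \<alpha>))"
      by (simp add: c_def p_def powr_minus_divide)
    finally show "ip (R k) (d k) \<le> 10 * Gamma (1 - \<alpha>) * (pg.\<tau> k powr \<alpha> * (residual_bound k)\<^sup>2)
      + pg.\<tau> k powr (- \<alpha>) * (nrm (d k))\<^sup>2 / (40 * Gamma (1 - \<alpha>))"
      by (simp add: p_def \<rho>_def \<delta>_def)
  qed
  also have "\<dots> = 10 * Gamma (1 - \<alpha>) * (\<Sum>k=1..n. pg.\<tau> k powr \<alpha> * (residual_bound k)\<^sup>2)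
      + (\<Sum>k=1..n. pg.\<tau> k powr (- \<alpha>) * (nrm (d k))\<^sup>2) / 40 / Gamma (1 - \<alpha>)"
    by (simp add: sum.distrib sum_distrib_left sum_divide_distrib)
  also have "(\<Sum>k=1..n. pg.\<tau> k powr (- \<alpha>) * (nrm (d k))\<^sup>2) / 40 / Gamma (1 - \<alpha>)
      \<le> Gamma (1 - \<alpha>) * (\<Sum>k=1..n. ip (Le k) (d k)) / Gamma (1 - \<alpha>)"
    using scheme_coercive[of n e] eL n Gp unfolding d_def Le_def by (intro divide_right_mono) auto
  finally have "(nrm (G n))\<^sup>2 \<le> 20 * Gamma (1 - \<alpha>) * (\<Sum>k=1..n. pg.\<tau> k powr \<alpha> * (residual_bound k)\<^sup>2)"
    using Gp by simp
  then show ?thesis using n by (simp add: G_def)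
qed

text \<open>The second exponent is always below \<open>-1\<close>; the first one decides about the rate.\<close>

lemma error_power_bound:
  assumes sol: "L2_scheme_solution \<Omega> \<alpha> mesh N f u0 U" and n: "1 \<le> n" "n \<le> N"
  shows "(nrm (\<lambda>x. grad (u (mesh n)) x - grad (U n) x))\<^sup>2
    \<le> error_const * real N powr (- (r * \<alpha>)) *
      ((\<Sum>k=1..N. real k powr (r * \<alpha> + \<alpha> - 6)) + (\<Sum>k=1..N. real k powr (1 - \<alpha> - 2 * r - r * \<alpha>)))"
proof -
  define B where "B = truncation_const \<alpha> r (mesh_kappa r) * growth_const / Gamma (1 - \<alpha>)"
  define M where "M = (mesh_kappa r * T) powr \<alpha> * real N powr (- (r * \<alpha>))"
  have Gp: "0 < Gamma (1 - \<alpha>)" using alpha by (intro Gamma_real_pos) auto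
  have "pg.\<tau> k powr \<alpha> * (residual_bound k)\<^sup>2
      \<le> 2 * B\<^sup>2 * M * (real k powr (r * \<alpha> + \<alpha> - 6) + real k powr (1 - \<alpha> - 2 * r - r * \<alpha>))"
    if k: "k \<in> {1..n}" for k
  proof -
    define a b where "a = real k powr (\<alpha> - 3)" and "b = real k powr (1/2 - r * (1 + \<alpha>))"
    have "pg.\<tau> k \<le> mesh_kappa r * mesh_scale T r N * real k powr (r - 1)" using k by (intro pg.tau_upper) auto
    also have "\<dots> \<le> mesh_kappa r * (T * real N powr (- r)) * real k powr (r - 1)"
      using pg.kappa mesh_scale_le[OF r T N] by (intro mult_right_mono mult_left_mono) auto
    finally have "pg.\<tau> k powr \<alpha> \<le> (mesh_kappa r * (T * real N powr (- r)) * real k powr (r - 1)) powr \<alpha>"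
      using pg.tau_nonneg alpha by (intro powr_mono2) auto
    also have "\<dots> = M * real k powr ((r - 1) * \<alpha>)"
      using pg.kappa T by (simp add: M_def powr_mult powr_powr)
    finally have 1: "pg.\<tau> k powr \<alpha> \<le> M * real k powr ((r - 1) * \<alpha>)" .
    have "(a + b)\<^sup>2 \<le> 2 * (a\<^sup>2 + b\<^sup>2)"
      using sum_squares_bound[of a b] by (simp add: power2_sum)
    then have "B\<^sup>2 * (a + b)\<^sup>2 \<le> B\<^sup>2 * (2 * (a\<^sup>2 + b\<^sup>2))" by (intro mult_left_mono) auto
    then have 2: "(residual_bound k)\<^sup>2 \<le> B\<^sup>2 * (2 * (a\<^sup>2 + b\<^sup>2))"
    proof -
      have "residual_bound k = B * (a + b)" by (simp add: residual_bound_def B_def a_def b_def)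
      then show ?thesis using \<open>B\<^sup>2 * (a + b)\<^sup>2 \<le> _\<close> by (simp only: power_mult_distrib)
    qed
    have "pg.\<tau> k powr \<alpha> * (residual_bound k)\<^sup>2
        \<le> (M * real k powr ((r - 1) * \<alpha>)) * (B\<^sup>2 * (2 * (a\<^sup>2 + b\<^sup>2)))"
      using 1 2 by (intro mult_mono) (auto simp: M_def)
    also have "\<dots> = 2 * B\<^sup>2 * M * (real k powr ((r - 1) * \<alpha>) * a\<^sup>2 + real k powr ((r - 1) * \<alpha>) * b\<^sup>2)"
      by (simp add: algebra_simps)
    also have "real k powr ((r - 1) * \<alpha>) * a\<^sup>2 = real k powr (r * \<alpha> + \<alpha> - 6)"
      by (simp add: a_def power2_eq_square powr_add[symmetric] algebra_simps)
    also have "real k powr ((r - 1) * \<alpha>) * b\<^sup>2 = real k powr (1 - \<alpha> - 2 * r - r * \<alpha>)"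
      by (simp add: b_def power2_eq_square powr_add[symmetric] algebra_simps)
    finally show ?thesis .
  qed
  then have "(\<Sum>k=1..n. pg.\<tau> k powr \<alpha> * (residual_bound k)\<^sup>2)
      \<le> (\<Sum>k=1..n. 2 * B\<^sup>2 * M * (real k powr (r * \<alpha> + \<alpha> - 6) + real k powr (1 - \<alpha> - 2 * r - r * \<alpha>)))"
    by (rule sum_mono)
  also have "\<dots> \<le> (\<Sum>k=1..N. 2 * B\<^sup>2 * M * (real k powr (r * \<alpha> + \<alpha> - 6) + real k powr (1 - \<alpha> - 2 * r - r * \<alpha>)))"
    using n by (intro sum_mono2) (auto simp: M_def)
  also have "\<dots> = 2 * B\<^sup>2 * M * ((\<Sum>k=1..N. real k powr (r * \<alpha> + \<alpha> - 6)) + (\<Sum>k=1..N. real k powr (1 - \<alpha> - 2 * r - r * \<alpha>)))"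
    by (simp add: sum_distrib_left[symmetric] sum.distrib)
  finally have "20 * Gamma (1 - \<alpha>) * (\<Sum>k=1..n. pg.\<tau> k powr \<alpha> * (residual_bound k)\<^sup>2)
      \<le> 20 * Gamma (1 - \<alpha>) * (2 * B\<^sup>2 * M * ((\<Sum>k=1..N. real k powr (r * \<alpha> + \<alpha> - 6)) + (\<Sum>k=1..N. real k powr (1 - \<alpha> - 2 * r - r * \<alpha>))))"
    using Gp by (intro mult_left_mono) auto
  then show ?thesis
    using energy_estimate[OF sol n] by (simp add: error_const_def B_def M_def ac_simps)
qed

end

end

section \<open>Sums of powers and convergence rates\<close>

lemma sum_powr_bounded:
  fixes z :: real
  assumes "z < - 1"
  shows "\<exists>Z\<ge>0. \<forall>N. (\<Sum>k=1..N. real k powr z) \<le> Z"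
proof -
  have s: "summable (\<lambda>k. real k powr z)" using assms by (simp add: summable_real_powr_iff)
  show ?thesis
  proof (intro exI conjI allI)
    show "0 \<le> (\<Sum>k. real k powr z)" by (intro suminf_nonneg s) simp
    show "(\<Sum>k=1..N. real k powr z) \<le> (\<Sum>k. real k powr z)" for N
      by (intro sum_le_suminf s) auto
  qed
qed

lemma sum_inverse_le_ln: "1 \<le> N \<Longrightarrow> (\<Sum>k=1..N. real k powr (- 1)) \<le> 1 + ln (real N)"
proof (induction N rule: nat_induct_at_least)
  case (Suc n)
  have "ln (real n / real (Suc n)) \<le> real n / real (Suc n) - 1"
    using Suc by (intro ln_le_minus_one) auto
  also have "\<dots> = - (real (Suc n) powr (- 1))" by (simp add: powr_minus_divide field_simps)
  finally have "real (Suc n) powr (- 1) \<le> ln (real (Suc n)) - ln (real n)"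
    using Suc by (simp add: ln_div)
  then show ?case using Suc by simp
qed simp

lemma sum_powr_le_powr:
  fixes z :: real
  assumes z: "- 1 < z"
  shows "\<exists>C\<ge>0. \<forall>N. (\<Sum>k=1..N. real k powr z) \<le> C * real N powr (z + 1)"
proof (cases "0 \<le> z")
  case True
  have "(\<Sum>k=1..N. real k powr z) \<le> 1 * real N powr (z + 1)" for N
  proof -
    have "(\<Sum>k=1..N. real k powr z) \<le> (\<Sum>k=1..N. real N powr z)"
      using True by (intro sum_mono powr_mono2) auto
    also have "\<dots> = real N powr (z + 1)" using powr_mult_base[of "real N" z] by (simp add: add.commute)
    finally show ?thesis by simp
  qed
  then show ?thesis by (intro exI[of _ 1]) auto
next
  case False
  have "(z + 1) * (\<Sum>k=1..N. real k powr z) \<le> real N powr (z + 1)" for N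
  proof (induction N)
    case (Suc n)
    have "(z + 1) * real (Suc n) powr z \<le> real (Suc n) powr (z + 1) - real n powr (z + 1)"
    proof (cases "n = 0")
      case True
      then show ?thesis using False z by simp
    next
      case n: False
      then have "\<exists>x. real n < x \<and> x < real (Suc n) \<and> real (Suc n) powr (z + 1) - real n powr (z + 1)
          = (real (Suc n) - real n) * ((z + 1) * x powr z)"
        by (intro MVT2) (use has_real_derivative_powr[of _ "z + 1"] in auto)
      then obtain x where x: "real n < x" "x < real (Suc n)"
        "real (Suc n) powr (z + 1) - real n powr (z + 1) = (z + 1) * x powr z" by auto
      have "real (Suc n) powr z \<le> x powr z" using x n False by (intro powr_mono2') auto
      then show ?thesis unfolding x(3) using z by (intro mult_left_mono) auto
    qed
    then show ?case using Suc by (simp add: distrib_left)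
  qed simp
  then have "(\<Sum>k=1..N. real k powr z) \<le> 1 / (z + 1) * real N powr (z + 1)" for N
    using z by (simp add: pos_le_divide_eq mult.commute)
  then show ?thesis using z by (intro exI[of _ "1 / (z + 1)"]) auto
qed

lemma ln_ge_half: "2 \<le> N \<Longrightarrow> 1 / 2 \<le> ln (real N)"
proof -
  assume N: "2 \<le> N"
  have "1 / 2 \<le> ln (2 :: real)" using ln_le_minus_one[of "1 / 2 :: real"] by (simp add: ln_div)
  also have "\<dots> \<le> ln (real N)" using N by simp
  finally show ?thesis .
qed

theorem theorem5p4:
  fixes \<alpha> T r :: real
    and \<Omega> :: "(real^'d) set"
    and u f :: "real \<Rightarrow> real^'d \<Rightarrow> real"
    and u0 :: "real^'d \<Rightarrow> real"
    and Du :: "nat \<Rightarrow> real \<Rightarrow> real^'d \<Rightarrow> real"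
    and C\<^sub>l :: "nat \<Rightarrow> real"
  assumes alpha: "0 < \<alpha>" "\<alpha> < 1"
    and T: "0 < T"
    and r: "1 < r"
    and domain: "bounded_lipschitz_domain \<Omega>"
    and regularity: "C_time_H10 3 \<Omega> T u Du"
    and continuity: "C_time_L2 \<Omega> T u"
    and initial: "AE x in lebesgue_on \<Omega>. u 0 x = u0 x"
    and source: "\<forall>t\<in>{0<..T}. f t \<in> L2 \<Omega>"
    and equation: "weak_subdiffusion_eq \<Omega> T \<alpha> f u (Du 1)"
    and bounds: "\<forall>l\<in>{1, 3}. \<forall>t\<in>{0<..T}. AE x in lebesgue_on \<Omega>.
                   \<bar>Du l t x\<bar> \<le> C\<^sub>l l * (1 + t powr (\<alpha> - real l))"
  shows "\<exists>C. \<forall>N\<ge>2. \<forall>U. L2_scheme_solution \<Omega> \<alpha> (graded_mesh T r N) N f u0 U \<longrightarrow>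
     (\<forall>n\<in>{1..N}.
        let err = L2_norm \<Omega> (\<lambda>x. weak_grad \<Omega> (u (graded_mesh T r N n)) x - weak_grad \<Omega> (U n) x)
        in (1 < r \<and> r < max 1 (1 / \<alpha> - 1) \<longrightarrow>
              err \<le> C * real N powr (- (2 * r * \<alpha> + \<alpha> - 1) / 2)) \<and>
           (max 1 (1 / \<alpha> - 1) < r \<and> r < 5 / \<alpha> - 1 \<longrightarrow>
              err \<le> C * real N powr (- r * \<alpha> / 2)) \<and>
           (r > 5 / \<alpha> - 1 \<longrightarrow>
              err \<le> C * real N powr (- (5 - \<alpha>) / 2)) \<and>
           (r = 1 / \<alpha> - 1 \<and> \<alpha> < 1 / 2 \<or> r = 5 / \<alpha> - 1 \<longrightarrow>
              err \<le> C * real N powr (- r * \<alpha> / 2) * ln (real N)))"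
proof -
  interpret subdiffusion \<alpha> T r \<Omega> u f u0 Du C\<^sub>l
    using alpha T r domain regularity continuity initial equation bounds by unfold_locales
  define err where "err N U n = L2_norm \<Omega> (\<lambda>x. weak_grad \<Omega> (u (graded_mesh T r N n)) x - weak_grad \<Omega> (U n) x)" for N U n
  define S where "S N = (\<Sum>k=1..N. real k powr (r * \<alpha> + \<alpha> - 6))" for N :: nat
  have ra: "0 < r * \<alpha>" using r alpha by simp
  obtain Z where Z: "0 \<le> Z" "\<And>N. (\<Sum>k=1..N. real k powr (1 - \<alpha> - 2 * r - r * \<alpha>)) \<le> Z"
    using sum_powr_bounded[of "1 - \<alpha> - 2 * r - r * \<alpha>"] ra r alpha by auto
  define Q where "Q = error_const"
  have Q: "0 \<le> Q" unfolding Q_def error_const_def using alpha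
    by (intro mult_nonneg_nonneg less_imp_le[OF Gamma_real_pos]) auto
  have main: "(err N U n)\<^sup>2 \<le> Q * real N powr (- (r * \<alpha>)) * (S N + Z)"
    if "2 \<le> N" "L2_scheme_solution \<Omega> \<alpha> (graded_mesh T r N) N f u0 U" "n \<in> {1..N}" for N U n
  proof -
    have "(err N U n)\<^sup>2 \<le> Q * real N powr (- (r * \<alpha>)) * (S N + (\<Sum>k=1..N. real k powr (1 - \<alpha> - 2 * r - r * \<alpha>)))"
      unfolding err_def S_def Q_def using that by (intro error_power_bound) auto
    also have "\<dots> \<le> Q * real N powr (- (r * \<alpha>)) * (S N + Z)"
      using Z(2)[of N] Q by (intro mult_left_mono) auto
    finally show ?thesis .
  qed
  have root: "err N U n \<le> sqrt D * y" if "(err N U n)\<^sup>2 \<le> D * y\<^sup>2" "0 \<le> y" for N U n D y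
  proof -
    have "sqrt ((err N U n)\<^sup>2) \<le> sqrt (D * y\<^sup>2)" using that(1) by (rule real_sqrt_le_mono)
    then show ?thesis using that(2) by (simp add: real_sqrt_mult err_def)
  qed
  have half: "(real N powr (- r * \<alpha> / 2))\<^sup>2 = real N powr (- (r * \<alpha>))" for N
    by (simp add: power2_eq_square powr_add[symmetric] mult.commute)
  have crit: "r < 5 / \<alpha> - 1 \<longleftrightarrow> r * \<alpha> + \<alpha> - 6 < - 1" "r = 5 / \<alpha> - 1 \<longleftrightarrow> r * \<alpha> + \<alpha> - 6 = - 1"
    using alpha by (auto simp: field_simps)
  have rates: "\<exists>C\<ge>0. \<forall>N\<ge>2. \<forall>U. L2_scheme_solution \<Omega> \<alpha> (graded_mesh T r N) N f u0 U \<longrightarrow> (\<forall>n\<in>{1..N}.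
      (r < 5 / \<alpha> - 1 \<longrightarrow> err N U n \<le> C * real N powr (- r * \<alpha> / 2)) \<and>
      (r = 5 / \<alpha> - 1 \<longrightarrow> err N U n \<le> C * (real N powr (- r * \<alpha> / 2) * ln (real N))) \<and>
      (r > 5 / \<alpha> - 1 \<longrightarrow> err N U n \<le> C * real N powr (- (5 - \<alpha>) / 2)))"
  proof (cases "r * \<alpha> + \<alpha> - 6" "- 1 :: real" rule: linorder_cases)
    case less
    obtain Z' where Z': "0 \<le> Z'" "\<And>N. S N \<le> Z'"
      using sum_powr_bounded[OF less] by (auto simp: S_def)
    have "err N U n \<le> sqrt (Q * (Z' + Z)) * real N powr (- r * \<alpha> / 2)"
      if "2 \<le> N" "L2_scheme_solution \<Omega> \<alpha> (graded_mesh T r N) N f u0 U" "n \<in> {1..N}" for N U n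
    proof (rule root)
      have "Q * real N powr (- (r * \<alpha>)) * (S N + Z) \<le> Q * real N powr (- (r * \<alpha>)) * (Z' + Z)"
        using Z'(2)[of N] Q by (intro mult_left_mono) auto
      then show "(err N U n)\<^sup>2 \<le> Q * (Z' + Z) * (real N powr (- r * \<alpha> / 2))\<^sup>2"
        using main[OF that] unfolding half by (simp add: ac_simps)
    qed simp
    then show ?thesis using less crit Q Z Z' by (intro exI[of _ "sqrt (Q * (Z' + Z))"]) auto
  next
    case equal
    have E: "err N U n \<le> sqrt (Q * (6 + 4 * Z)) * (real N powr (- r * \<alpha> / 2) * ln (real N))"
      if N: "2 \<le> N" and "L2_scheme_solution \<Omega> \<alpha> (graded_mesh T r N) N f u0 U" "n \<in> {1..N}" for N U n
    proof (rule root)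
      define l where "l = ln (real N)"
      have l: "1 \<le> 2 * l" using ln_ge_half[OF N] by (simp add: l_def)
      then have l2: "l * 1 \<le> l * (2 * l)" "1 * 1 \<le> (2 * l) * (2 * l)"
        by (intro mult_left_mono mult_mono; simp)+
      have "Z * 1 \<le> Z * (4 * (l * l))" using l2 Z by (intro mult_left_mono) auto
      moreover have "S N \<le> 1 + l" using sum_inverse_le_ln[of N] N unfolding S_def equal l_def by simp
      ultimately have "S N + Z \<le> (6 + 4 * Z) * l\<^sup>2" using l2 by (simp add: power2_eq_square algebra_simps)
      then have "Q * real N powr (- (r * \<alpha>)) * (S N + Z) \<le> Q * real N powr (- (r * \<alpha>)) * ((6 + 4 * Z) * l\<^sup>2)"
        using Q by (intro mult_left_mono) auto
      then show "(err N U n)\<^sup>2 \<le> Q * (6 + 4 * Z) * (real N powr (- r * \<alpha> / 2) * ln (real N))\<^sup>2"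
        using main[OF that] unfolding power_mult_distrib half l_def by (simp add: ac_simps)
    qed (use N in auto)
    have r5: "\<not> r < 5 / \<alpha> - 1" "\<not> 5 / \<alpha> - 1 < r" using equal crit by auto
    show ?thesis
    proof (intro exI[of _ "sqrt (Q * (6 + 4 * Z))"] conjI allI impI ballI)
      show "0 \<le> sqrt (Q * (6 + 4 * Z))" using Q Z by simp
    qed (use E r5 in blast)+
  next
    case greater
    obtain D where D: "0 \<le> D" "\<And>N. S N \<le> D * real N powr (r * \<alpha> + \<alpha> - 6 + 1)"
      using sum_powr_le_powr[OF greater] by (auto simp: S_def)
    have "err N U n \<le> sqrt (Q * (D + Z)) * real N powr (- (5 - \<alpha>) / 2)"
      if N: "2 \<le> N" and "L2_scheme_solution \<Omega> \<alpha> (graded_mesh T r N) N f u0 U" "n \<in> {1..N}" for N U n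
    proof (rule root)
      have one: "1 \<le> real N powr (r * \<alpha> + \<alpha> - 6 + 1)"
        using N greater by (intro ge_one_powr_ge_zero) auto
      have "S N + Z * 1 \<le> D * real N powr (r * \<alpha> + \<alpha> - 6 + 1) + Z * real N powr (r * \<alpha> + \<alpha> - 6 + 1)"
        using D(2)[of N] one Z by (intro add_mono mult_left_mono) auto
      then have "Q * real N powr (- (r * \<alpha>)) * (S N + Z)
          \<le> Q * real N powr (- (r * \<alpha>)) * ((D + Z) * real N powr (r * \<alpha> + \<alpha> - 6 + 1))"
        using Q by (intro mult_left_mono) (auto simp: algebra_simps)
      also have "\<dots> = Q * (D + Z) * (real N powr (- (r * \<alpha>)) * real N powr (r * \<alpha> + \<alpha> - 6 + 1))" by simp
      also have "real N powr (- (r * \<alpha>)) * real N powr (r * \<alpha> + \<alpha> - 6 + 1) = (real N powr (- (5 - \<alpha>) / 2))\<^sup>2"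
        by (simp add: power2_eq_square powr_add[symmetric])
      finally show "(err N U n)\<^sup>2 \<le> Q * (D + Z) * (real N powr (- (5 - \<alpha>) / 2))\<^sup>2"
        using main[OF that] by simp
    qed simp
    then show ?thesis using greater crit Q Z D by (intro exI[of _ "sqrt (Q * (D + Z))"]) auto
  qed
  then obtain C where C: "0 \<le> C" and rate: "\<And>N U n. 2 \<le> N \<Longrightarrow> L2_scheme_solution \<Omega> \<alpha> (graded_mesh T r N) N f u0 U \<Longrightarrow> n \<in> {1..N} \<Longrightarrow>
      (r < 5 / \<alpha> - 1 \<longrightarrow> err N U n \<le> C * real N powr (- r * \<alpha> / 2)) \<and>
      (r = 5 / \<alpha> - 1 \<longrightarrow> err N U n \<le> C * (real N powr (- r * \<alpha> / 2) * ln (real N))) \<and>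
      (r > 5 / \<alpha> - 1 \<longrightarrow> err N U n \<le> C * real N powr (- (5 - \<alpha>) / 2))"
    by blast
  have small: "1 / \<alpha> - 1 < 5 / \<alpha> - 1" using alpha by (simp add: divide_strict_right_mono)
  have weaker: "r < 5 / \<alpha> - 1 \<and> - r * \<alpha> / 2 \<le> - (2 * r * \<alpha> + \<alpha> - 1) / 2" if "r < max 1 (1 / \<alpha> - 1)"
  proof -
    have "r < 1 / \<alpha> - 1" using that r by (auto simp: max_def split: if_splits)
    then show ?thesis using alpha small by (simp add: field_simps)
  qed
  show ?thesis
  proof (intro exI[of _ "2 * C"] allI impI ballI)
    fix N :: nat and U n
    assume N: "2 \<le> N" and "L2_scheme_solution \<Omega> \<alpha> (graded_mesh T r N) N f u0 U" "n \<in> {1..N}"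
    note e = rate[OF this]
    have twice: "err N U n \<le> 2 * C * y" if "err N U n \<le> C * x" "x \<le> 2 * y" for x y
    proof -
      have "C * x \<le> C * (2 * y)" using that(2) C by (rule mult_left_mono)
      then show ?thesis using that(1) by simp
    qed
    define X where "X = real N powr (- r * \<alpha> / 2)"
    have X: "0 \<le> X" by (simp add: X_def)
    have l: "X * 1 \<le> X * (2 * ln (real N))" using ln_ge_half[OF N] X by (intro mult_left_mono) auto
    have a: "err N U n \<le> 2 * C * real N powr (- (2 * r * \<alpha> + \<alpha> - 1) / 2)" if "r < max 1 (1 / \<alpha> - 1)"
    proof (rule twice)
      show "err N U n \<le> C * X" using e weaker[OF that] by (simp add: X_def)
      have "X \<le> real N powr (- (2 * r * \<alpha> + \<alpha> - 1) / 2)"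
        unfolding X_def using N weaker[OF that] by (intro powr_mono) auto
      then show "X \<le> 2 * real N powr (- (2 * r * \<alpha> + \<alpha> - 1) / 2)"
        using powr_ge_zero[of "real N" "- (2 * r * \<alpha> + \<alpha> - 1) / 2"] by linarith
    qed
    have b: "err N U n \<le> 2 * C * X" if "r < 5 / \<alpha> - 1"
      using e that X by (intro twice[of X]) (auto simp: X_def)
    have c: "err N U n \<le> 2 * C * real N powr (- (5 - \<alpha>) / 2)" if "r > 5 / \<alpha> - 1"
      using e that by (intro twice[of "real N powr (- (5 - \<alpha>) / 2)"]) auto
    have d: "err N U n \<le> 2 * C * (X * ln (real N))" if "r = 1 / \<alpha> - 1 \<or> r = 5 / \<alpha> - 1"
      using that
    proof
      assume "r = 1 / \<alpha> - 1"
      then show ?thesis using e small l by (intro twice[of X]) (auto simp: X_def)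
    next
      assume "r = 5 / \<alpha> - 1"
      then have "err N U n \<le> C * (X * ln (real N))" using e by (simp add: X_def)
      moreover have "0 \<le> X * ln (real N)" using X N by simp
      ultimately show ?thesis by (intro twice[of "X * ln (real N)"]) auto
    qed
    show "let err = L2_norm \<Omega> (\<lambda>x. weak_grad \<Omega> (u (graded_mesh T r N n)) x - weak_grad \<Omega> (U n) x)
        in (1 < r \<and> r < max 1 (1 / \<alpha> - 1) \<longrightarrow>
              err \<le> 2 * C * real N powr (- (2 * r * \<alpha> + \<alpha> - 1) / 2)) \<and>
           (max 1 (1 / \<alpha> - 1) < r \<and> r < 5 / \<alpha> - 1 \<longrightarrow>
              err \<le> 2 * C * real N powr (- r * \<alpha> / 2)) \<and>
           (r > 5 / \<alpha> - 1 \<longrightarrow>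
              err \<le> 2 * C * real N powr (- (5 - \<alpha>) / 2)) \<and>
           (r = 1 / \<alpha> - 1 \<and> \<alpha> < 1 / 2 \<or> r = 5 / \<alpha> - 1 \<longrightarrow>
              err \<le> 2 * C * real N powr (- r * \<alpha> / 2) * ln (real N))"
      unfolding Let_def err_def[symmetric] X_def[symmetric]
      using a b c d by (auto simp: mult.assoc)
  qed
qed

end
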